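(* Let $n\geqslant 2$, let $A_0>0$, $R_0>0$, $\delta>0$, let $D\subset\mathbb{R}^n$ be a domain, let $x_0\in\partial D$, $x_0\neq\infty$, and let $Q:D\to[0,\infty]$ be a Lebesgue measurable function (extended by zero outside $D$). Assume that the following conditions hold: 1) there is $r_0'=r_0'(x_0)>0$ such that the set $B(x_0,r)\cap D$ is connected for any $0<r<r_0'$; 2) there is $0<C=C(x_0)<\infty$ such that $$\limsup_{\varepsilon\to 0}\frac{1}{\Omega_n\,\varepsilon^n}\int_{B(x_0,\varepsilon)\cap D}Q(x)\,dm(x)\leqslant C.$$ Then there are $\widetilde{\varepsilon_0}=\widetilde{\varepsilon_0}(x_0)>0$ and a number $\alpha=\alpha(n,\delta,C,R_0,x_0)>0$ such that $$|f(x)-f(y)|\leqslant\alpha\cdot\max\{|x-x_0|^{\beta_n},\,|y-x_0|^{\beta_n}\}$$ holds for any $x,y\in B(x_0,\widetilde{\varepsilon_0})\cap D$ and all $f\in\mathfrak{R}^{A_0,R_0}_{Q,\delta}(D,x_0)$, where $$\beta_n=\left(\frac{n\log 2}{A_0\,C\,2^{n+1}}\right)^{\frac{1}{n-1}}.$$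
   Context: Notation: $B(x_0,r)=\{x\in\mathbb{R}^n:|x-x_0|<r\}$, $S(x_0,r)=\{x\in\mathbb{R}^n:|x-x_0|=r\}$, $A(x_0,r_1,r_2)=\{x\in\mathbb{R}^n:r_1<|x-x_0|<r_2\}$; $m$ is Lebesgue measure in $\mathbb{R}^n$ and $\Omega_n=m(B(0,1))$. $\overline{\mathbb{R}^n}=\mathbb{R}^n\cup\{\infty\}$, and boundaries of domains are taken in $\overline{\mathbb{R}^n}$. A continuum is a compact connected set; $\mathrm{diam}$ is the Euclidean diameter. The chordal metric on $\overline{\mathbb{R}^n}$ is $h(x,y)=\frac{|x-y|}{\sqrt{1+|x|^2}\sqrt{1+|y|^2}}$ for $x\neq\infty\neq y$ and $h(x,\infty)=\frac{1}{\sqrt{1+|x|^2}}$; for sets, $h(E,F)=\inf_{x\in E,\,y\in F}h(x,y)$. For sets $E,F$ and $G$, $\Gamma(E,F,G)$ is the family of all paths (continuous maps) $\gamma:[a,b]\to G$ with $\gamma(a)\in E$, $\gamma(b)\in F$. For a family $\Gamma$ of paths in the domain of $f$, $f(\Gamma)=\{f\circ\gamma:\gamma\in\Gamma\}$. $M(\Gamma)$ is the conformal modulus of the path family $\Gamma$: the infimum of $\int_{\mathbb{R}^n}\varrho^n\,dm$ over all Borel $\varrho:\mathbb{R}^n\to[0,\infty]$ with $\int_\gamma\varrho\,ds\geqslant1$ for every locally rectifiable $\gamma\in\Gamma$. Ring $Q$-condition at $x_0$: a mapping $f:D\to\overline{\mathbb{R}^n}$ is a ring $Q$-mapping at $x_0\in\overline{D}$,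 $x_0\neq\infty$, if for some $r_0=r_0(x_0)>0$ the inequality $$M\big(f(\Gamma(S(x_0,r_1),S(x_0,r_2),D))\big)\leqslant\int_{A(x_0,r_1,r_2)}Q(x)\,\eta^n(|x-x_0|)\,dm(x)$$ holds for all $0<r_1<r_2<r_0$ and all Lebesgue measurable $\eta:(r_1,r_2)\to[0,\infty]$ with $\int_{r_1}^{r_2}\eta(r)\,dr\geqslant1$. The radius $r_0=r_0(x_0)$ depends only on the point $x_0$; it is the same for all mappings of the family considered. A domain $G\subset\mathbb{R}^n$ satisfies the quasiextremal distance ($QED$) condition with constant $A_0$ if $M(\Gamma(E,F,\mathbb{R}^n))\leqslant A_0\,M(\Gamma(E,F,G))$ for any continua $E,F\subset G$. A continuous mapping $f:D\to\mathbb{R}^n$ is open if images of open sets are open, discrete if preimages of points consist of isolated points, and closed if $C(f,\partial D)\subset\partial f(D)$, where $C(f,\partial D)$ is the cluster set of $f$ on $\partial D$ (all limits in $\overline{\mathbb{R}^n}$ of $f(x_k)$ along sequences $x_k\in D$ converging to a point of $\partial D$). $\mathfrak{R}^{A_0,R_0}_{Q,\delta}(D,x_0)$ is the family of all open, discrete and closed ring $Q$-mappings $f:D\to B(0,R_0)$ at $x_0$ such that the domain $D_f'=f(D)$ satisfies the $QED$ condition with constant $A_0$ and, in addition, there exists a path connected continuum $K_f\subset D_f'$ such that $\mathrm{diam}\,K_f\geqslant\delta$ and $h(f^{-1}(K_f),\partial D)\geqslant\delta$. *)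

theory Defs
  imports "HOL-Analysis.Analysis"
begin

text \<open>
  A path is a continuous map on [0, 1] (\<^const>\<open>path\<close>); a path on [a, b] is an affine
  reparametrization of one, and lengths, path integrals and moduli do not see the difference.
  Functions on a domain D are total functions of which only the values on D are ever used.
\<close>

definition domain :: "(real^'n) set \<Rightarrow> bool" where
  "domain D \<longleftrightarrow> open D \<and> connected D \<and> D \<noteq> {}"

definition continuum :: "(real^'n) set \<Rightarrow> bool" where
  "continuum K \<longleftrightarrow> compact K \<and> connected K"


subsection \<open>The extended space and the chordal metric\<close>

text \<open>\<^const>\<open>None\<close> is the point at infinity.\<close>

abbreviation ext_space :: "(real^'n) option topology" where
  "ext_space \<equiv> Alexandroff_compactification euclidean"

definition ext_boundary :: "(real^'n) set \<Rightarrow> (real^'n) option set" where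
  "ext_boundary D = ext_space frontier_of (Some ` D)"

fun chordal :: "(real^'n) option \<Rightarrow> (real^'n) option \<Rightarrow> real" where
  "chordal (Some x) (Some y) = norm (x - y) / (sqrt (1 + (norm x)\<^sup>2) * sqrt (1 + (norm y)\<^sup>2))"
| "chordal (Some x) None = 1 / sqrt (1 + (norm x)\<^sup>2)"
| "chordal None (Some y) = 1 / sqrt (1 + (norm y)\<^sup>2)"
| "chordal None None = 0"

text \<open>Extended real values, so that the infimum over an empty set is infinite.\<close>

definition chordal_setdist :: "(real^'n) option set \<Rightarrow> (real^'n) option set \<Rightarrow> ereal" where
  "chordal_setdist E F = (INF x\<in>E. INF y\<in>F. ereal (chordal x y))"


subsection \<open>Path integrals and the conformal modulus\<close>

text \<open>Length of the restriction of \<open>\<gamma>\<close> to [0, t].\<close>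

definition arc_length :: "(real \<Rightarrow> real^'n) \<Rightarrow> real \<Rightarrow> ennreal" where
  "arc_length \<gamma> t =
     (SUP ts \<in> {ts. sorted ts \<and> set ts \<subseteq> {0..t}}.
        \<Sum>i<length ts - 1. ennreal (dist (\<gamma> (ts ! i)) (\<gamma> (ts ! Suc i))))"

text \<open>Since the parameter interval is compact, this is the same as local rectifiability.\<close>

definition rectifiable :: "(real \<Rightarrow> real^'n) \<Rightarrow> bool" where
  "rectifiable \<gamma> \<longleftrightarrow> arc_length \<gamma> 1 < \<infinity>"

text \<open>
  Arc-length parametrization of a rectifiable path: for s between 0 and the length, some initial
  piece of \<open>\<gamma>\<close> has length s, and all such pieces end at the same point.
\<close>

definition arc_param :: "(real \<Rightarrow> real^'n) \<Rightarrow> real \<Rightarrow> real^'n" where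
  "arc_param \<gamma> s = (THE p. \<exists>t\<in>{0..1}. arc_length \<gamma> t = ennreal s \<and> p = \<gamma> t)"

definition path_integral :: "(real \<Rightarrow> real^'n) \<Rightarrow> (real^'n \<Rightarrow> ennreal) \<Rightarrow> ennreal" where
  "path_integral \<gamma> \<rho> = (\<integral>\<^sup>+s\<in>{0..enn2real (arc_length \<gamma> 1)}. \<rho> (arc_param \<gamma> s) \<partial>lborel)"

definition admissible :: "(real^'n \<Rightarrow> ennreal) \<Rightarrow> (real \<Rightarrow> real^'n) set \<Rightarrow> bool" where
  "admissible \<rho> \<Gamma> \<longleftrightarrow>
     \<rho> \<in> borel_measurable borel \<and> (\<forall>\<gamma>\<in>\<Gamma>. rectifiable \<gamma> \<longrightarrow> 1 \<le> path_integral \<gamma> \<rho>)"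

definition conf_modulus :: "(real \<Rightarrow> real^'n) set \<Rightarrow> ennreal" where
  "conf_modulus \<Gamma> = (INF \<rho> \<in> {\<rho>. admissible \<rho> \<Gamma>}. \<integral>\<^sup>+x. \<rho> x ^ CARD('n) \<partial>lborel)"

definition path_family ::
    "(real^'n) set \<Rightarrow> (real^'n) set \<Rightarrow> (real^'n) set \<Rightarrow> (real \<Rightarrow> real^'n) set" where
  "path_family E F G =
     {\<gamma>. path \<gamma> \<and> path_image \<gamma> \<subseteq> G \<and> pathstart \<gamma> \<in> E \<and> pathfinish \<gamma> \<in> F}"


subsection \<open>Ring Q-mappings and the QED condition\<close>

definition annulus :: "real^'n \<Rightarrow> real \<Rightarrow> real \<Rightarrow> (real^'n) set" where
  "annulus x0 r1 r2 = {x. r1 < norm (x - x0) \<and> norm (x - x0) < r2}"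

text \<open>
  The radius r0 is a parameter rather than existentially quantified, because it is the same for
  all mappings of a family. Only finite-valued mappings are needed.
\<close>

definition ring_Q_mapping ::
    "real \<Rightarrow> (real^'n \<Rightarrow> ennreal) \<Rightarrow> (real^'n) set \<Rightarrow> real^'n \<Rightarrow> (real^'n \<Rightarrow> real^'n) \<Rightarrow> bool" where
  "ring_Q_mapping r0 Q D x0 f \<longleftrightarrow>
     (\<forall>r1 r2 (\<eta> :: real \<Rightarrow> ennreal).
        0 < r1 \<and> r1 < r2 \<and> r2 < r0 \<and>
        \<eta> \<in> borel_measurable (lebesgue_on {r1<..<r2}) \<and>
        1 \<le> (\<integral>\<^sup>+r\<in>{r1<..<r2}. \<eta> r \<partial>lebesgue) \<longrightarrow>
        conf_modulus ((\<lambda>\<gamma>. f \<circ> \<gamma>) ` path_family (sphere x0 r1) (sphere x0 r2) D)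
          \<le> (\<integral>\<^sup>+x\<in>annulus x0 r1 r2. Q x * \<eta> (norm (x - x0)) ^ CARD('n) \<partial>lebesgue))"

definition QED :: "real \<Rightarrow> (real^'n) set \<Rightarrow> bool" where
  "QED A0 G \<longleftrightarrow>
     (\<forall>E F. continuum E \<and> continuum F \<and> E \<subseteq> G \<and> F \<subseteq> G \<longrightarrow>
        conf_modulus (path_family E F UNIV) \<le> ennreal A0 * conf_modulus (path_family E F G))"


subsection \<open>Open, discrete and closed mappings\<close>

definition open_mapping :: "(real^'n) set \<Rightarrow> (real^'n \<Rightarrow> real^'n) \<Rightarrow> bool" where
  "open_mapping D f \<longleftrightarrow> (\<forall>U. open U \<and> U \<subseteq> D \<longrightarrow> open (f ` U))"

definition discrete_mapping :: "(real^'n) set \<Rightarrow> (real^'n \<Rightarrow> real^'n) \<Rightarrow> bool" where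
  "discrete_mapping D f \<longleftrightarrow> (\<forall>y. discrete (D \<inter> f -` {y}))"

definition boundary_cluster_set ::
    "(real^'n) set \<Rightarrow> (real^'n \<Rightarrow> real^'n) \<Rightarrow> (real^'n) option set" where
  "boundary_cluster_set D f =
     {y. \<exists>xs p. (\<forall>k::nat. xs k \<in> D) \<and> p \<in> ext_boundary D \<and>
           limitin ext_space (\<lambda>k. Some (xs k)) p sequentially \<and>
           limitin ext_space (\<lambda>k. Some (f (xs k))) y sequentially}"

definition closed_mapping :: "(real^'n) set \<Rightarrow> (real^'n \<Rightarrow> real^'n) \<Rightarrow> bool" where
  "closed_mapping D f \<longleftrightarrow> boundary_cluster_set D f \<subseteq> ext_boundary (f ` D)"


definition ring_family ::
    "real \<Rightarrow> real \<Rightarrow> real \<Rightarrow> (real^'n \<Rightarrow> ennreal) \<Rightarrow> real \<Rightarrow> (real^'n) set \<Rightarrow> real^'n \<Rightarrow>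
     (real^'n \<Rightarrow> real^'n) set" where
  "ring_family r0 A0 R0 Q \<delta> D x0 =
     {f. continuous_on D f \<and> f ` D \<subseteq> ball 0 R0 \<and>
         open_mapping D f \<and> discrete_mapping D f \<and> closed_mapping D f \<and>
         ring_Q_mapping r0 Q D x0 f \<and>
         domain (f ` D) \<and> QED A0 (f ` D) \<and>
         (\<exists>K. continuum K \<and> path_connected K \<and> K \<subseteq> f ` D \<and> \<delta> \<le> diameter K \<and>
              ereal \<delta> \<le> chordal_setdist (Some ` (D \<inter> f -` K)) (ext_boundary D))}"

definition beta_exponent :: "nat \<Rightarrow> real \<Rightarrow> real \<Rightarrow> real" where
  "beta_exponent n A0 C = (real n * ln 2 / (A0 * C * 2 ^ (n + 1))) powr (1 / (real n - 1))"

end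

theory Submission
  imports Defs "HOL-Complex_Analysis.Great_Picard"
begin

text \<open>
  Join \<open>x\<close> and \<open>y\<close> inside \<open>ball x0 r1 \<inter> D\<close>, with \<open>r1\<close> twice the larger of the two distances to
  \<open>x0\<close>, by a path, and let \<open>E\<close> be its image under \<open>f\<close>. Since \<open>f\<close> is open, discrete and closed, it is
  proper with finite fibres, so every path from \<open>E\<close> to \<open>K\<close> in \<open>f ` D\<close> lifts to a path in \<open>D\<close> that
  starts at distance less than \<open>r1\<close> from \<open>x0\<close> and ends at distance at least \<open>\<delta>\<close>. The ring condition with
  \<open>\<eta> t = 1 / (t ln (r2 / r1))\<close> then bounds the modulus of these paths by a multiple of
  \<open>C / ln (r2 / r1) ^ (n - 1)\<close>, and by the QED condition that of all paths from \<open>E\<close> to \<open>K\<close>.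

  Conversely, averaging \<open>\<rho>\<close> over random polygons from \<open>E\<close> to \<open>K\<close> bounds the modulus from below by
  about \<open>n V / ln (1 / d) ^ (n - 1)\<close>, where \<open>V\<close> is the volume of the unit ball and \<open>d = dist (f x) (f y)\<close>.
  The first segment joins a point of \<open>E\<close> to a point \<open>p\<close> uniformly distributed in a ball of radius
  comparable to \<open>d\<close>, within the hyperplane through \<open>p\<close> orthogonal to a fixed axis; this uses that \<open>E\<close>
  is connected. The second dilates that ball to unit scale, which gives the main term, and the other two
  lead to \<open>K\<close> in the same manner. The constant \<open>2 ^ (n + 1)\<close> in the exponent leaves enough room for
  all lower order terms.
\<close>

section \<open>Arc length and path integrals\<close>

text \<open>The image curves may be null sets, so nothing can be averaged over their points; the
  auxiliary balls supply positive measure. Cones with a fixed apex would shrink all n directions and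
  bring in the divergent weight 1/t. Within hyperplanes only n - 1 directions shrink, and t to the
  power -(n - 1)/n is integrable. Of the four segments only the dilation costs more as d tends to 0.

  The upper bound loses a factor 2 in passing from the limsup to fixed radii and a factor n + 1 in
  the layer cake. The product 2 (n + 1) stays below 2^(n+1) by a factor of at least 4/3, and this
  margin pays for the cost of the other three segments.

  A lift cannot be put together from local inverses, since f may branch; it arises as a limit of
  discrete chains.

  The number \<alpha> is chosen before \<open>A0\<close>. This works because a nonempty family
  forces A0 \<ge> 1 and the exponent decreases in \<open>A0\<close>.\<close>

definition polygon_length :: "(real \<Rightarrow> real^'n) \<Rightarrow> real list \<Rightarrow> ennreal" where
  "polygon_length g ts = (\<Sum>i<length ts - 1. ennreal (dist (g (ts ! i)) (g (ts ! Suc i))))"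

text \<open>Arc length over an arbitrary parameter interval: additivity and the passage to subpaths
  need both end points free.\<close>

definition variation :: "(real \<Rightarrow> real^'n) \<Rightarrow> real \<Rightarrow> real \<Rightarrow> ennreal" where
  "variation g a b = (SUP ts \<in> {ts. sorted ts \<and> set ts \<subseteq> {a..b}}. polygon_length g ts)"

lemma arc_length_eq_variation: "arc_length g t = variation g 0 t"
  by (simp add: arc_length_def variation_def polygon_length_def)

lemma polygon_length_Nil [simp]: "polygon_length g [] = 0"
  and polygon_length_single [simp]: "polygon_length g [x] = 0"
  by (simp_all add: polygon_length_def)

lemma polygon_length_Cons2 [simp]:
  "polygon_length g (x # y # ys) = ennreal (dist (g x) (g y)) + polygon_length g (y # ys)"
  unfolding polygon_length_def by (simp add: sum.lessThan_Suc_shift del: sum.lessThan_Suc)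

lemma polygon_length_Cons_ge: "polygon_length g ys \<le> polygon_length g (x # ys)"
  by (cases ys) auto

lemma polygon_length_append_ge:
  "polygon_length g xs + polygon_length g ys \<le> polygon_length g (xs @ ys)"
proof (induction xs)
  case (Cons x xs)
  show ?case
  proof (cases xs)
    case Nil
    then show ?thesis using polygon_length_Cons_ge by simp
  next
    case (Cons y zs)
    then show ?thesis using Cons.IH by (simp add: add.assoc add_left_mono)
  qed
qed simp

text \<open>Triangle inequality at the extra vertex \<open>b\<close>, which ends the one polygon and
  starts the other.\<close>

lemma polygon_length_insert:
  "polygon_length g (xs @ ys) \<le> polygon_length g (xs @ [b]) + polygon_length g (b # ys)"
proof (induction xs)
  case Nil
  show ?case using polygon_length_Cons_ge by simp
next
  case (Cons x xs)
  show ?case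
  proof (cases xs)
    case Nil
    show ?thesis
    proof (cases ys)
      case (Cons y zs)
      have "ennreal (dist (g x) (g y)) \<le> ennreal (dist (g x) (g b)) + ennreal (dist (g b) (g y))"
        by (simp add: dist_triangle flip: ennreal_plus)
      then show ?thesis using Nil Cons by (simp add: add_right_mono flip: add.assoc)
    qed (use Nil in simp)
  next
    case (Cons y zs)
    then show ?thesis using Cons.IH by (simp add: add.assoc add_left_mono)
  qed
qed

lemma polygon_length_le_variation:
  "sorted ts \<Longrightarrow> set ts \<subseteq> {a..b} \<Longrightarrow> polygon_length g ts \<le> variation g a b"
  unfolding variation_def by (rule SUP_upper) simp

lemma variation_leI:
  "(\<And>ts. sorted ts \<Longrightarrow> set ts \<subseteq> {a..b} \<Longrightarrow> polygon_length g ts \<le> B) \<Longrightarrow> variation g a b \<le> B"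
  unfolding variation_def by (rule SUP_least) simp

lemma dist_le_variation: "a \<le> b \<Longrightarrow> ennreal (dist (g a) (g b)) \<le> variation g a b"
  using polygon_length_le_variation[of "[a,b]" a b g] by simp

lemma sorted_split_at:
  fixes b :: real
  assumes "sorted ts"
  shows "ts = filter (\<lambda>t. t \<le> b) ts @ filter (\<lambda>t. \<not> t \<le> b) ts"
  using assms
proof (induction ts)
  case (Cons t ts)
  show ?case
  proof (cases "t \<le> b")
    case True
    then show ?thesis using Cons by simp
  next
    case False
    then have "\<forall>s\<in>set (t # ts). \<not> s \<le> b" using Cons.prems by auto
    then have "filter (\<lambda>t. t \<le> b) (t # ts) = []" "filter (\<lambda>t. \<not> t \<le> b) (t # ts) = t # ts"
      by (auto simp only: filter_empty_conv filter_id_conv)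
    then show ?thesis by (simp only: append_Nil)
  qed
qed simp

text \<open>For the upper bound \<open>b\<close> is inserted into a polygon, which does not shorten
  it; for the lower bound polygons over the two halves are concatenated.\<close>

lemma variation_add:
  assumes "a \<le> b" "b \<le> c"
  shows "variation g a c = variation g a b + variation g b c"
proof (rule antisym)
  show "variation g a c \<le> variation g a b + variation g b c"
  proof (rule variation_leI)
    fix ts assume ts: "sorted ts" "set ts \<subseteq> {a..c}"
    let ?A = "filter (\<lambda>t. t \<le> b) ts" and ?B = "filter (\<lambda>t. \<not> t \<le> b) ts"
    have "polygon_length g ts \<le> polygon_length g (?A @ [b]) + polygon_length g (b # ?B)"
      using polygon_length_insert[of g ?A ?B b] sorted_split_at[OF ts(1), of b] by simp
    also have "\<dots> \<le> variation g a b + variation g b c"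
      using ts assms
      by (intro add_mono polygon_length_le_variation) (auto simp: sorted_append sorted_wrt_filter)
    finally show "polygon_length g ts \<le> variation g a b + variation g b c" .
  qed
next
  have le: "polygon_length g ts + polygon_length g us \<le> variation g a c"
    if "sorted ts" "set ts \<subseteq> {a..b}" "sorted us" "set us \<subseteq> {b..c}" for ts us
  proof -
    have "polygon_length g (ts @ us) \<le> variation g a c"
      using that assms by (intro polygon_length_le_variation) (force simp: sorted_append)+
    then show ?thesis using polygon_length_append_ge order_trans by blast
  qed
  have ne: "{ts::real list. sorted ts \<and> set ts \<subseteq> {a..b}} \<noteq> {}" for a b
    by (auto intro!: exI[of _ "[]"])
  have "polygon_length g ts + variation g b c \<le> variation g a c"
    if "sorted ts" "set ts \<subseteq> {a..b}" for ts
    unfolding variation_def[of g b c] ennreal_SUP_add_right[OF ne]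
    using le that by (intro SUP_least) auto
  then show "variation g a b + variation g b c \<le> variation g a c"
    unfolding variation_def[of g a b] ennreal_SUP_add_left[OF ne, symmetric]
    by (intro SUP_least) auto
qed

lemma variation_refl [simp]: "variation g a a = 0"
proof -
  have "polygon_length g ts = 0" if "set ts \<subseteq> {a}" for ts
    using that by (induction ts rule: induct_list012) auto
  then have "variation g a a \<le> 0" by (intro variation_leI) auto
  then show ?thesis by simp
qed

lemma variation_mono: "a \<le> a' \<Longrightarrow> b' \<le> b \<Longrightarrow> variation g a' b' \<le> variation g a b"
  by (rule variation_leI, rule polygon_length_le_variation) auto

lemma polygon_length_map: "polygon_length (\<lambda>t. g (\<phi> t)) ts = polygon_length g (map \<phi> ts)"
  by (induction ts rule: induct_list012) auto

lemma variation_compose_le: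
  assumes "mono_on {a..b} \<phi>"
  shows "variation (\<lambda>t. g (\<phi> t)) a b \<le> variation g (\<phi> a) (\<phi> b)"
proof (rule variation_leI)
  fix ts assume ts: "sorted ts" "set ts \<subseteq> {a..b}"
  have "sorted (map \<phi> ts)"
    using ts by (induction ts) (auto intro!: mono_onD[OF assms])
  moreover have "set (map \<phi> ts) \<subseteq> {\<phi> a..\<phi> b}"
    using ts(2) mono_onD[OF assms] by (auto simp: subset_iff)
  ultimately show "polygon_length (\<lambda>t. g (\<phi> t)) ts \<le> variation g (\<phi> a) (\<phi> b)"
    unfolding polygon_length_map by (rule polygon_length_le_variation)
qed

text \<open>The bound under monotone reparametrization is used twice, for the affine map of
  \<open>subpath\<close> and for its inverse \<open>\<psi>\<close>. For \<open>u = v\<close> there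
  is no inverse, and both sides vanish.\<close>

lemma variation_subpath:
  assumes "u \<le> v" "0 \<le> t"
  shows "variation (subpath u v g) 0 t = variation g u (u + (v - u) * t)"
proof -
  have le: "variation (subpath u v g) 0 t \<le> variation g u (u + (v - u) * t)"
    using variation_compose_le[of 0 t "\<lambda>t. (v - u) * t + u" g] assms
    by (simp add: subpath_def add.commute mono_on_def mult_left_mono)
  show ?thesis
  proof (cases "u = v")
    case True
    then show ?thesis using le by simp
  next
    case False
    define \<psi> where "\<psi> s = (s - u) / (v - u)" for s
    have "(\<lambda>s. subpath u v g (\<psi> s)) = g"
      using False assms by (auto simp: subpath_def \<psi>_def)
    moreover have "mono_on {u..u + (v - u) * t} \<psi>"
      using assms False by (auto simp: mono_on_def \<psi>_def divide_right_mono)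
    ultimately have "variation g u (u + (v - u) * t) \<le> variation (subpath u v g) 0 t"
      using variation_compose_le[of u "u + (v - u) * t" \<psi> "subpath u v g"] False assms
      by (simp add: \<psi>_def)
    then show ?thesis using le by (rule antisym[rotated])
  qed
qed

lemma variation_cong:
  assumes "\<And>t. t \<in> {a..b} \<Longrightarrow> g t = h t"
  shows "variation g a b = variation h a b"
proof -
  have "polygon_length g ts = polygon_length h ts" if "set ts \<subseteq> {a..b}" for ts
    using that assms by (induction ts rule: induct_list012) auto
  then show ?thesis unfolding variation_def by (intro SUP_cong) auto
qed

section \<open>The arc-length function and the arc-length parametrization\<close>

definition arc_len :: "(real \<Rightarrow> real^'n) \<Rightarrow> real \<Rightarrow> real" where
  "arc_len g t = enn2real (arc_length g t)"

lemma arc_length_finite: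
  assumes "rectifiable g" "t \<le> 1"
  shows "arc_length g t < \<infinity>"
  using variation_mono[of 0 0 t 1 g] assms
  by (auto simp: rectifiable_def arc_length_eq_variation intro: order.strict_trans1)

lemma ennreal_arc_len:
  "rectifiable g \<Longrightarrow> t \<le> 1 \<Longrightarrow> ennreal (arc_len g t) = arc_length g t"
  using arc_length_finite[of g t] by (simp add: arc_len_def)

lemma arc_len_0 [simp]: "arc_len g 0 = 0"
  by (simp add: arc_len_def arc_length_eq_variation)

lemma arc_len_nonneg [simp]: "0 \<le> arc_len g t"
  by (simp add: arc_len_def)

lemma arc_len_le_imp_nonneg: "arc_len g u \<le> x \<Longrightarrow> 0 \<le> x"
  using arc_len_nonneg[of g u] by linarith

lemma arc_len_diff:
  assumes "rectifiable g" "0 \<le> s" "s \<le> t" "t \<le> 1"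
  shows "variation g s t = ennreal (arc_len g t - arc_len g s)" "arc_len g s \<le> arc_len g t"
proof -
  have eq: "arc_length g t = arc_length g s + variation g s t"
    using variation_add[of 0 s t g] assms by (simp add: arc_length_eq_variation)
  have fin: "arc_length g s < \<infinity>" "arc_length g t < \<infinity>"
    using arc_length_finite[OF assms(1)] assms by auto
  have v: "variation g s t < \<infinity>"
    by (metis add.commute eq ennreal_add_eq_top fin(2) infinity_ennreal_def top.not_eq_extremum)
  have "arc_len g t = arc_len g s + enn2real (variation g s t)"
    unfolding arc_len_def eq using fin v by (subst enn2real_plus) auto
  moreover have "variation g s t = ennreal (enn2real (variation g s t))"
    using v by simp
  ultimately show "variation g s t = ennreal (arc_len g t - arc_len g s)" "arc_len g s \<le> arc_len g t"
    by (auto simp add: algebra_simps)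
qed

lemma dist_le_arc_len:
  assumes "rectifiable g" "0 \<le> s" "s \<le> t" "t \<le> 1"
  shows "dist (g s) (g t) \<le> arc_len g t - arc_len g s"
  using dist_le_variation[OF assms(3), of g] arc_len_diff[OF assms] by (simp add: ennreal_le_iff)

text \<open>\<open>T\<close> holds the vertices of a polygon within \<open>e/2\<close> of the total
  length. If none of them lies strictly between \<open>u\<close> and \<open>v\<close>, the arc
  before \<open>u\<close>, the chord and the arc after \<open>v\<close> together are at least as
  long as the polygon. So the arc from \<open>u\<close> to \<open>v\<close> exceeds its chord by
  less than \<open>e/2\<close>, and uniform continuity makes the chord short.\<close>

lemma variation_small:
  assumes g: "path g" and r: "rectifiable g" and e: "e > 0"
  obtains d T where "d > 0" "finite T"
    "\<And>u v. 0 \<le> u \<Longrightarrow> u \<le> v \<Longrightarrow> v \<le> 1 \<Longrightarrow> v - u < d \<Longrightarrow> T \<inter> {u<..<v} = {} \<Longrightarrow>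
       arc_len g v - arc_len g u \<le> e"
proof -
  have "variation g 0 1 < \<infinity>" using r by (simp add: rectifiable_def arc_length_eq_variation)
  then have fin: "variation g 0 1 \<noteq> \<infinity>" by auto
  have ne: "{ts::real list. sorted ts \<and> set ts \<subseteq> {0..1}} \<noteq> {}"
    by (auto intro!: exI[of _ "[]"])
  obtain ts where ts: "sorted ts" "set ts \<subseteq> {0..1}"
    "variation g 0 1 < polygon_length g ts + ennreal (e/2)"
    using SUP_approx_ennreal[OF half_gt_zero[OF e] ne variation_def fin] by auto
  have "uniformly_continuous_on {0..1} g"
    using g by (simp add: path_def compact_uniformly_continuous)
  then obtain d where d: "d > 0" "\<And>s t. s \<in> {0..1} \<Longrightarrow> t \<in> {0..1} \<Longrightarrow> dist t s < d \<Longrightarrow> dist (g t) (g s) < e/2"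
    using e unfolding uniformly_continuous_on_def by (meson half_gt_zero)
  show thesis
  proof (rule that[OF d(1), of "set ts"])
    fix u v :: real assume uv: "0 \<le> u" "u \<le> v" "v \<le> 1" "v - u < d" "set ts \<inter> {u<..<v} = {}"
    let ?A = "filter (\<lambda>t. t \<le> u) ts" and ?B = "filter (\<lambda>t. \<not> t \<le> u) ts"
    let ?s = "arc_len g u + dist (g u) (g v) + (arc_len g 1 - arc_len g v)"
    have "polygon_length g ts \<le> polygon_length g (?A @ [u]) + polygon_length g (u # ?B)"
      using polygon_length_insert[of g ?A ?B u] sorted_split_at[OF ts(1), of u] by simp
    also have "polygon_length g (u # ?B) \<le> polygon_length g [u, v] + polygon_length g (v # ?B)"
      using polygon_length_insert[of g "[u]" ?B v] by simp
    also have "polygon_length g (?A @ [u]) \<le> variation g 0 u"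
      using ts uv by (intro polygon_length_le_variation) (auto simp: sorted_append sorted_wrt_filter)
    also have "polygon_length g (v # ?B) \<le> variation g v 1"
    proof (intro polygon_length_le_variation)
      have "v \<le> x" if "x \<in> set ?B" for x using that uv(5) by force
      then show "sorted (v # ?B)" "set (v # ?B) \<subseteq> {v..1}"
        using ts uv by (auto simp: sorted_wrt_filter)
    qed
    finally have "polygon_length g ts \<le> variation g 0 u + (ennreal (dist (g u) (g v)) + variation g v 1)"
      by (simp add: add_mono)
    also have "variation g 0 u = ennreal (arc_len g u)"
      using arc_len_diff[OF r, of 0 u] uv by simp
    also have "variation g v 1 = ennreal (arc_len g 1 - arc_len g v)"
      using arc_len_diff[OF r, of v 1] uv by simp
    also have "ennreal (arc_len g u) + (ennreal (dist (g u) (g v)) + ennreal (arc_len g 1 - arc_len g v))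
        = ennreal (?s)"
      using arc_len_diff[OF r, of v 1] uv by (simp add: add.assoc flip: ennreal_plus)
    finally have "variation g 0 1 < ennreal (?s) + ennreal (e/2)"
      using ts(3) by (meson add_right_mono order_less_le_trans)
    also have "\<dots> = ennreal (?s + e/2)"
      using arc_len_diff[OF r, of v 1] uv e by (subst ennreal_plus) auto
    finally have "arc_len g 1 < ?s + e/2"
      using arc_len_diff[OF r, of 0 1] by (simp add: ennreal_less_iff)
    moreover have "dist (g u) (g v) < e/2" using d(2)[of v u] uv by (simp add: dist_real_def)
    ultimately show "arc_len g v - arc_len g u \<le> e" by simp
  qed simp
qed

lemma continuous_on_arc_len:
  assumes g: "path g" and r: "rectifiable g"
  shows "continuous_on {0..1} (arc_len g)"
  unfolding continuous_on_iff
proof (intro ballI allI impI)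
  fix t e :: real assume t: "t \<in> {0..1}" and e: "e > 0"
  obtain d T where dT: "d > 0" "finite T"
    "\<And>u v. 0 \<le> u \<Longrightarrow> u \<le> v \<Longrightarrow> v \<le> 1 \<Longrightarrow> v - u < d \<Longrightarrow> T \<inter> {u<..<v} = {} \<Longrightarrow>
       arc_len g v - arc_len g u \<le> e/2"
    using variation_small[OF g r, of "e/2"] e by auto
  \<comment> \<open>Only \<open>t\<close> itself can be a vertex at distance below \<open>d'\<close>
    from \<open>t\<close>, so the open interval between \<open>t\<close> and a nearby
    \<open>s\<close> avoids \<open>T\<close>.\<close>
  obtain d' where d': "d' > 0" "\<And>x. x \<in> T \<Longrightarrow> x \<noteq> t \<Longrightarrow> d' \<le> dist t x"
    using finite_set_avoid[OF dT(2), of t] by blast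
  show "\<exists>d>0. \<forall>s\<in>{0..1}. dist s t < d \<longrightarrow> dist (arc_len g s) (arc_len g t) < e"
  proof (intro exI[of _ "min d d'"] conjI ballI impI)
    fix s assume s: "s \<in> {0..1}" "dist s t < min d d'"
    show "dist (arc_len g s) (arc_len g t) < e"
    proof (cases "s \<le> t")
      case True
      have "T \<inter> {s<..<t} = {}" using d' s True by (force simp: dist_real_def)
      then have "arc_len g t - arc_len g s \<le> e/2" using dT(3)[of s t] s t True by (auto simp: dist_real_def)
      then show ?thesis using arc_len_diff(2)[OF r, of s t] s t True e by (auto simp: dist_real_def)
    next
      case False
      have "T \<inter> {t<..<s} = {}" using d' s False by (force simp: dist_real_def)
      then have "arc_len g s - arc_len g t \<le> e/2" using dT(3)[of t s] s t False by (auto simp: dist_real_def)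
      then show ?thesis using arc_len_diff(2)[OF r, of t s] s t False e by (auto simp: dist_real_def)
    qed
  qed (use dT d' in auto)
qed

text \<open>The description in \<open>arc_param\<close> is unambiguous: two parameters with the same
  arc length bound an arc of length zero, and \<open>g\<close> agrees at its ends.\<close>

lemma arc_param_arc_len:
  assumes r: "rectifiable g" and t: "t \<in> {0..1}"
  shows "arc_param g (arc_len g t) = g t"
  unfolding arc_param_def
proof (rule the_equality)
  show "\<exists>s\<in>{0..1}. arc_length g s = ennreal (arc_len g t) \<and> g t = g s"
    using t r ennreal_arc_len[of g t] by auto
next
  fix p assume "\<exists>s\<in>{0..1}. arc_length g s = ennreal (arc_len g t) \<and> p = g s"
  then obtain s where s: "s \<in> {0..1}" "arc_length g s = ennreal (arc_len g t)" "p = g s" by auto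
  then have eq: "arc_len g s = arc_len g t" by (simp add: arc_len_def)
  show "p = g t"
  proof (cases "s \<le> t")
    case True
    then show ?thesis using dist_le_arc_len[OF r, of s t] s t eq by auto
  next
    case False
    then show ?thesis using dist_le_arc_len[OF r, of t s] s t eq by auto
  qed
qed

lemma arc_len_attained:
  assumes g: "path g" and r: "rectifiable g" and uv: "0 \<le> u" "u \<le> v" "v \<le> 1"
    and s: "arc_len g u \<le> s" "s \<le> arc_len g v"
  obtains t where "t \<in> {u..v}" "arc_len g t = s"
  using IVT'[of "arc_len g" u s v] s uv continuous_on_subset[OF continuous_on_arc_len[OF g r], of "{u..v}"]
  by fastforce

text \<open>\<open>arc_param g\<close> is 1-Lipschitz, since a chord is no longer than its
  arc.\<close>

lemma continuous_on_arc_param: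
  assumes g: "path g" and r: "rectifiable g"
  shows "continuous_on {0..arc_len g 1} (arc_param g)"
proof -
  have "dist (arc_param g s) (arc_param g s') \<le> s' - s"
    if s: "0 \<le> s" "s \<le> s'" "s' \<le> arc_len g 1" for s s'
  proof -
    obtain t' where t': "t' \<in> {0..1}" "arc_len g t' = s'"
      using arc_len_attained[OF g r, of 0 1 s'] s by auto
    obtain t where t: "t \<in> {0..t'}" "arc_len g t = s"
      using arc_len_attained[OF g r, of 0 t' s] s t' by auto
    show ?thesis
      using dist_le_arc_len[OF r, of t t'] t t' arc_param_arc_len[OF r, of t] arc_param_arc_len[OF r, of t']
      by auto
  qed
  then have "1-lipschitz_on {0..arc_len g 1} (arc_param g)"
    by (intro lipschitz_onI) (smt (verit, ccfv_threshold) atLeastAtMost_iff dist_commute dist_real_def mult_1)+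
  then show ?thesis by (rule lipschitz_on_continuous_on)
qed

lemma arc_length_cong:
  "(\<And>t. t \<in> {0..1} \<Longrightarrow> g t = h t) \<Longrightarrow> t \<le> 1 \<Longrightarrow> arc_length g t = arc_length h t"
  unfolding arc_length_eq_variation by (rule variation_cong) auto

lemma rectifiable_cong:
  "(\<And>t. t \<in> {0..1} \<Longrightarrow> g t = h t) \<Longrightarrow> rectifiable g \<longleftrightarrow> rectifiable h"
  using arc_length_cong[of g h 1] by (auto simp: rectifiable_def)

lemma path_integral_cong:
  assumes "\<And>t. t \<in> {0..1} \<Longrightarrow> g t = h t"
  shows "path_integral g \<rho> = path_integral h \<rho>"
proof -
  have "arc_param g = arc_param h"
    unfolding arc_param_def using arc_length_cong[of g h] assms
    by (intro ext arg_cong[where f=The]) auto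
  then show ?thesis unfolding path_integral_def using arc_length_cong[of g h 1] assms by simp
qed

lemma rectifiable_subpath:
  assumes "rectifiable g" "0 \<le> u" "u \<le> v" "v \<le> 1"
  shows "rectifiable (subpath u v g)"
  using variation_subpath[of u v 1 g] arc_len_diff(1)[of g u v] assms
  by (simp add: rectifiable_def arc_length_eq_variation)

lemma arc_len_subpath:
  assumes "rectifiable g" "0 \<le> u" "u \<le> v" "v \<le> 1" "t \<in> {0..1}"
  shows "arc_len (subpath u v g) t = arc_len g (u + (v - u) * t) - arc_len g u"
proof -
  have "(v - u) * t \<le> v - u" using assms by (intro mult_left_le) auto
  then have *: "u + (v - u) * t \<le> 1" "u \<le> u + (v - u) * t" using assms by auto
  have "arc_len (subpath u v g) t = enn2real (variation g u (u + (v - u) * t))"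
    using variation_subpath[of u v t g] assms by (simp add: arc_len_def arc_length_eq_variation)
  also have "\<dots> = arc_len g (u + (v - u) * t) - arc_len g u"
    using arc_len_diff[OF assms(1,2) *(2,1)] by simp
  finally show ?thesis .
qed

section \<open>Path integrals over subpaths, joined paths and segments\<close>

lemma path_integral_arc_len:
  "path_integral g \<rho> = (\<integral>\<^sup>+s\<in>{0..arc_len g 1}. \<rho> (arc_param g s) \<partial>lborel)"
  by (simp add: path_integral_def arc_len_def)

lemma borel_measurable_arc_param:
  fixes \<rho> :: "real^'n \<Rightarrow> ennreal"
  assumes g: "path g" and r: "rectifiable g" and \<rho>: "\<rho> \<in> borel_measurable borel"
    and uv: "0 \<le> u" "u \<le> v" "v \<le> 1"
  shows "(\<lambda>s. \<rho> (arc_param g s) * indicator {arc_len g u..arc_len g v} s) \<in> borel_measurable borel"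
proof -
  \<comment> \<open>Beyond the total length the description in \<open>arc_param\<close> has no
    witness. Clamping the argument gives a continuous function that agrees with it on the relevant
    interval.\<close>
  let ?c = "\<lambda>s. max 0 (min (arc_len g 1) s)"
  have "continuous_on UNIV (\<lambda>s. arc_param g (?c s))"
    by (rule continuous_on_compose2[OF continuous_on_arc_param[OF g r]])
       (auto intro!: continuous_intros)
  then have "(\<lambda>s. arc_param g (?c s)) \<in> borel_measurable borel"
    by (rule borel_measurable_continuous_onI)
  note m = measurable_compose[OF this \<rho>]
  have "(\<lambda>s. \<rho> (arc_param g (?c s)) * indicator {arc_len g u..arc_len g v} s) \<in> borel_measurable borel"
    by (intro borel_measurable_times_ennreal m) auto
  moreover have "\<rho> (arc_param g (?c s)) * indicator {arc_len g u..arc_len g v} s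
     = \<rho> (arc_param g s) * indicator {arc_len g u..arc_len g v} s" for s
  proof (cases "s \<in> {arc_len g u..arc_len g v}")
    case True
    then have "?c s = s"
      using arc_len_diff(2)[OF r, of v 1] uv arc_len_le_imp_nonneg[of g u s] by auto
    then show ?thesis by simp
  qed simp
  ultimately show ?thesis by simp
qed

text \<open>The arc-length parametrization of a subpath is that of \<open>g\<close> shifted by
  \<open>arc_len g u\<close>, so a translation of the line turns one integral into the
  other.\<close>

lemma path_integral_subpath:
  assumes g: "path g" and r: "rectifiable g" and \<rho>: "\<rho> \<in> borel_measurable borel"
    and uv: "0 \<le> u" "u \<le> v" "v \<le> 1"
  shows "path_integral (subpath u v g) \<rho> =
    (\<integral>\<^sup>+s\<in>{arc_len g u..arc_len g v}. \<rho> (arc_param g s) \<partial>lborel)"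
proof -
  let ?h = "subpath u v g"
  have r': "rectifiable ?h" by (rule rectifiable_subpath[OF r uv])
  have g': "path ?h" using g uv by simp
  have L1: "arc_len ?h 1 = arc_len g v - arc_len g u" using arc_len_subpath[OF r uv, of 1] by simp
  have par: "arc_param ?h s = arc_param g (arc_len g u + s)" if s: "s \<in> {0..arc_len ?h 1}" for s
  proof -
    obtain t where t: "t \<in> {0..1}" "arc_len ?h t = s"
      using arc_len_attained[OF g' r', of 0 1 s] s by auto
    have "(v - u) * t \<le> v - u" using uv t by (intro mult_left_le) auto
    then have *: "u + (v - u) * t \<in> {0..1}" using uv t by auto
    have "arc_param ?h s = ?h t" using arc_param_arc_len[OF r' t(1)] t by simp
    also have "\<dots> = g (u + (v - u) * t)" by (simp add: subpath_def add.commute)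
    also have "\<dots> = arc_param g (arc_len g (u + (v - u) * t))" using arc_param_arc_len[OF r *] by simp
    also have "arc_len g (u + (v - u) * t) = arc_len g u + s"
      using arc_len_subpath[OF r uv t(1)] t by simp
    finally show ?thesis .
  qed
  have "(\<integral>\<^sup>+s\<in>{arc_len g u..arc_len g v}. \<rho> (arc_param g s) \<partial>lborel)
     = (\<integral>\<^sup>+s. \<rho> (arc_param g (arc_len g u + s)) * indicator {arc_len g u..arc_len g v} (arc_len g u + s) \<partial>lborel)"
    using nn_integral_real_affine[OF borel_measurable_arc_param[OF g r \<rho> uv], of 1 "arc_len g u"] by simp
  also have "\<dots> = (\<integral>\<^sup>+s\<in>{0..arc_len ?h 1}. \<rho> (arc_param ?h s) \<partial>lborel)"
  proof (intro nn_integral_cong)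
    fix s
    show "\<rho> (arc_param g (arc_len g u + s)) * indicator {arc_len g u..arc_len g v} (arc_len g u + s)
       = \<rho> (arc_param ?h s) * indicator {0..arc_len ?h 1} s"
      using par[of s] L1 by (auto simp: indicator_def)
  qed
  finally show ?thesis unfolding path_integral_arc_len ..
qed

lemma path_integral_subpath_le:
  assumes "path g" "rectifiable g" "\<rho> \<in> borel_measurable borel" "0 \<le> u" "u \<le> v" "v \<le> 1"
  shows "path_integral (subpath u v g) \<rho> \<le> path_integral g \<rho>"
proof -
  have "arc_len g v \<le> arc_len g 1"
    using arc_len_diff(2)[OF assms(2), of v 1] assms(4-6) by auto
  then show ?thesis
    unfolding path_integral_subpath[OF assms] path_integral_arc_len[of g]
    by (intro nn_integral_mono mult_left_mono)
       (auto simp: indicator_def intro: arc_len_le_imp_nonneg)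
qed

text \<open>On \<open>{0..1}\<close> the two halves of \<open>g +++ h\<close> agree with
  \<open>g\<close> and \<open>h\<close>. Their arc-length intervals share the point
  \<open>?L (1/2)\<close>, so the integrands compare by an inequality, in the direction that upper
  bounds require.\<close>

lemma
  assumes g: "path g" "path h" "pathfinish g = pathstart h" and r: "rectifiable g" "rectifiable h"
  shows rectifiable_join: "rectifiable (g +++ h)"
    and path_integral_join_le: "\<rho> \<in> borel_measurable borel \<Longrightarrow>
      path_integral (g +++ h) \<rho> \<le> path_integral g \<rho> + path_integral h \<rho>"
proof -
  let ?j = "g +++ h"
  have jp: "path ?j" using g by simp
  have 1: "subpath 0 (1/2) ?j t = g t" if "t \<in> {0..1}" for t
    using that by (simp add: subpath_def joinpaths_def)
  \<comment> \<open>At the joint \<open>joinpaths\<close> still evaluates \<open>g\<close>, so the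
    parameter 0 relies on the matching end points.\<close>
  have 2: "subpath (1/2) 1 ?j t = h t" if "t \<in> {0..1}" for t
  proof (cases "t = 0")
    case True
    then show ?thesis using g(3) by (simp add: subpath_def joinpaths_def pathfinish_def pathstart_def)
  next
    case False
    then show ?thesis using that by (simp add: subpath_def joinpaths_def)
  qed
  have "variation ?j 0 (1/2) = variation (subpath 0 (1/2) ?j) 0 1"
    using variation_subpath[of 0 "1/2" 1 ?j] by simp
  also have "\<dots> = variation g 0 1" using 1 by (intro variation_cong) auto
  finally have v1: "variation ?j 0 (1/2) < \<infinity>" using r by (simp add: rectifiable_def arc_length_eq_variation)
  have "variation ?j (1/2) 1 = variation (subpath (1/2) 1 ?j) 0 1"
    using variation_subpath[of "1/2" 1 1 ?j] by simp
  also have "\<dots> = variation h 0 1" using 2 by (intro variation_cong) auto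
  finally have v2: "variation ?j (1/2) 1 < \<infinity>" using r by (simp add: rectifiable_def arc_length_eq_variation)
  show rj: "rectifiable ?j"
    using v1 v2 variation_add[of 0 "1/2" 1 ?j] by (simp add: rectifiable_def arc_length_eq_variation)
  assume \<rho>: "\<rho> \<in> borel_measurable borel"
  let ?L = "arc_len ?j"
  have L: "0 \<le> ?L (1/2)" "?L (1/2) \<le> ?L 1" using arc_len_diff(2)[OF rj, of "1/2" 1] by auto
  have "path_integral ?j \<rho> \<le> (\<integral>\<^sup>+s. \<rho> (arc_param ?j s) * indicator {?L 0..?L (1/2)} s +
     \<rho> (arc_param ?j s) * indicator {?L (1/2)..?L 1} s \<partial>lborel)"
    unfolding path_integral_arc_len using L
    by (intro nn_integral_mono) (auto simp: indicator_def)
  also have "\<dots> = path_integral (subpath 0 (1/2) ?j) \<rho> + path_integral (subpath (1/2) 1 ?j) \<rho>"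
    using path_integral_subpath[OF jp rj \<rho>, of 0 "1/2"] path_integral_subpath[OF jp rj \<rho>, of "1/2" 1]
      borel_measurable_arc_param[OF jp rj \<rho>, of 0 "1/2"] borel_measurable_arc_param[OF jp rj \<rho>, of "1/2" 1]
    by (subst nn_integral_add) auto
  also have "path_integral (subpath 0 (1/2) ?j) \<rho> = path_integral g \<rho>"
    using 1 by (rule path_integral_cong)
  also have "path_integral (subpath (1/2) 1 ?j) \<rho> = path_integral h \<rho>"
    using 2 by (rule path_integral_cong)
  finally show "path_integral ?j \<rho> \<le> path_integral g \<rho> + path_integral h \<rho>" .
qed

lemma arc_length_linepath:
  assumes "0 \<le> t"
  shows "arc_length (linepath a b) t = ennreal (t * dist a b)"
proof -
  have d: "dist (linepath a b x) (linepath a b y) = \<bar>x - y\<bar> * dist a b" for x y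
  proof -
    have "linepath a b x - linepath a b y = (y - x) *\<^sub>R (a - b)" by (simp add: linepath_def algebra_simps)
    then show ?thesis by (simp add: dist_norm abs_minus_commute)
  qed
  have up: "polygon_length (linepath a b) (x # ts) \<le> ennreal ((c - x) * dist a b)"
    if "sorted (x # ts)" "set (x # ts) \<subseteq> {..c}" for x ts c
    using that
  proof (induction ts arbitrary: x)
    case (Cons y ts)
    have "polygon_length (linepath a b) (x # y # ts) \<le> ennreal ((y - x) * dist a b) + ennreal ((c - y) * dist a b)"
      using Cons by (auto simp: d intro!: add_mono mult_right_mono)
    also have "\<dots> = ennreal ((c - x) * dist a b)"
      using Cons.prems by (subst ennreal_plus[symmetric]) (auto simp: algebra_simps mult_right_mono)
    finally show ?case .
  qed simp
  have "polygon_length (linepath a b) ts \<le> ennreal (t * dist a b)" if "sorted ts" "set ts \<subseteq> {0..t}" for ts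
  proof (cases ts)
    case (Cons x xs)
    have "polygon_length (linepath a b) ts \<le> ennreal ((t - x) * dist a b)"
      using up[of x xs t] that Cons by force
    also have "\<dots> \<le> ennreal (t * dist a b)"
      using that Cons by (intro ennreal_leI mult_right_mono) auto
    finally show ?thesis .
  qed simp
  then have "variation (linepath a b) 0 t \<le> ennreal (t * dist a b)" by (rule variation_leI)
  moreover have "ennreal (t * dist a b) \<le> variation (linepath a b) 0 t"
    using dist_le_variation[OF assms, of "linepath a b"] assms by (simp add: d)
  ultimately show ?thesis unfolding arc_length_eq_variation by (rule antisym)
qed

lemma rectifiable_linepath [simp]: "rectifiable (linepath a b)"
  by (simp add: rectifiable_def arc_length_linepath)

text \<open>The path integral of a segment in the affine parameter. In this form it is visibly
  jointly measurable in the end points and can be averaged over them with Fubini.\<close>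

definition segment_integral :: "real^'n \<Rightarrow> real^'n \<Rightarrow> (real^'n \<Rightarrow> ennreal) \<Rightarrow> ennreal" where
  "segment_integral a b \<rho> = ennreal (dist a b) * (\<integral>\<^sup>+t\<in>{0..1}. \<rho> (linepath a b t) \<partial>lborel)"

lemma path_integral_linepath:
  assumes [measurable]: "\<rho> \<in> borel_measurable borel"
  shows "path_integral (linepath a b) \<rho> = segment_integral a b \<rho>"
proof (cases "a = b")
  case True
  have "(\<integral>\<^sup>+s. \<rho> (arc_param (linepath a b) s) * indicator {0} s \<partial>lborel) = 0"
    by (rule nn_integral_null_set) (simp add: null_setsI)
  then show ?thesis
    unfolding segment_integral_def path_integral_def using True by (simp add: arc_length_linepath)
next
  case False
  let ?L = "dist a b"
  have L: "?L > 0" using False by simp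
  have al: "arc_len (linepath a b) t = t * ?L" if "0 \<le> t" for t
    using that by (simp add: arc_len_def arc_length_linepath)
  have [measurable]: "linepath a b \<in> borel_measurable borel"
    unfolding linepath_def by (intro borel_measurable_continuous_onI continuous_intros)
  have "path_integral (linepath a b) \<rho> = (\<integral>\<^sup>+s\<in>{0..?L}. \<rho> (linepath a b (s / ?L)) \<partial>lborel)"
    unfolding path_integral_arc_len
  proof (intro nn_integral_cong)
    fix s
    show "\<rho> (arc_param (linepath a b) s) * indicator {0..arc_len (linepath a b) 1} s =
         \<rho> (linepath a b (s / ?L)) * indicator {0..?L} s"
      using al[of 1] al[of "s / ?L"] L arc_param_arc_len[OF rectifiable_linepath, of "s / ?L" a b]
      by (auto simp: indicator_def)
  qed
  also have "\<dots> = ennreal \<bar>?L\<bar> * (\<integral>\<^sup>+t. \<rho> (linepath a b ((0 + ?L * t) / ?L)) * indicator {0..?L} (0 + ?L * t) \<partial>lborel)"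
    using L by (intro nn_integral_real_affine) auto
  also have "(\<integral>\<^sup>+t. \<rho> (linepath a b ((0 + ?L * t) / ?L)) * indicator {0..?L} (0 + ?L * t) \<partial>lborel)
      = (\<integral>\<^sup>+t\<in>{0..1}. \<rho> (linepath a b t) \<partial>lborel)"
    using L by (intro nn_integral_cong) (auto simp: indicator_def zero_le_mult_iff)
  finally show ?thesis unfolding segment_integral_def by simp
qed

lemma path_integral_four_segments_le:
  fixes a b c d e :: "real^'n"
  assumes [measurable]: "\<rho> \<in> borel_measurable borel"
  defines "g \<equiv> linepath a b +++ linepath b c +++ linepath c d +++ linepath d e"
  shows "rectifiable g" "path_integral g \<rho> \<le> segment_integral a b \<rho> + segment_integral b c \<rho> +
      segment_integral c d \<rho> + segment_integral d e \<rho>"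
proof -
  have r1: "rectifiable (linepath c d +++ linepath d e)"
    and r2: "rectifiable (linepath b c +++ linepath c d +++ linepath d e)"
    by (intro rectifiable_join; simp)+
  show "rectifiable g" unfolding g_def
    by (intro rectifiable_join; simp)
  have "path_integral g \<rho> \<le> path_integral (linepath a b) \<rho> + (path_integral (linepath b c) \<rho> +
      (path_integral (linepath c d) \<rho> + path_integral (linepath d e) \<rho>))"
    unfolding g_def using r1 r2
    by (intro order_trans[OF path_integral_join_le] add_mono order_refl; simp)
  then show "path_integral g \<rho> \<le> segment_integral a b \<rho> + segment_integral b c \<rho> +
      segment_integral c d \<rho> + segment_integral d e \<rho>"
    by (simp add: path_integral_linepath add.assoc)
qed

section \<open>The extended boundary and properness of closed maps\<close>

lemma mem_ext_boundary_iff: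
  assumes "open D"
  shows "p \<in> ext_boundary D \<longleftrightarrow> p \<in> ext_space closure_of (Some ` D) \<and> p \<notin> Some ` D"
proof -
  have "ext_space interior_of (Some ` D) = Some ` D"
    using assms by (simp add: interior_of_openin)
  then show ?thesis by (auto simp: ext_boundary_def frontier_of_def)
qed

lemma Some_mem_closure_of_iff: "Some x \<in> ext_space closure_of (Some ` D) \<longleftrightarrow> x \<in> closure D"
proof
  assume L: "Some x \<in> ext_space closure_of (Some ` D)"
  have "\<exists>y\<in>D. y \<in> U" if "open U" "x \<in> U" for U
  proof -
    have "openin ext_space (Some ` U)" "Some x \<in> Some ` U" using that by auto
    then show ?thesis using L unfolding in_closure_of by blast
  qed
  then show "x \<in> closure D" by (force simp: closure_iff_nhds_not_empty)
next
  assume R: "x \<in> closure D"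
  have "\<exists>y\<in>D. Some y \<in> T" if T: "openin ext_space T" "Some x \<in> T" for T
  proof -
    have "open (Some -` T)"
      using openin_continuous_map_preimage[OF continuous_map_Some T(1)]
      by (simp add: vimage_def)
    moreover have "x \<in> Some -` T" using T by simp
    ultimately show ?thesis using R open_Int_closure_eq_empty[of "Some -` T" D] by blast
  qed
  then show "Some x \<in> ext_space closure_of (Some ` D)" unfolding in_closure_of by auto
qed

lemma Some_mem_ext_boundary_iff:
  "open D \<Longrightarrow> Some x \<in> ext_boundary D \<longleftrightarrow> x \<in> closure D \<and> x \<notin> D"
  by (auto simp: mem_ext_boundary_iff Some_mem_closure_of_iff)

lemma limitin_Some: "xs \<longlonglongrightarrow> x \<Longrightarrow> limitin ext_space (\<lambda>k. Some (xs k)) (Some x) sequentially"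
  using continuous_map_limit[OF continuous_map_Some, of euclidean xs x sequentially]
  by (simp add: o_def)

lemma limitin_None:
  fixes xs :: "nat \<Rightarrow> real^'n"
  assumes "filterlim (\<lambda>k. norm (xs k)) at_top sequentially"
  shows "limitin ext_space (\<lambda>k. Some (xs k)) None sequentially"
  unfolding limitin_def
proof (intro conjI allI impI)
  fix U :: "(real^'n) option set" assume U: "openin ext_space U \<and> None \<in> U"
  then obtain C where C: "compact C" "U = insert None (Some ` (UNIV - C))"
    unfolding openin_Alexandroff_compactification by auto
  obtain B where B: "\<And>x. x \<in> C \<Longrightarrow> norm x \<le> B" using compact_imp_bounded[OF C(1)] bounded_iff by blast
  have "eventually (\<lambda>k. B < norm (xs k)) sequentially"
    using assms unfolding filterlim_at_top_dense by blast
  then show "eventually (\<lambda>k. Some (xs k) \<in> U) sequentially"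
    by (rule eventually_mono) (use B C in force)
qed simp

lemma ext_boundary_limit:
  fixes D :: "(real^'n) set"
  assumes "open D" "\<And>k. xs k \<in> D" "limitin ext_space (\<lambda>k. Some (xs k)) p sequentially" "p \<notin> Some ` D"
  shows "p \<in> ext_boundary D"
proof -
  have "\<exists>y\<in>D. Some y \<in> T" if "openin ext_space T" "p \<in> T" for T
  proof -
    have "eventually (\<lambda>k. Some (xs k) \<in> T) sequentially" using limitinD[OF assms(3) that] .
    then show ?thesis using assms(2) unfolding eventually_sequentially by blast
  qed
  then have "p \<in> ext_space closure_of (Some ` D)"
    using limitin_topspace[OF assms(3)] unfolding in_closure_of by auto
  then show ?thesis using assms by (simp add: mem_ext_boundary_iff)
qed

text \<open>A sequence in the preimage without a limit point in \<open>D\<close> subconverges in the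
  extended space to a boundary point, possibly infinity. A limit of its values in \<open>K\<close>
  is then a cluster value, hence a boundary point of the image of \<open>D\<close>, whereas
  \<open>K\<close> lies inside this open set.\<close>

lemma closed_mapping_proper:
  fixes f :: "real^'n \<Rightarrow> real^'n"
  assumes D: "open D" and f: "continuous_on D f" "closed_mapping D f" and fD: "open (f ` D)"
    and K: "compact K" "K \<subseteq> f ` D"
  shows "compact (D \<inter> f -` K)"
  unfolding compact_def
proof (intro allI impI)
  fix xs :: "nat \<Rightarrow> real^'n" assume xs: "\<forall>n. xs n \<in> D \<inter> f -` K"
  obtain y r where y: "y \<in> K" "strict_mono (r::nat\<Rightarrow>nat)" "(\<lambda>n. f (xs (r n))) \<longlonglongrightarrow> y"
    using K(1)[unfolded compact_def, rule_format, of "\<lambda>n. f (xs n)"] xs by (auto simp: o_def)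
  have no: False if s: "strict_mono (s::nat\<Rightarrow>nat)" and p: "p \<notin> Some ` D"
    "limitin ext_space (\<lambda>k. Some (xs (r (s k)))) p sequentially" for s p
  proof -
    have "p \<in> ext_boundary D"
      by (rule ext_boundary_limit[OF D, of "\<lambda>k. xs (r (s k))"]) (use xs p in auto)
    moreover have "limitin ext_space (\<lambda>k. Some (f (xs (r (s k))))) (Some y) sequentially"
      using limitin_Some[OF LIMSEQ_subseq_LIMSEQ[OF y(3) s]] by (simp add: o_def)
    ultimately have "Some y \<in> boundary_cluster_set D f"
      using xs p unfolding boundary_cluster_set_def mem_Collect_eq
      by (intro exI[of _ "\<lambda>k. xs (r (s k))"] exI[of _ p]) auto
    then have "Some y \<in> ext_boundary (f ` D)" using f unfolding closed_mapping_def by blast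
    then show False using Some_mem_ext_boundary_iff[OF fD] y K by auto
  qed
  have "bounded (range (\<lambda>n. xs (r n)))"
  proof (rule ccontr)
    assume "\<not> bounded (range (\<lambda>n. xs (r n)))"
    then have unb: "\<exists>n. B < norm (xs (r n))" for B
      unfolding bounded_iff by (force simp: not_le)
    \<comment> \<open>Exceeding the maximum over all indices up to \<open>m\<close> forces the new
      index beyond \<open>m\<close>; iteration gives a subsequence whose norms tend to
      infinity.\<close>
    have "\<exists>n>m. real m < norm (xs (r n))" for m
    proof -
      define B where "B = Max (insert (real m) ((\<lambda>n. norm (xs (r n))) ` {..m}))"
      obtain n where n: "B < norm (xs (r n))" using unb by blast
      have "norm (xs (r k)) \<le> B" if "k \<le> m" for k
        unfolding B_def using that by (intro Max_ge) auto
      moreover have "real m \<le> B" unfolding B_def by (intro Max_ge) auto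
      ultimately show ?thesis using n by (metis not_le order_le_less_trans)
    qed
    then obtain h where h: "\<And>m. m < h m" "\<And>m. real m < norm (xs (r (h m)))" by metis
    define s where "s = rec_nat 0 (\<lambda>_ m. h m)"
    have sS: "s (Suc k) = h (s k)" for k by (simp add: s_def)
    have s: "strict_mono s" using h by (simp add: strict_mono_Suc_iff sS)
    have "real k \<le> norm (xs (r (s (Suc k))))" for k
      using h(2)[of "s k"] strict_mono_imp_increasing[OF s, of k] by (simp add: sS)
    then have "filterlim (\<lambda>k. norm (xs (r (s (Suc k))))) at_top sequentially"
      by (intro filterlim_at_top_mono[OF filterlim_real_sequentially]) auto
    then have "limitin ext_space (\<lambda>k. Some (xs (r (s (Suc k))))) None sequentially"
      by (rule limitin_None)
    then show False using no[of "\<lambda>k. s (Suc k)" None] s by (auto simp: strict_mono_Suc_iff)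
  qed
  then obtain p s where s: "strict_mono (s::nat\<Rightarrow>nat)" "(\<lambda>k. xs (r (s k))) \<longlonglongrightarrow> p"
    using bounded_imp_convergent_subsequence[of "\<lambda>n. xs (r n)"] by (auto simp: o_def)
  have pD: "p \<in> D" using no[OF s(1), of "Some p"] limitin_Some[OF s(2)] by auto
  have "(\<lambda>k. f (xs (r (s k)))) \<longlonglongrightarrow> f p"
    using f(1) D pD s xs continuous_on_eq_continuous_at[OF D, of f]
    by (auto intro: isCont_tendsto_compose)
  moreover have "(\<lambda>k. f (xs (r (s k)))) \<longlonglongrightarrow> y"
    using LIMSEQ_subseq_LIMSEQ[OF y(3) s(1)] by (simp add: o_def)
  ultimately have "f p = y" by (rule LIMSEQ_unique)
  then show "\<exists>l\<in>D \<inter> f -` K. \<exists>r. strict_mono r \<and> (xs \<circ> r) \<longlonglongrightarrow> l"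
    using pD y s by (intro bexI[of _ p] exI[of _ "\<lambda>k. r (s k)"]) (auto simp: o_def strict_mono_def)
qed

section \<open>Path lifting for proper open maps with finite fibres\<close>

locale proper_open_finite_map =
  fixes D :: "(real^'n) set" and f :: "real^'n \<Rightarrow> real^'n"
  assumes open_D: "open D" and cont: "continuous_on D f"
    and open_map: "\<And>U. open U \<Longrightarrow> U \<subseteq> D \<Longrightarrow> open (f ` U)"
    and proper: "\<And>K. compact K \<Longrightarrow> K \<subseteq> f ` D \<Longrightarrow> compact (D \<inter> f -` K)"
    and finite_fibre: "\<And>y. y \<in> f ` D \<Longrightarrow> finite (D \<inter> f -` {y})"
begin

text \<open>A discrete substitute for a path in \<open>D\<close>; the lift is a limit of such
  chains.\<close>

definition fine_chain :: "real \<Rightarrow> (nat \<Rightarrow> real^'n) \<Rightarrow> nat \<Rightarrow> nat \<Rightarrow> bool" where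
  "fine_chain \<epsilon> c i j \<longleftrightarrow> (\<forall>k\<in>{i..j}. c k \<in> D) \<and> (\<forall>k\<in>{i..<j}. dist (c k) (c (Suc k)) < \<epsilon>)"

lemma fine_chain_mono: "fine_chain \<epsilon> c i j \<Longrightarrow> \<epsilon> \<le> \<epsilon>' \<Longrightarrow> fine_chain \<epsilon>' c i j"
  by (fastforce simp: fine_chain_def)

text \<open>The fibre over y is covered by well separated small balls, between which a fine chain
  lying over a neighbourhood of y cannot jump.\<close>

lemma fine_chain_small_local:
  assumes y: "y \<in> f ` D" and e: "e > 0"
  shows "\<exists>\<eta>>0. \<exists>\<epsilon>>0. \<forall>c i j. i \<le> j \<and> fine_chain \<epsilon> c i j \<and> (\<forall>k\<in>{i..j}. f (c k) \<in> ball y \<eta>)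
           \<longrightarrow> dist (c i) (c j) < e"
proof -
  define F where "F = D \<inter> f -` {y}"
  have finF: "finite F" using finite_fibre[OF y] by (simp add: F_def)
  have "\<exists>r>0. \<forall>x\<in>F. \<forall>x'\<in>F. x' \<noteq> x \<longrightarrow> r \<le> dist x x'"
  proof -
    have "\<forall>x. \<exists>r>0. \<forall>x'\<in>F. x' \<noteq> x \<longrightarrow> r \<le> dist x x'"
      using finite_set_avoid[OF finF] by blast
    then obtain r where r: "\<And>x. r x > (0::real)" "\<And>x x'. x' \<in> F \<Longrightarrow> x' \<noteq> x \<Longrightarrow> r x \<le> dist x x'"
      by metis
    have "Min (insert 1 (r ` F)) \<le> r x" if "x \<in> F" for x using finF that by simp
    moreover have "Min (insert 1 (r ` F)) > 0" using finF r by simp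
    ultimately show ?thesis using r(2) by (meson order_trans)
  qed
  then obtain r0 where r0: "r0 > 0" "\<And>x x'. x \<in> F \<Longrightarrow> x' \<in> F \<Longrightarrow> x' \<noteq> x \<Longrightarrow> r0 \<le> dist x x'" by blast
  \<comment> \<open>As \<open>3 * r \<le> r0\<close>, a step below \<open>r\<close> cannot lead from
    one ball of radius \<open>r\<close> to another; as \<open>2 * r \<le> e\<close>, two points of
    the same ball are closer than \<open>e\<close>.\<close>
  define r where "r = min (r0/3) (e/2)"
  have r: "r > 0" "3 * r \<le> r0" "2 * r \<le> e" using r0 e by (auto simp: r_def)
  have "open (f ` D)" using open_map[OF open_D] by simp
  then obtain \<eta>0 where \<eta>0: "\<eta>0 > 0" "cball y \<eta>0 \<subseteq> f ` D" using y open_contains_cball by blast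
  \<comment> \<open>\<open>Z\<close> is the part of a compact preimage outside the balls. Its image
    is compact and misses \<open>y\<close>, so values close enough to \<open>y\<close> come from the
    balls only.\<close>
  define Z where "Z = D \<inter> f -` cball y \<eta>0 - (\<Union>x\<in>F. ball x r)"
  have Z: "compact Z" unfolding Z_def
    by (intro compact_diff proper \<eta>0 compact_cball) auto
  have "compact (f ` Z)"
    by (rule compact_continuous_image[OF continuous_on_subset[OF cont] Z]) (auto simp: Z_def)
  moreover have "y \<notin> f ` Z" using r by (force simp: Z_def F_def)
  ultimately obtain \<eta>1 where \<eta>1: "\<eta>1 > 0" "\<And>z. z \<in> f ` Z \<Longrightarrow> \<eta>1 \<le> dist y z"
    using separate_point_closed[of "f ` Z" y] compact_imp_closed by blast
  have cover: "\<exists>x\<in>F. z \<in> ball x r" if "z \<in> D" "f z \<in> ball y (min \<eta>0 \<eta>1)" for z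
  proof (rule ccontr)
    assume "\<not> (\<exists>x\<in>F. z \<in> ball x r)"
    then have "z \<in> Z" using that by (auto simp: Z_def)
    then show False using \<eta>1(2)[of "f z"] that by auto
  qed
  show ?thesis
  proof (rule exI[of _ "min \<eta>0 \<eta>1"], rule conjI[rotated], rule exI[of _ r], rule conjI[rotated], intro allI impI)
    fix c i j assume *: "i \<le> j \<and> fine_chain r c i j \<and> (\<forall>k\<in>{i..j}. f (c k) \<in> ball y (min \<eta>0 \<eta>1))"
    then have mem: "c k \<in> D" "f (c k) \<in> ball y (min \<eta>0 \<eta>1)" if "k \<in> {i..j}" for k
      using that by (auto simp: fine_chain_def)
    obtain x where x: "x \<in> F" "c i \<in> ball x r" using cover[OF mem, of i] * by auto
    have "c (i + m) \<in> ball x r" if "i + m \<le> j" for m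
      using that
    proof (induction m)
      case (Suc m)
      then have 1: "c (i + m) \<in> ball x r" by simp
      obtain x' where x': "x' \<in> F" "c (i + Suc m) \<in> ball x' r"
        using cover[OF mem, of "i + Suc m"] Suc.prems by auto
      have "dist (c (i + m)) (c (i + Suc m)) < r" using * Suc.prems by (auto simp: fine_chain_def)
      then have "dist x x' < 3 * r"
        using 1 x'(2) dist_triangle[of x x' "c (i + m)"] dist_triangle[of "c (i + m)" x' "c (i + Suc m)"]
        by (simp add: dist_commute)
      then have "x' = x" using r0(2)[OF x(1) x'(1)] r by force
      then show ?case using x' by simp
    qed (use x in simp)
    from this[of "j - i"] have "c j \<in> ball x r" using * by simp
    then have "dist (c i) (c j) < 2 * r" using x dist_triangle[of "c i" "c j" x]
      by (simp add: dist_commute)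
    then show "dist (c i) (c j) < e" using r by simp
  qed (use \<eta>0 \<eta>1 r in auto)
qed

text \<open>The local statement made uniform over the compact set \<open>P\<close>: with a Lebesgue
  number \<open>d\<close>, every ball of radius \<open>d\<close> about a point of \<open>P\<close>
  lies in one of finitely many local balls.\<close>

lemma fine_chain_small:
  assumes P: "compact P" "P \<subseteq> f ` D" and e: "e > 0"
  shows "\<exists>d>0. \<exists>\<epsilon>>0. \<forall>c i j. i \<le> j \<and> fine_chain \<epsilon> c i j \<and> f (c i) \<in> P \<and>
           (\<forall>k\<in>{i..j}. dist (f (c i)) (f (c k)) < d) \<longrightarrow> dist (c i) (c j) < e"
proof -
  have "\<forall>y\<in>P. \<exists>\<eta> \<epsilon>. \<eta> > 0 \<and> \<epsilon> > 0 \<and> (\<forall>c i j. i \<le> j \<and> fine_chain \<epsilon> c i j \<and>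
      (\<forall>k\<in>{i..j}. f (c k) \<in> ball y \<eta>) \<longrightarrow> dist (c i) (c j) < e)"
    using fine_chain_small_local[OF _ e] P(2) by (meson subsetD)
  then obtain \<eta> \<epsilon> where h: "\<And>y. y \<in> P \<Longrightarrow> \<eta> y > 0" "\<And>y. y \<in> P \<Longrightarrow> \<epsilon> y > 0"
    "\<And>y c i j. y \<in> P \<Longrightarrow> i \<le> j \<Longrightarrow> fine_chain (\<epsilon> y) c i j \<Longrightarrow>
      (\<And>k. k \<in> {i..j} \<Longrightarrow> f (c k) \<in> ball y (\<eta> y)) \<Longrightarrow> dist (c i) (c j) < e"
    by metis
  have "P \<subseteq> (\<Union>y\<in>P. ball y (\<eta> y))" using h(1) by force
  then obtain T where T: "T \<subseteq> P" "finite T" "P \<subseteq> (\<Union>y\<in>T. ball y (\<eta> y))"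
    using compactE_image[OF P(1), of P "\<lambda>y. ball y (\<eta> y)"] by auto
  obtain d where d: "d > 0" "\<And>p. p \<in> P \<Longrightarrow> \<exists>G\<in>(\<lambda>y. ball y (\<eta> y)) ` T. ball p d \<subseteq> G"
    by (rule Heine_Borel_lemma[OF P(1), of "(\<lambda>y. ball y (\<eta> y)) ` T"]) (use T(3) in auto)
  define \<epsilon>0 where "\<epsilon>0 = Min (insert 1 (\<epsilon> ` T))"
  have \<epsilon>0: "\<epsilon>0 > 0" "\<And>y. y \<in> T \<Longrightarrow> \<epsilon>0 \<le> \<epsilon> y"
    using T h(2) unfolding \<epsilon>0_def by (auto simp: subset_iff)
  show ?thesis
  proof (rule exI[of _ d], rule conjI[rotated], rule exI[of _ \<epsilon>0], rule conjI[rotated], intro allI impI)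
    fix c i j assume *: "i \<le> j \<and> fine_chain \<epsilon>0 c i j \<and> f (c i) \<in> P \<and>
      (\<forall>k\<in>{i..j}. dist (f (c i)) (f (c k)) < d)"
    then obtain y where y: "y \<in> T" "ball (f (c i)) d \<subseteq> ball y (\<eta> y)" using d(2) by blast
    show "dist (c i) (c j) < e"
      by (rule h(3)[of y]) (use * y T(1) \<epsilon>0(2)[OF y(1)] fine_chain_mono in \<open>auto simp: subset_iff\<close>)
  qed (use d \<epsilon>0 in auto)
qed

text \<open>The preimage of \<open>P\<close> is compact, and half of a radius valid at
  \<open>x\<close> serves all points near \<open>x\<close>. This is the uniform step that continues
  a discrete lift.\<close>

lemma uniformly_open:
  assumes P: "compact P" "P \<subseteq> f ` D" and e: "e > 0"
  shows "\<exists>d>0. \<forall>x\<in>D. \<forall>y. f x \<in> P \<and> dist (f x) y < d \<longrightarrow> (\<exists>x'\<in>D. dist x x' < e \<and> f x' = y)"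
proof -
  define X where "X = D \<inter> f -` P"
  have X: "compact X" unfolding X_def by (rule proper[OF P])
  have loc: "\<exists>s d. s > 0 \<and> d > 0 \<and> (\<forall>x'\<in>D \<inter> ball x s. \<forall>y. dist (f x') y < d \<longrightarrow>
      (\<exists>x''\<in>D. dist x' x'' < e \<and> f x'' = y))" if x: "x \<in> X" for x
  proof -
    have xD: "x \<in> D" using x by (simp add: X_def)
    have "open (f ` (D \<inter> ball x (e/2)))" by (rule open_map) (use open_D in auto)
    moreover have "f x \<in> f ` (D \<inter> ball x (e/2))" using xD e by auto
    ultimately obtain d where d: "d > 0" "ball (f x) d \<subseteq> f ` (D \<inter> ball x (e/2))"
      using open_contains_ball by metis
    obtain s where s: "s > 0" "\<And>x'. x' \<in> D \<Longrightarrow> dist x' x < s \<Longrightarrow> dist (f x') (f x) < d/2"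
      using cont xD d(1) unfolding continuous_on_iff by (meson half_gt_zero)
    show ?thesis
    proof (rule exI[of _ "min s (e/2)"], rule exI[of _ "d/2"], intro conjI ballI allI impI)
      fix x' y assume x': "x' \<in> D \<inter> ball x (min s (e/2))" and y: "dist (f x') y < d/2"
      then have "dist (f x) y < d" using s(2)[of x'] dist_triangle_half_l[of "f x" "f x'" d y]
        by (auto simp: dist_commute)
      then obtain x'' where "x'' \<in> D" "dist x x'' < e/2" "f x'' = y" using d(2) by force
      moreover have "dist x' x < e/2" using x' by (simp add: dist_commute)
      ultimately show "\<exists>x''\<in>D. dist x' x'' < e \<and> f x'' = y"
        using dist_triangle_half_r[of x x' e x''] by (auto simp: dist_commute)
    qed (use s e d in auto)
  qed
  then obtain s d where sd: "\<And>x. x \<in> X \<Longrightarrow> s x > 0" "\<And>x. x \<in> X \<Longrightarrow> d x > (0::real)"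
    "\<And>x x' y. x \<in> X \<Longrightarrow> x' \<in> D \<inter> ball x (s x) \<Longrightarrow> dist (f x') y < d x \<Longrightarrow>
      (\<exists>x''\<in>D. dist x' x'' < e \<and> f x'' = y)"
    by metis
  have "X \<subseteq> (\<Union>x\<in>X. ball x (s x))" using sd(1) by force
  then obtain T where T: "T \<subseteq> X" "finite T" "X \<subseteq> (\<Union>x\<in>T. ball x (s x))"
    using compactE_image[OF X, of X "\<lambda>x. ball x (s x)"] by auto
  define d0 where "d0 = Min (insert 1 (d ` T))"
  have d0: "d0 > 0" "\<And>y. y \<in> T \<Longrightarrow> d0 \<le> d y"
    using T sd(2) unfolding d0_def by (auto simp: subset_iff)
  show ?thesis
  proof (intro exI[of _ d0] conjI ballI allI impI)
    fix x y assume x: "x \<in> D" and y: "f x \<in> P \<and> dist (f x) y < d0"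
    then have "x \<in> X" by (simp add: X_def)
    then obtain z where z: "z \<in> T" "x \<in> ball z (s z)" using T(3) by blast
    show "\<exists>x'\<in>D. dist x x' < e \<and> f x' = y"
      by (rule sd(3)[of z]) (use x y z T(1) d0(2)[OF z(1)] in auto)
  qed (use d0 in auto)
qed

text \<open>The grid is so fine that consecutive values of \<open>g\<close> are close enough for
  \<open>uniformly_open\<close> to continue the chain. The bound \<open>m0\<close> lets the grid be
  refined at will.\<close>

lemma discrete_lift:
  assumes g: "path g" "path_image g \<subseteq> f ` D" and x: "x \<in> D" "f x = g 0" and \<epsilon>: "\<epsilon> > 0"
  shows "\<exists>m\<ge>m0. \<exists>c. m > 0 \<and> c 0 = x \<and> fine_chain \<epsilon> c 0 m \<and> (\<forall>i\<le>m. f (c i) = g (real i / real m))"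
proof -
  let ?P = "path_image g"
  obtain d where d: "d > 0" "\<And>x y. x \<in> D \<Longrightarrow> f x \<in> ?P \<Longrightarrow> dist (f x) y < d \<Longrightarrow> \<exists>x'\<in>D. dist x x' < \<epsilon> \<and> f x' = y"
    using uniformly_open[OF compact_path_image[OF g(1)] g(2) \<epsilon>] by blast
  have "uniformly_continuous_on {0..1} g"
    using g by (simp add: path_def compact_uniformly_continuous)
  then obtain r where r: "r > 0" "\<And>s t. s \<in> {0..1} \<Longrightarrow> t \<in> {0..1} \<Longrightarrow> dist t s < r \<Longrightarrow> dist (g t) (g s) < d"
    using d(1) unfolding uniformly_continuous_on_def by meson
  obtain m1 where m1: "1 / r < real m1" using reals_Archimedean2 by blast
  define m where "m = max (Suc m0) (Suc m1)"
  have m: "m \<ge> m0" "m > 0" "1 / r < real m" using m1 by (auto simp: m_def)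
  have step: "\<exists>x'\<in>D. dist x x' < \<epsilon> \<and> f x' = g (real (Suc i) / real m)"
    if "x \<in> D" "f x = g (real i / real m)" "i < m" for x i
  proof (rule d(2))
    have "real i / real m \<in> {0..1}" "real (Suc i) / real m \<in> {0..1}" using that m by auto
    moreover have "dist (real i / real m) (real (Suc i) / real m) < r"
      using m r by (simp add: dist_real_def field_simps)
    ultimately show "dist (f x) (g (real (Suc i) / real m)) < d" "f x \<in> ?P"
      using r(2) that by (auto simp: path_image_def)
  qed fact
  define c where "c = rec_nat x (\<lambda>i z. SOME x'. x' \<in> D \<and> dist z x' < \<epsilon> \<and> f x' = g (real (Suc i) / real m))"
  have c0: "c 0 = x" by (simp add: c_def)
  have cS: "c (Suc i) \<in> D \<and> dist (c i) (c (Suc i)) < \<epsilon> \<and> f (c (Suc i)) = g (real (Suc i) / real m)"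
    if "c i \<in> D" "f (c i) = g (real i / real m)" "i < m" for i
    using someI_ex[of "\<lambda>x'. x' \<in> D \<and> dist (c i) x' < \<epsilon> \<and> f x' = g (real (Suc i) / real m)"] step[OF that]
    by (auto simp: c_def)
  have inv: "c i \<in> D \<and> f (c i) = g (real i / real m)" if "i \<le> m" for i
    using that by (induction i) (use c0 x cS in auto)
  then have "fine_chain \<epsilon> c 0 m" using cS by (auto simp: fine_chain_def)
  then show ?thesis using m c0 inv by blast
qed

text \<open>Arzela-Ascoli: chains with step length tending to zero converge along a diagonal
  subsequence at all rational parameters. The limit is uniformly continuous there, extends to the
  whole interval, and lifts \<open>g\<close> by density.\<close>

theorem path_lifting:
  assumes g: "path g" "path_image g \<subseteq> f ` D" and x: "x \<in> D" "f x = pathstart g"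
  obtains h where "path h" "path_image h \<subseteq> D" "pathstart h = x" "\<And>t. t \<in> {0..1} \<Longrightarrow> f (h t) = g t"
proof -
  define P where "P = path_image g"
  have P: "compact P" "P \<subseteq> f ` D" using g by (auto simp: P_def)
  define X where "X = D \<inter> f -` P"
  have X: "compact X" unfolding X_def by (rule proper[OF P])
  have gP: "g t \<in> P" if "t \<in> {0..1}" for t using that by (auto simp: P_def path_image_def)
  have "\<forall>k. \<exists>m c. m \<ge> Suc k \<and> c 0 = x \<and> fine_chain (1 / real (Suc k)) c 0 m \<and> (\<forall>i\<le>m. f (c i) = g (real i / real m))"
    using discrete_lift[OF g x(1), of "1 / real (Suc _)" "Suc _"] x(2)
    unfolding pathstart_def by (metis of_nat_0_less_iff zero_less_Suc zero_less_divide_1_iff)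
  then obtain m c where mc: "\<And>k. m k \<ge> Suc k" "\<And>k. c k 0 = x" "\<And>k. fine_chain (1 / real (Suc k)) (c k) 0 (m k)"
    "\<And>k i. i \<le> m k \<Longrightarrow> f (c k i) = g (real i / real (m k))"
    by metis
  \<comment> \<open>\<open>J k t\<close> is the last grid index not beyond \<open>t\<close>, so
    \<open>F k\<close> is the step function of the k-th chain.\<close>
  define J where "J k t = nat \<lfloor>t * real (m k)\<rfloor>" for k t
  define F where "F k t = c k (J k t)" for k t
  have mpos: "m k > 0" for k using mc(1)[of k] by simp
  let ?\<tau> = "\<lambda>k t. real (J k t) / real (m k)"
  have J: "J k t \<le> m k" "?\<tau> k t \<le> t" "t - 1 / real (m k) < ?\<tau> k t"
     "?\<tau> k t \<in> {0..1}"
    if t: "t \<in> {0..1}" for k t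
  proof -
    have 1: "t * real (m k) \<le> real (m k)" using t by (simp add: mult_left_le_one_le)
    have 0: "0 \<le> t * real (m k)" using t by simp
    show 2: "J k t \<le> m k" unfolding J_def using 1 by linarith
    have 3: "real (J k t) \<le> t * real (m k)" "t * real (m k) < real (J k t) + 1"
      unfolding J_def using 0 by linarith+
    then have "(t * real (m k) - 1) / real (m k) < ?\<tau> k t"
      using mpos[of k] by (intro divide_strict_right_mono) auto
    then show "?\<tau> k t \<le> t" "t - 1 / real (m k) < ?\<tau> k t"
      using mpos[of k] 3 by (auto simp: diff_divide_distrib divide_le_eq)
    show "?\<tau> k t \<in> {0..1}" using 2 mpos[of k] by simp
  qed
  have fF: "f (F k t) = g (?\<tau> k t)" if "t \<in> {0..1}" for k t
    using mc(4) J(1)[OF that] by (simp add: F_def)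
  have FX: "F k t \<in> X" if "t \<in> {0..1}" for k t
    using mc(3)[of k] J(1,4)[OF that, of k] fF[OF that] gP by (auto simp: F_def X_def fine_chain_def)
  have J0: "F k 0 = x" for k using mc(2) by (simp add: F_def J_def)
  have minv: "1 / real (m k) \<le> 1 / real (Suc k)" for k
    using mc(1)[of k] by (intro divide_left_mono) auto
  have gu: "uniformly_continuous_on {0..1} g"
    using g by (simp add: path_def compact_uniformly_continuous)
  \<comment> \<open>Step functions jump, so equicontinuity is only claimed for all large
    \<open>k\<close>. The grid contributes up to \<open>r/2\<close> to a parameter distance, which
    leaves \<open>r/2\<close> for the distance of \<open>s\<close> and \<open>t\<close>.\<close>
  have equi: "\<exists>d>0. \<exists>K. \<forall>k\<ge>K. \<forall>s\<in>{0..1}. \<forall>t\<in>{0..1}. \<bar>s - t\<bar> < d \<longrightarrow> dist (F k s) (F k t) < e" if e: "e > 0" for e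
  proof -
    obtain d \<epsilon> where d: "d > 0" "\<epsilon> > 0" "\<And>c i j. i \<le> j \<Longrightarrow> fine_chain \<epsilon> c i j \<Longrightarrow> f (c i) \<in> P \<Longrightarrow>
        (\<And>k. k \<in> {i..j} \<Longrightarrow> dist (f (c i)) (f (c k)) < d) \<Longrightarrow> dist (c i) (c j) < e"
      using fine_chain_small[OF P e] by metis
    obtain r where r: "r > 0" "\<And>s t. s \<in> {0..1} \<Longrightarrow> t \<in> {0..1} \<Longrightarrow> dist t s < r \<Longrightarrow> dist (g t) (g s) < d"
      using d(1) gu unfolding uniformly_continuous_on_def by meson
    obtain K where K: "1 / min \<epsilon> (r/2) < real K" using reals_Archimedean2 by blast
    have Kk: "1 / real (Suc k) < min \<epsilon> (r/2)" if "k \<ge> K" for k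
    proof -
      have inv: "1 / x < \<mu>" if "1 / \<mu> < x" "0 < \<mu>" "0 < x" for \<mu> x :: real
        using that by (simp add: field_simps)
      have "1 / min \<epsilon> (r/2) < real (Suc k)" using K that by linarith
      then show ?thesis by (rule inv) (use d r in auto)
    qed
    have main: "dist (F k s) (F k t) < e" if k: "k \<ge> K" and st: "s \<in> {0..1}" "t \<in> {0..1}" "s \<le> t" "t - s < r/2" for k s t
      unfolding F_def
    proof (rule d(3))
      show le: "J k s \<le> J k t" using st by (simp add: J_def nat_mono floor_mono mult_right_mono)
      show "fine_chain \<epsilon> (c k) (J k s) (J k t)"
        using fine_chain_mono[OF mc(3)[of k], of \<epsilon>] J(1)[OF st(2), of k] Kk[OF k]
        by (auto simp: fine_chain_def)
      show "f (c k (J k s)) \<in> P" using FX[OF st(1), of k] by (simp add: F_def X_def)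
      fix i assume i: "i \<in> {J k s..J k t}"
      then have im: "i \<le> m k" using J(1)[OF st(2), of k] by simp
      have "?\<tau> k s \<le> real i / real (m k)" "real i / real (m k) \<le> ?\<tau> k t"
        using i by (auto intro!: divide_right_mono)
      then have "dist (?\<tau> k s) (real i / real (m k)) < r"
        using J(2)[OF st(2), of k] J(3)[OF st(1), of k] st(4) minv[of k] Kk[OF k] by (auto simp: dist_real_def)
      then have "dist (g (?\<tau> k s)) (g (real i / real (m k))) < d"
        by (intro r(2)) (use im mpos[of k] J(4)[OF st(1)] in auto)
      then show "dist (f (c k (J k s))) (f (c k i)) < d"
        using mc(4)[OF im] mc(4)[OF J(1)[OF st(1)]] by simp
    qed
    show ?thesis
    proof (intro exI[of _ "r/2"] exI[of _ K] conjI allI impI ballI)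
      fix k s t assume "K \<le> k" "s \<in> {0..1::real}" "t \<in> {0..1::real}" "\<bar>s - t\<bar> < r/2"
      then show "dist (F k s) (F k t) < e"
        using main[of k s t] main[of k t s] by (cases "s \<le> t") (auto simp: dist_commute)
    qed (use r in auto)
  qed
  define S where "S = {0..1::real} \<inter> \<rat>"
  have "countable S" unfolding S_def by (simp add: countable_rat)
  moreover obtain B where "\<And>z. z \<in> X \<Longrightarrow> norm z \<le> B" using compact_imp_bounded[OF X] bounded_iff by blast
  ultimately obtain r where r: "strict_mono (r::nat\<Rightarrow>nat)" "\<And>t. t \<in> S \<Longrightarrow> \<exists>l. (\<lambda>n. F (r n) t) \<longlonglongrightarrow> l"
    using function_convergent_subsequence[of S F B] FX unfolding S_def by (metis IntD1)
  then obtain l where l: "\<And>t. t \<in> S \<Longrightarrow> (\<lambda>n. F (r n) t) \<longlonglongrightarrow> l t" by metis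
  have "uniformly_continuous_on S l"
    unfolding uniformly_continuous_on_def
  proof (intro allI impI)
    fix e :: real assume "e > 0"
    then obtain d K where d: "d > 0" "\<And>k s t. k \<ge> K \<Longrightarrow> s \<in> {0..1} \<Longrightarrow> t \<in> {0..1} \<Longrightarrow> \<bar>s - t\<bar> < d \<Longrightarrow> dist (F k s) (F k t) < e/2"
      using equi[of "e/2"] by (metis half_gt_zero)
    have "dist (l t) (l s) < e" if "s \<in> S" "t \<in> S" "dist t s < d" for s t
    proof -
      have "(\<lambda>n. dist (F (r n) t) (F (r n) s)) \<longlonglongrightarrow> dist (l t) (l s)"
        by (intro tendsto_dist l that)
      moreover have "dist (F (r n) t) (F (r n) s) \<le> e/2" if "n \<ge> K" for n
      proof -
        have "r n \<ge> K" using that strict_mono_imp_increasing[OF r(1), of n] by linarith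
        then show ?thesis using d(2)[of "r n" t s] \<open>s \<in> S\<close> \<open>t \<in> S\<close> \<open>dist t s < d\<close>
          by (auto simp: S_def dist_real_def intro: less_imp_le)
      qed
      ultimately have "dist (l t) (l s) \<le> e/2" using LIMSEQ_le_const2 by blast
      then show ?thesis using \<open>e > 0\<close> by simp
    qed
    then show "\<exists>d>0. \<forall>s\<in>S. \<forall>t\<in>S. dist t s < d \<longrightarrow> dist (l t) (l s) < e" using d(1) by blast
  qed
  then obtain h where h: "uniformly_continuous_on (closure S) h" "\<And>t. t \<in> S \<Longrightarrow> l t = h t"
    using uniformly_continuous_on_extension_on_closure by metis
  have cl: "closure S = {0..1}"
  proof
    show "closure S \<subseteq> {0..1}" by (rule closure_minimal) (auto simp: S_def)
    have "{0..1} = closure ({0<..<1} \<inter> \<rat> :: real set)"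
      using closure_open_Int_superset[of "{0<..<1::real}" "\<rat>"] Rats_closure_real by simp
    also have "\<dots> \<subseteq> closure S" by (rule closure_mono) (auto simp: S_def)
    finally show "{0..1} \<subseteq> closure S" .
  qed
  have hc: "continuous_on {0..1} h" using uniformly_continuous_imp_continuous[OF h(1)] cl by simp
  have lX: "h t \<in> X" if "t \<in> S" for t
    using closed_sequentially[OF compact_imp_closed[OF X] _ l[OF that]] FX that h(2)[OF that] by (auto simp: S_def)
  have hX: "h ` {0..1} \<subseteq> X"
    using image_closure_subset[of S h X] hc cl lX compact_imp_closed[OF X] by auto
  have fh: "f (h t) - g t = 0" if t: "t \<in> S" for t
  proof -
    have t1: "t \<in> {0..1}" using t by (simp add: S_def)
    have hD: "h t \<in> D" using lX[OF t] by (simp add: X_def)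
    have "isCont f (h t)" using cont hD continuous_on_eq_continuous_at[OF open_D] by blast
    then have "(\<lambda>n. f (F (r n) t)) \<longlonglongrightarrow> f (h t)"
      using isCont_tendsto_compose[OF _ l[OF t]] h(2)[OF t] by simp
    moreover have "(\<lambda>n. f (F (r n) t)) \<longlonglongrightarrow> g t"
    proof -
      have "(\<lambda>k. ?\<tau> k t) \<longlonglongrightarrow> t"
      proof (rule tendsto_sandwich[where f="\<lambda>k. t - 1 / real (Suc k)" and h="\<lambda>_. t"])
        show "\<forall>\<^sub>F k in sequentially. t - 1 / real (Suc k) \<le> ?\<tau> k t"
          using J(3)[OF t1] minv by (intro always_eventually allI) (smt (verit))
        show "\<forall>\<^sub>F k in sequentially. ?\<tau> k t \<le> t" using J(2)[OF t1] by simp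
        show "(\<lambda>k. t - 1 / real (Suc k)) \<longlonglongrightarrow> t"
          using tendsto_diff[OF tendsto_const[of t] lim_1_over_n[THEN LIMSEQ_Suc]] by simp
      qed simp
      then have "(\<lambda>k. g (?\<tau> k t)) \<longlonglongrightarrow> g t"
        by (rule continuous_on_tendsto_compose[OF g(1)[unfolded path_def] _ t1])
           (use J(4)[OF t1] in \<open>auto intro: always_eventually\<close>)
      from LIMSEQ_subseq_LIMSEQ[OF this r(1)] show ?thesis using fF[OF t1] by (simp add: o_def)
    qed
    ultimately show ?thesis using LIMSEQ_unique by force
  qed
  show thesis
  proof
    show "path h" using hc by (simp add: path_def)
    show "path_image h \<subseteq> D" using hX by (auto simp: path_image_def X_def)
    have 0: "0 \<in> S" by (simp add: S_def)
    show "pathstart h = x" using LIMSEQ_unique[OF l[OF 0]] h(2)[OF 0] J0 by (simp add: pathstart_def)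
    fix t :: real assume t: "t \<in> {0..1}"
    have "continuous_on {0..1} (\<lambda>t. f (h t) - g t)"
      using hX hc g(1) unfolding path_def X_def
      by (intro continuous_intros continuous_on_compose2[OF cont hc]) auto
    then show "f (h t) = g t" using continuous_constant_on_closure[of S "\<lambda>t. f (h t) - g t" 0 t] fh cl t by auto
  qed
qed

end

text \<open>Openness of the image turns closedness into properness; a fibre is then compact and
  discrete, hence finite.\<close>

lemma proper_open_finite_mapI:
  assumes "open D" "continuous_on D f" "open_mapping D f" "discrete_mapping D f" "closed_mapping D f"
  shows "proper_open_finite_map D f"
proof
  show om: "open (f ` U)" if "open U" "U \<subseteq> D" for U using that assms by (simp add: open_mapping_def)
  show pr: "compact (D \<inter> f -` K)" if "compact K" "K \<subseteq> f ` D" for K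
    using closed_mapping_proper[OF assms(1,2,5) om that] assms(1) by simp
  show "finite (D \<inter> f -` {y})" if "y \<in> f ` D" for y
    using pr[of "{y}"] that assms(4) by (auto simp: discrete_mapping_def simp flip: discrete_compact_finite_iff)
qed (use assms in auto)

section \<open>Integration tools\<close>

text \<open>Young's inequality for \<rho>/a and w/b, integrated and multiplied by a b; the
  reciprocals of the conjugate exponents add up to 1. Bounds in place of norms avoid roots of
  extended numbers.\<close>

lemma nn_integral_Holder:
  fixes \<rho> :: "'a \<Rightarrow> ennreal" and w :: "'a \<Rightarrow> real" and n :: nat
  assumes n: "n \<ge> 2" and [measurable]: "\<rho> \<in> borel_measurable M" "w \<in> borel_measurable M"
    and w: "\<And>x. w x \<ge> 0" and ab: "a > 0" "b > 0"
    and I: "(\<integral>\<^sup>+x. \<rho> x ^ n \<partial>M) \<le> ennreal (a ^ n)"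
    and J: "(\<integral>\<^sup>+x. ennreal (w x powr (real n / (real n - 1))) \<partial>M)
              \<le> ennreal (b powr (real n / (real n - 1)))"
  shows "(\<integral>\<^sup>+x. \<rho> x * ennreal (w x) \<partial>M) \<le> ennreal (a * b)"
proof -
  define q where "q = real n / (real n - 1)"
  have q: "q > 1" "1 / real n + 1 / q = 1" using n by (auto simp: q_def field_simps)
  let ?A = "1 / (real n * a ^ n)" and ?B = "1 / (q * b powr q)"
  let ?R = "\<lambda>x. ennreal (a * b) * (ennreal ?A * \<rho> x ^ n + ennreal ?B * ennreal (w x powr q))"
  have pt: "\<rho> x * ennreal (w x) \<le> ?R x" for x
  proof (cases "\<rho> x")
    \<comment> \<open>Where \<rho> is infinite, so is the right-hand side, because the coefficient
      of its power is positive.\<close>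
    case top
    have "?A > 0" using ab n by simp
    then have "?R x = \<infinity>"
      using top ab n by (auto simp: ennreal_mult_top ennreal_top_mult ennreal_mult_eq_top_iff top_power_ennreal)
    then show ?thesis by simp
  next
    case (real r)
    have "(r / a) * (w x / b) \<le> (r / a) powr n / n + (w x / b) powr q / q"
      using n q ab real w by (intro Youngs_inequality) auto
    also have "(r / a) powr n = r ^ n / a ^ n"
      using real ab n by (cases "r = 0") (auto simp: powr_realpow power_divide)
    also have "(w x / b) powr q = w x powr q / b powr q" using w ab by (simp add: powr_divide)
    finally have "r * w x \<le> (a * b) * (r ^ n / a ^ n / n + w x powr q / b powr q / q)"
      using ab by (simp add: field_simps)
    also have "\<dots> = (a * b) * (?A * r ^ n + ?B * w x powr q)" by (simp add: field_simps)
    finally have "ennreal (r * w x) \<le> ennreal ((a * b) * (?A * r ^ n + ?B * w x powr q))"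
      by (rule ennreal_leI)
    moreover have "\<rho> x * ennreal (w x) = ennreal (r * w x)" using real w by (simp add: ennreal_mult)
    moreover have "ennreal ?A * \<rho> x ^ n + ennreal ?B * ennreal (w x powr q) = ennreal (?A * r ^ n + ?B * w x powr q)"
      using real ab q n by (simp add: ennreal_power flip: ennreal_mult ennreal_plus)
    moreover have "ennreal ((a * b) * (?A * r ^ n + ?B * w x powr q)) = ennreal (a * b) * ennreal (?A * r ^ n + ?B * w x powr q)"
      using real ab q n by (intro ennreal_mult) auto
    ultimately show ?thesis by (simp only:)
  qed
  have "(\<integral>\<^sup>+x. \<rho> x * ennreal (w x) \<partial>M) \<le>
      (\<integral>\<^sup>+x. ?R x \<partial>M)"
    by (intro nn_integral_mono pt)
  also have "\<dots> = ennreal (a * b) * (ennreal ?A * (\<integral>\<^sup>+x. \<rho> x ^ n \<partial>M) +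
      ennreal ?B * (\<integral>\<^sup>+x. ennreal (w x powr q) \<partial>M))"
    by (subst nn_integral_cmult, measurable, subst nn_integral_add, measurable)
       (simp add: nn_integral_cmult)
  also have "\<dots> \<le> ennreal (a * b) * (ennreal ?A * ennreal (a ^ n) + ennreal ?B * ennreal (b powr q))"
    using I J unfolding q_def[symmetric] by (intro mult_left_mono add_mono) auto
  also have "\<dots> = ennreal (a * b * (?A * a ^ n + ?B * b powr q))"
    using ab q n by (simp flip: ennreal_plus ennreal_mult)
  also have "?A * a ^ n + ?B * b powr q = 1 / n + 1 / q" using ab q n by simp
  finally show ?thesis using q by simp
qed

lemma emeasure_ball_vec:
  "r \<ge> 0 \<Longrightarrow> emeasure lborel (ball (b::real^'n) r) = ennreal (unit_ball_vol CARD('n) * r ^ CARD('n))"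
  by (simp add: emeasure_ball)

lemma unit_ball_vol_gt_0: "unit_ball_vol (real CARD('n::finite)) > 0"
  by simp

text \<open>Hoelder against the indicator of the ball. The bound is written as the volume of the
  ball times a bound for the mean, the form in which the averages are combined later.\<close>

lemma nn_integral_ball_Holder:
  fixes \<phi> :: "real^'n \<Rightarrow> ennreal"
  assumes n: "CARD('n) \<ge> 2" and [measurable]: "\<phi> \<in> borel_measurable borel" and c: "c > 0" and r: "r > 0"
    and I: "(\<integral>\<^sup>+x. \<phi> x ^ CARD('n) \<partial>lborel) \<le> ennreal (c ^ CARD('n))"
  shows "(\<integral>\<^sup>+x\<in>ball b r. \<phi> x \<partial>lborel) \<le>
     ennreal (unit_ball_vol CARD('n) * r ^ CARD('n) * (c * unit_ball_vol CARD('n) powr (- 1 / CARD('n)) / r))"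
proof -
  let ?n = "real CARD('n)" and ?V = "unit_ball_vol (real CARD('n))"
  define m where "m = ?V * r ^ CARD('n)"
  have V: "?V > 0" by (rule unit_ball_vol_gt_0)
  have m: "m > 0" using V r by (simp add: m_def)
  define w where "w x = indicat_real (ball b r) x" for x
  have [measurable]: "w \<in> borel_measurable borel" unfolding w_def
    by (intro borel_measurable_indicator borel_open open_ball)
  have "(\<integral>\<^sup>+x. ennreal (w x powr (?n / (?n - 1))) \<partial>lborel) = (\<integral>\<^sup>+x. indicator (ball b r) x \<partial>lborel)"
    by (intro nn_integral_cong) (auto simp: w_def indicator_def)
  also have "\<dots> = ennreal m" using emeasure_ball_vec[of r b] r by (simp add: m_def)
  also have "m = (m powr ((?n - 1) / ?n)) powr (?n / (?n - 1))"
    using n m by (simp add: powr_powr)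
  finally have J: "(\<integral>\<^sup>+x. ennreal (w x powr (?n / (?n - 1))) \<partial>lborel) \<le> ennreal ((m powr ((?n - 1) / ?n)) powr (?n / (?n - 1)))"
    by simp
  have "(\<integral>\<^sup>+x\<in>ball b r. \<phi> x \<partial>lborel) = (\<integral>\<^sup>+x. \<phi> x * ennreal (w x) \<partial>lborel)"
    by (intro nn_integral_cong) (auto simp: w_def indicator_def)
  also have "\<dots> \<le> ennreal (c * m powr ((?n - 1) / ?n))"
  proof (rule nn_integral_Holder[OF n _ _ _ c _ I J])
    show "\<phi> \<in> borel_measurable lborel" "w \<in> borel_measurable lborel" by measurable
  qed (use m in \<open>auto simp: w_def\<close>)
  also have "m powr ((?n - 1) / ?n) = m * m powr (- 1 / ?n)"
  proof -
    have "(?n - 1) / ?n = 1 + - 1 / ?n" using n by (simp add: field_simps)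
    then show ?thesis using m by (simp only: powr_add) simp
  qed
  also have "m powr (- 1 / ?n) = ?V powr (- 1 / ?n) * (r ^ CARD('n)) powr (- 1 / ?n)"
    unfolding m_def using V r by (simp add: powr_mult)
  also have "(r ^ CARD('n)) powr (- 1 / ?n) = 1 / r"
    using r n by (simp add: powr_powr powr_minus_divide flip: powr_realpow)
  finally show ?thesis by (simp add: m_def mult.commute mult.left_commute)
qed

section \<open>Changes of variables: translations, dilations and shears\<close>

lemma nn_integral_lborel_translate:
  fixes g :: "'a::euclidean_space \<Rightarrow> ennreal"
  assumes [measurable]: "g \<in> borel_measurable borel"
  shows "(\<integral>\<^sup>+x. g (x + c) \<partial>lborel) = (\<integral>\<^sup>+x. g x \<partial>lborel)"
proof -
  have "(\<integral>\<^sup>+x. g x \<partial>lborel) = (\<integral>\<^sup>+x. g x \<partial>distr lborel borel ((+) c))" by (simp add: lborel_distr_plus)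
  also have "\<dots> = (\<integral>\<^sup>+x. g (x + c) \<partial>lborel)" by (subst nn_integral_distr) (auto simp: add.commute)
  finally show ?thesis ..
qed

lemma nn_integral_lborel_affine:
  fixes g :: "real^'n \<Rightarrow> ennreal"
  assumes [measurable]: "g \<in> borel_measurable borel" and t: "t > 0"
  shows "(\<integral>\<^sup>+x. g (y + t *\<^sub>R x) \<partial>lborel) = ennreal (1 / t ^ CARD('n)) * (\<integral>\<^sup>+x. g x \<partial>lborel)"
proof -
  have "(\<integral>\<^sup>+x. g x \<partial>lborel) = (\<integral>\<^sup>+x. g x \<partial>(density (distr lborel borel (\<lambda>x. y + t *\<^sub>R x)) (\<lambda>_. \<bar>t\<bar>^DIM(real^'n))))"
    using lborel_affine[of t y] t by simp
  also have "\<dots> = ennreal (t ^ CARD('n)) * (\<integral>\<^sup>+x. g (y + t *\<^sub>R x) \<partial>lborel)"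
    using t by (subst nn_integral_density, measurable, subst nn_integral_distr) (auto simp: nn_integral_cmult)
  finally have "ennreal (1 / t ^ CARD('n)) * (\<integral>\<^sup>+x. g x \<partial>lborel) =
      ennreal (1 / t ^ CARD('n)) * ennreal (t ^ CARD('n)) * (\<integral>\<^sup>+x. g (y + t *\<^sub>R x) \<partial>lborel)"
    by (simp add: mult.assoc)
  also have "ennreal (1 / t ^ CARD('n)) * ennreal (t ^ CARD('n)) = 1"
    using t by (simp flip: ennreal_mult)
  finally show ?thesis by simp
qed

text \<open>Nonlinear shears preserve Lebesgue measure. Splitting off the coordinate \<open>k\<close> is avoided by
  integrating against a probability density \<open>\<phi>\<close> in an auxiliary variable \<open>r\<close>: the shear is moved from
  the argument of \<open>g\<close> into the argument of \<open>\<phi>\<close> by translations only.\<close>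

lemma nn_integral_shear:
  fixes g :: "real^'n \<Rightarrow> ennreal" and v :: "real \<Rightarrow> real^'n"
  assumes [measurable]: "g \<in> borel_measurable borel" "v \<in> borel_measurable borel"
    and v: "\<And>s. v s $ k = 0"
  shows "(\<integral>\<^sup>+x. g (x + v (x $ k)) \<partial>lborel) = (\<integral>\<^sup>+x. g x \<partial>lborel)"
proof -
  \<comment> \<open>\<open>P\<close> removes the k-th coordinate, so translating by
    \<open>P r\<close> does not change the argument \<open>x $ k\<close> of the shear.\<close>
  define P :: "real^'n \<Rightarrow> real^'n" where "P x = x - (x $ k) *\<^sub>R axis k 1" for x
  have Pk: "P x $ k = 0" for x by (simp add: P_def axis_def)
  have Pv: "P (r + v s) = P r + v s" for r s using v by (simp add: P_def)
  have "continuous_on UNIV P" unfolding P_def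
    by (intro continuous_intros)
  then have [measurable]: "P \<in> borel_measurable borel" by (rule borel_measurable_continuous_onI)
  have [measurable]: "(\<lambda>x::real^'n. x $ k) \<in> borel_measurable borel"
    by (intro borel_measurable_continuous_onI continuous_intros)
  define \<phi> :: "real^'n \<Rightarrow> ennreal" where "\<phi> = indicator (cbox 0 One)"
  have [measurable]: "\<phi> \<in> borel_measurable borel" unfolding \<phi>_def by measurable
  have \<phi>1: "(\<integral>\<^sup>+x. \<phi> x \<partial>lborel) = 1" unfolding \<phi>_def by (simp add: emeasure_lborel_cbox_eq)
  let ?G = "\<lambda>x. g (x + v (x $ k))"
  have "(\<integral>\<^sup>+x. ?G x \<partial>lborel) = (\<integral>\<^sup>+r. \<phi> r * (\<integral>\<^sup>+x. ?G x \<partial>lborel) \<partial>lborel)"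
    by (subst nn_integral_multc) (auto simp: \<phi>1)
  also have "\<dots> = (\<integral>\<^sup>+r. \<phi> r * (\<integral>\<^sup>+x. ?G (x + P r) \<partial>lborel) \<partial>lborel)"
    by (intro nn_integral_cong arg_cong2[where f=times] refl nn_integral_lborel_translate[symmetric]) measurable
  also have "\<dots> = (\<integral>\<^sup>+r. (\<integral>\<^sup>+x. \<phi> r * g (x + P r + v (x $ k)) \<partial>lborel) \<partial>lborel)"
    by (intro nn_integral_cong, subst nn_integral_cmult) (auto simp: Pk)
  also have "\<dots> = (\<integral>\<^sup>+x. (\<integral>\<^sup>+r. \<phi> r * g (x + P r + v (x $ k)) \<partial>lborel) \<partial>lborel)"
    by (rule lborel_pair.Fubini') measurable
  \<comment> \<open>With \<open>r + v (x $ k)\<close> as the new variable the shear leaves the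
    argument of \<open>g\<close> and becomes a translation of the density.\<close>
  also have "\<dots> = (\<integral>\<^sup>+x. (\<integral>\<^sup>+r. \<phi> ((r + v (x $ k)) - v (x $ k)) * g (x + P (r + v (x $ k))) \<partial>lborel) \<partial>lborel)"
    by (simp add: Pv add.assoc)
  also have "\<dots> = (\<integral>\<^sup>+x. (\<integral>\<^sup>+r. \<phi> (r - v (x $ k)) * g (x + P r) \<partial>lborel) \<partial>lborel)"
    by (intro nn_integral_cong nn_integral_lborel_translate) measurable
  also have "\<dots> = (\<integral>\<^sup>+r. (\<integral>\<^sup>+x. \<phi> (r - v (x $ k)) * g (x + P r) \<partial>lborel) \<partial>lborel)"
    by (rule lborel_pair.Fubini'[symmetric]) measurable
  \<comment> \<open>Evaluating \<open>v\<close> at \<open>x + P r\<close> changes nothing, and for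
    fixed \<open>r\<close> the integrand then depends on \<open>x\<close> through
    \<open>x + P r\<close> alone.\<close>
  also have "\<dots> = (\<integral>\<^sup>+r. (\<integral>\<^sup>+x. \<phi> (r - v ((x + P r) $ k)) * g (x + P r) \<partial>lborel) \<partial>lborel)"
    by (simp add: Pk)
  also have "\<dots> = (\<integral>\<^sup>+r. (\<integral>\<^sup>+x. \<phi> (r - v (x $ k)) * g x \<partial>lborel) \<partial>lborel)"
    by (intro nn_integral_cong nn_integral_lborel_translate) measurable
  also have "\<dots> = (\<integral>\<^sup>+x. (\<integral>\<^sup>+r. \<phi> (r - v (x $ k)) * g x \<partial>lborel) \<partial>lborel)"
    by (rule lborel_pair.Fubini') measurable
  also have "\<dots> = (\<integral>\<^sup>+x. (\<integral>\<^sup>+r. \<phi> (r + - v (x $ k)) \<partial>lborel) * g x \<partial>lborel)"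
    by (intro nn_integral_cong, subst nn_integral_multc) auto
  also have "\<dots> = (\<integral>\<^sup>+x. g x \<partial>lborel)"
    by (subst nn_integral_lborel_translate) (auto simp: \<phi>1)
  finally show ?thesis .
qed

text \<open>A dilation by \<tau> of the n - 1 directions orthogonal to axis \<open>k\<close>,
  followed by a shear: this is how points move along segments that stay in such hyperplanes.\<close>

lemma nn_integral_scaled_shear:
  fixes g :: "real^'n \<Rightarrow> ennreal" and v :: "real \<Rightarrow> real^'n"
  assumes [measurable]: "g \<in> borel_measurable borel" "v \<in> borel_measurable borel"
    and v: "\<And>s. v s $ k = 0" and \<tau>: "\<tau> > 0"
  shows "(\<integral>\<^sup>+x. g (axis k (x $ k) + \<tau> *\<^sub>R (x - axis k (x $ k)) + v (x $ k)) \<partial>lborel)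
       = ennreal (1 / \<tau> ^ (CARD('n) - 1)) * (\<integral>\<^sup>+x. g x \<partial>lborel)"
proof -
  let ?c = "\<lambda>j::real^'n. if j = axis k 1 then 1 else \<tau>"
  let ?T = "\<lambda>x::real^'n. (\<Sum>j\<in>Basis. (?c j * (x \<bullet> j)) *\<^sub>R j)"
  let ?G = "\<lambda>x. g (x + v (x $ k))"
  let ?t = "ennreal (1 / \<tau> ^ (CARD('n) - 1))"
  have [measurable]: "(\<lambda>x::real^'n. x $ k) \<in> borel_measurable borel"
    by (intro borel_measurable_continuous_onI continuous_intros)
  have kB: "axis k (1::real) \<in> Basis" by (simp add: axis_in_Basis_iff)
  have T: "?T x = axis k (x $ k) + \<tau> *\<^sub>R (x - axis k (x $ k))" for x
  proof -
    have "?T x = (\<Sum>j\<in>Basis. (\<tau> * (x \<bullet> j)) *\<^sub>R j + (if j = axis k 1 then ((1 - \<tau>) * (x \<bullet> j)) *\<^sub>R j else 0))"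
      by (intro sum.cong) (auto simp: algebra_simps)
    also have "\<dots> = \<tau> *\<^sub>R x + ((1 - \<tau>) * (x \<bullet> axis k 1)) *\<^sub>R axis k 1"
      using kB by (simp add: sum.distrib euclidean_representation flip: scaleR_scaleR scaleR_sum_right)
    also have "\<dots> = axis k (x $ k) + \<tau> *\<^sub>R (x - axis k (x $ k))"
    proof -
      have "x \<bullet> axis k 1 = x $ k" by (simp add: inner_axis)
      then show ?thesis by (simp only:) (simp add: vec_eq_iff axis_def algebra_simps)
    qed
    finally show ?thesis .
  qed
  have prod: "(\<Prod>j\<in>Basis. \<bar>?c j\<bar>) = \<tau> ^ (CARD('n) - 1)"
  proof -
    have "(\<Prod>j\<in>Basis. \<bar>?c j\<bar>) = \<bar>?c (axis k 1)\<bar> * (\<Prod>j\<in>Basis - {axis k 1}. \<bar>?c j\<bar>)"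
      using kB by (intro prod.remove) auto
    also have "(\<Prod>j\<in>Basis - {axis k 1}. \<bar>?c j\<bar>) = (\<Prod>j\<in>(Basis::(real^'n) set) - {axis k 1}. \<tau>)"
      using \<tau> by (intro prod.cong) auto
    also have "\<dots> = \<tau> ^ (CARD('n) - 1)" using kB by (simp add: card_Diff_singleton)
    finally show ?thesis by simp
  qed
  have "(\<integral>\<^sup>+x. g x \<partial>lborel) = (\<integral>\<^sup>+x. ?G x \<partial>lborel)"
    by (rule nn_integral_shear[OF _ _ v, symmetric]) auto
  also have "\<dots> = (\<integral>\<^sup>+x. ?G x \<partial>(density (distr lborel borel (\<lambda>x. 0 + ?T x)) (\<lambda>_. (\<Prod>j\<in>Basis. \<bar>?c j\<bar>))))"
    using \<tau> by (subst lborel_affine_euclidean[of ?c 0]) auto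
  also have "\<dots> = ennreal (\<tau> ^ (CARD('n) - 1)) * (\<integral>\<^sup>+x. ?G (?T x) \<partial>lborel)"
    unfolding prod by (subst nn_integral_density, measurable, subst nn_integral_distr) (auto simp: nn_integral_cmult)
  also have "(\<lambda>x. ?G (?T x)) = (\<lambda>x. g (axis k (x $ k) + \<tau> *\<^sub>R (x - axis k (x $ k)) + v (x $ k)))"
    unfolding T by (simp add: axis_def)
  finally have "?t * (\<integral>\<^sup>+x. g x \<partial>lborel) =
     ?t * ennreal (\<tau> ^ (CARD('n) - 1)) *
     (\<integral>\<^sup>+x. g (axis k (x $ k) + \<tau> *\<^sub>R (x - axis k (x $ k)) + v (x $ k)) \<partial>lborel)"
    by (simp add: mult.assoc)
  also have "?t * ennreal (\<tau> ^ (CARD('n) - 1)) = 1"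
    using \<tau> by (simp flip: ennreal_mult)
  finally show ?thesis by simp
qed

section \<open>Integrals of inverse powers\<close>

lemma DERIV_minus_inverse_power:
  fixes t :: real
  assumes "t > 0"
  shows "((\<lambda>t. - (1 / t ^ n)) has_field_derivative real n / t ^ Suc n) (at t within S)"
proof -
  have "((\<lambda>t. - (inverse t ^ n)) has_field_derivative
      - (real n * ((- (inverse t * 1 * inverse t)) * inverse t ^ (n - Suc 0)))) (at t within S)"
    by (intro DERIV_minus DERIV_power DERIV_inverse' DERIV_ident) (use assms in auto)
  also have "- (real n * ((- (inverse t * 1 * inverse t)) * inverse t ^ (n - Suc 0))) = real n / t ^ Suc n"
    using assms by (cases n) (auto simp: field_simps)
  finally show ?thesis by (simp add: power_inverse divide_inverse)
qed

lemma nn_integral_inverse_power_le: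
  assumes u: "u > 0" and n: "n > (0::nat)"
  shows "(\<integral>\<^sup>+t\<in>{u..T}. ennreal (1 / t ^ Suc n) \<partial>lborel) \<le> ennreal (1 / (real n * u ^ n))"
proof (cases "u \<le> T")
  case True
  have "(\<integral>\<^sup>+t\<in>{u..T}. ennreal (1 / t ^ Suc n) \<partial>lborel) =
      ennreal (- (1 / (real n * T ^ n)) - - (1 / (real n * u ^ n)))"
  proof (rule nn_integral_FTC_Icc)
    show "((\<lambda>t. - (1 / (real n * t ^ n))) has_field_derivative 1 / t ^ Suc n) (at t)"
      if "t \<in> {u..T}" for t
      using DERIV_cmult[OF DERIV_minus_inverse_power[of t n UNIV], of "1 / real n"] that u n by simp
  qed (use u True in auto)
  also have "\<dots> \<le> ennreal (1 / (real n * u ^ n))" using u True by (intro ennreal_leI) simp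
  finally show ?thesis .
qed simp

text \<open>Layer cake: \<open>1 / u ^ n\<close> is \<open>1 / r2 ^ n\<close> plus the integral of \<open>n / t ^ (n + 1)\<close> over \<open>u < t < r2\<close>.\<close>

lemma nn_integral_inverse_power_layer:
  fixes u :: "'a \<Rightarrow> real" and q :: "'a \<Rightarrow> ennreal"
  assumes M: "sigma_finite_measure M" and [measurable]: "u \<in> borel_measurable M" "q \<in> borel_measurable M"
    and r: "0 < r1" "r1 \<le> r2" and n: "n > (0::nat)" and \<kappa>: "\<kappa> \<ge> 0"
    and vol: "\<And>t. t \<in> {r1..r2} \<Longrightarrow> (\<integral>\<^sup>+x. q x * indicator {x. u x < t} x \<partial>M) \<le> ennreal (\<kappa> * t ^ n)"
  shows "(\<integral>\<^sup>+x. q x * ennreal (1 / u x ^ n) * indicator {x. r1 \<le> u x \<and> u x < r2} x \<partial>M)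
     \<le> ennreal (\<kappa> * (1 + real n * ln (r2 / r1)))"
proof -
  interpret sigma_finite_measure M by (rule M)
  interpret pair_sigma_finite M lborel by standard
  let ?I = "\<lambda>x. indicator {x. r1 \<le> u x \<and> u x < r2} x :: ennreal"
  let ?k = "\<lambda>x t. ennreal (real n / t ^ Suc n) * indicator {t. u x < t} t * indicator {r1..r2} t"
  let ?h = "\<lambda>x t. q x * indicator {x. u x < t} x * (ennreal (real n / t ^ Suc n) * indicator {r1..r2} t)"
  have pt: "ennreal (1 / u x ^ n) * ?I x \<le> (ennreal (1 / r2 ^ n) + (\<integral>\<^sup>+t. ?k x t \<partial>lborel)) * ?I x" for x
  proof (cases "r1 \<le> u x \<and> u x < r2")
    case True
    have "(\<integral>\<^sup>+t\<in>{u x..r2}. ennreal (real n / t ^ Suc n) \<partial>lborel) =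
        ennreal (- (1 / r2 ^ n) - - (1 / u x ^ n))"
    proof (rule nn_integral_FTC_Icc)
      show "((\<lambda>t. - (1 / t ^ n)) has_field_derivative real n / t ^ Suc n) (at t)"
        if "t \<in> {u x..r2}" for t
        using that True r by (intro DERIV_minus_inverse_power) auto
    qed (use r True in auto)
    also have "(\<integral>\<^sup>+t\<in>{u x..r2}. ennreal (real n / t ^ Suc n) \<partial>lborel) = (\<integral>\<^sup>+t. ?k x t \<partial>lborel)"
      by (rule nn_integral_cong_AE, rule AE_mp[OF AE_lborel_singleton[of "u x"]])
         (use True in \<open>auto simp: indicator_def\<close>)
    finally have "ennreal (1 / r2 ^ n) + (\<integral>\<^sup>+t. ?k x t \<partial>lborel) = ennreal (1 / r2 ^ n) + ennreal (1 / u x ^ n - 1 / r2 ^ n)"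
      by simp
    also have "\<dots> = ennreal (1 / u x ^ n)"
      using True r by (subst ennreal_plus[symmetric]) (auto intro!: divide_left_mono power_mono mult_pos_pos)
    finally show ?thesis by simp
  qed simp
  have "(\<integral>\<^sup>+x. q x * ennreal (1 / u x ^ n) * ?I x \<partial>M) \<le>
      (\<integral>\<^sup>+x. ennreal (1 / r2 ^ n) * (q x * indicator {x. u x < r2} x) +
        (\<integral>\<^sup>+t. ?h x t \<partial>lborel) \<partial>M)"
  proof (rule nn_integral_mono)
    fix x
    have "q x * ennreal (1 / u x ^ n) * ?I x \<le> q x * ((ennreal (1 / r2 ^ n) + (\<integral>\<^sup>+t. ?k x t \<partial>lborel)) * ?I x)"
      using pt[of x] by (simp add: mult.assoc mult_left_mono)
    also have "\<dots> \<le> ennreal (1 / r2 ^ n) * (q x * indicator {x. u x < r2} x) + q x * (\<integral>\<^sup>+t. ?k x t \<partial>lborel)"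
      by (auto simp: indicator_def algebra_simps)
    also have "q x * (\<integral>\<^sup>+t. ?k x t \<partial>lborel) =
       (\<integral>\<^sup>+t. ?h x t \<partial>lborel)"
      by (subst nn_integral_cmult[symmetric]) (auto intro!: nn_integral_cong simp: indicator_def)
    finally show "q x * ennreal (1 / u x ^ n) * ?I x \<le> ennreal (1 / r2 ^ n) * (q x * indicator {x. u x < r2} x) +
        (\<integral>\<^sup>+t. ?h x t \<partial>lborel)" .
  qed
  \<comment> \<open>The constant term will contribute \<kappa>, the layers \<kappa> n times the
    integral of 1/t.\<close>
  also have "\<dots> = ennreal (1 / r2 ^ n) * (\<integral>\<^sup>+x. q x * indicator {x. u x < r2} x \<partial>M) +
      (\<integral>\<^sup>+x. \<integral>\<^sup>+t. ?h x t \<partial>lborel \<partial>M)"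
    by (subst nn_integral_add) (auto simp: nn_integral_cmult)
  also have "(\<integral>\<^sup>+x. \<integral>\<^sup>+t. ?h x t \<partial>lborel \<partial>M)
     = (\<integral>\<^sup>+t. \<integral>\<^sup>+x. ?h x t \<partial>M \<partial>lborel)"
    by (rule Fubini'[symmetric]) measurable
  also have "\<dots> = (\<integral>\<^sup>+t. (\<integral>\<^sup>+x. q x * indicator {x. u x < t} x \<partial>M) * (ennreal (real n / t ^ Suc n) * indicator {r1..r2} t) \<partial>lborel)"
    by (intro nn_integral_cong nn_integral_multc) measurable
  also have "\<dots> \<le> (\<integral>\<^sup>+t\<in>{r1..r2}. ennreal (\<kappa> * real n * (1 / t)) \<partial>lborel)"
  proof (rule nn_integral_mono)
    fix t
    show "(\<integral>\<^sup>+x. q x * indicator {x. u x < t} x \<partial>M) * (ennreal (real n / t ^ Suc n) * indicator {r1..r2} t)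
        \<le> ennreal (\<kappa> * real n * (1 / t)) * indicator {r1..r2} t"
    proof (cases "t \<in> {r1..r2}")
      case True
      have "(\<integral>\<^sup>+x. q x * indicator {x. u x < t} x \<partial>M) * ennreal (real n / t ^ Suc n)
          \<le> ennreal (\<kappa> * t ^ n) * ennreal (real n / t ^ Suc n)"
        by (intro mult_right_mono vol True) auto
      also have "\<dots> = ennreal (\<kappa> * t ^ n * (real n / t ^ Suc n))"
        using \<kappa> True r by (intro ennreal_mult[symmetric]) auto
      also have "\<kappa> * t ^ n * (real n / t ^ Suc n) = \<kappa> * real n * (1 / t)" using True r by simp
      finally show ?thesis using True by simp
    qed simp
  qed
  also have "\<dots> = ennreal (\<kappa> * real n * ln r2 - \<kappa> * real n * ln r1)"
  proof (rule nn_integral_FTC_Icc)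
    show "((\<lambda>t. \<kappa> * real n * ln t) has_field_derivative \<kappa> * real n * (1 / t)) (at t)"
      if "t \<in> {r1..r2}" for t
      using that r by (auto intro!: derivative_eq_intros)
  qed (use r \<kappa> in auto)
  also have "\<kappa> * real n * ln r2 - \<kappa> * real n * ln r1 = \<kappa> * real n * ln (r2 / r1)"
    using r by (simp add: ln_div algebra_simps)
  also have "ennreal (1 / r2 ^ n) * (\<integral>\<^sup>+x. q x * indicator {x. u x < r2} x \<partial>M) \<le> ennreal (1 / r2 ^ n) * ennreal (\<kappa> * r2 ^ n)"
    using r by (intro mult_left_mono vol) auto
  also have "\<dots> = ennreal \<kappa>" using r \<kappa> by (subst ennreal_mult[symmetric]) auto
  finally show ?thesis using \<kappa> r by (simp add: add_mono algebra_simps flip: ennreal_plus)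
qed

section \<open>Averaged segment integrals\<close>

lemma nn_integral_powr_01:
  assumes "p > -1"
  shows "(\<integral>\<^sup>+t\<in>{0..1}. ennreal (t powr p) \<partial>lborel) = ennreal (1 / (p + 1))"
proof -
  have "((\<lambda>t. t powr p) has_integral (1 powr (p + 1) / (p + 1))) {0..1}"
    by (rule has_integral_powr_from_0) (use assms in auto)
  then have "(\<integral>\<^sup>+t. ennreal (indicator {0..1} t * t powr p) \<partial>lborel) = ennreal (1 powr (p + 1) / (p + 1))"
    by (intro nn_integral_has_integral_lebesgue) auto
  moreover have "(\<integral>\<^sup>+t\<in>{0..1}. ennreal (t powr p) \<partial>lborel) = (\<integral>\<^sup>+t. ennreal (indicator {0..1} t * t powr p) \<partial>lborel)"
    by (intro nn_integral_cong) (auto simp: indicator_def)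
  ultimately show ?thesis by simp
qed

lemma borel_measurable_segment_integral [measurable]:
  fixes \<rho> :: "real^'n \<Rightarrow> ennreal"
  assumes [measurable]: "\<rho> \<in> borel_measurable borel" "x \<in> borel_measurable M" "y \<in> borel_measurable M"
  shows "(\<lambda>p. segment_integral (x p) (y p) \<rho>) \<in> borel_measurable M"
  unfolding segment_integral_def linepath_def by measurable

lemma segment_integral_commute:
  fixes \<rho> :: "real^'n \<Rightarrow> ennreal"
  assumes [measurable]: "\<rho> \<in> borel_measurable borel"
  shows "segment_integral x y \<rho> = segment_integral y x \<rho>"
proof -
  have "(\<integral>\<^sup>+t\<in>{0..1}. \<rho> (linepath x y t) \<partial>lborel) =
      ennreal \<bar>-1\<bar> * (\<integral>\<^sup>+t. \<rho> (linepath x y (1 + -1 * t)) * indicator {0..1} (1 + -1 * t) \<partial>lborel)"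
    unfolding linepath_def by (rule nn_integral_real_affine) auto
  also have "\<dots> = (\<integral>\<^sup>+t\<in>{0..1}. \<rho> (linepath y x t) \<partial>lborel)"
    by (auto intro!: nn_integral_cong simp: linepath_def indicator_def add.commute)
  finally show ?thesis by (simp add: segment_integral_def dist_commute)
qed

text \<open>Fubini reduces a mean of segment integrals to slices with fixed parameter
  \<open>t\<close>, on which a change of variables is available.\<close>

lemma nn_integral_segment_le:
  fixes \<rho> :: "real^'n \<Rightarrow> ennreal" and x y :: "real^'n \<Rightarrow> real^'n"
  assumes [measurable]: "\<rho> \<in> borel_measurable borel" "x \<in> borel_measurable borel" "y \<in> borel_measurable borel"
    "B \<in> sets borel"
    and d: "\<And>p. p \<in> B \<Longrightarrow> dist (x p) (y p) \<le> \<Delta>"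
  shows "(\<integral>\<^sup>+p\<in>B. segment_integral (x p) (y p) \<rho> \<partial>lborel) \<le>
     ennreal \<Delta> * (\<integral>\<^sup>+t\<in>{0..1}. (\<integral>\<^sup>+p\<in>B. \<rho> (linepath (x p) (y p) t) \<partial>lborel) \<partial>lborel)"
proof -
  let ?F = "\<lambda>p t. \<rho> (linepath (x p) (y p) t) * indicator {0..1} t * indicator B p"
  have [measurable]: "(\<lambda>(p, t). \<rho> (linepath (x p) (y p) t)) \<in> borel_measurable (borel \<Otimes>\<^sub>M borel)"
    unfolding linepath_def by measurable
  have "(\<integral>\<^sup>+p\<in>B. segment_integral (x p) (y p) \<rho> \<partial>lborel) \<le>
      (\<integral>\<^sup>+p. ennreal \<Delta> * (\<integral>\<^sup>+t. ?F p t \<partial>lborel) \<partial>lborel)"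
  proof (rule nn_integral_mono)
    fix p
    show "segment_integral (x p) (y p) \<rho> * indicator B p \<le>
      ennreal \<Delta> * (\<integral>\<^sup>+t. ?F p t \<partial>lborel)"
      using d[of p] by (cases "p \<in> B") (auto simp: segment_integral_def intro!: mult_right_mono ennreal_leI)
  qed
  also have "\<dots> = ennreal \<Delta> * (\<integral>\<^sup>+p. (\<integral>\<^sup>+t. ?F p t \<partial>lborel) \<partial>lborel)"
    by (rule nn_integral_cmult) measurable
  also have "(\<integral>\<^sup>+p. (\<integral>\<^sup>+t. ?F p t \<partial>lborel) \<partial>lborel)
     = (\<integral>\<^sup>+t. (\<integral>\<^sup>+p. ?F p t \<partial>lborel) \<partial>lborel)"
    by (rule lborel_pair.Fubini'[symmetric]) measurable
  also have "\<dots> = (\<integral>\<^sup>+t\<in>{0..1}. (\<integral>\<^sup>+p\<in>B. \<rho> (linepath (x p) (y p) t) \<partial>lborel) \<partial>lborel)"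
    by (intro nn_integral_cong) (auto simp: indicator_def)
  finally show ?thesis .
qed

text \<open>\<open>a\<close> bounds the n-norm of the density, and \<kappa> is the factor by which
  Hoelder turns it into the bound \<open>a * \<kappa> / r\<close> for the mean over a ball of radius
  \<open>r\<close>.\<close>

locale Ln_density =
  fixes \<rho> :: "real^'n \<Rightarrow> ennreal" and a V \<kappa> :: real
  defines V_def: "V \<equiv> unit_ball_vol (real CARD('n))"
    and \<kappa>_def: "\<kappa> \<equiv> V powr (- 1 / real CARD('n))"
  assumes dim: "CARD('n) \<ge> 2" and measurable_density [measurable]: "\<rho> \<in> borel_measurable borel"
    and a: "a > 0" and Ln_norm_le: "(\<integral>\<^sup>+x. \<rho> x ^ CARD('n) \<partial>lborel) \<le> ennreal (a ^ CARD('n))"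
begin

lemma V_pos: "V > 0" and \<kappa>_pos: "\<kappa> > 0"
proof -
  show "V > 0" unfolding V_def by (rule unit_ball_vol_gt_0)
  then show "\<kappa> > 0" by (simp add: \<kappa>_def)
qed

lemma emeasure_ball_V: "r \<ge> 0 \<Longrightarrow> emeasure lborel (ball (b::real^'n) r) = ennreal (V * r ^ CARD('n))"
  by (simp add: emeasure_ball_vec V_def)

lemma ball_Holder:
  fixes \<phi> :: "real^'n \<Rightarrow> ennreal"
  assumes "\<phi> \<in> borel_measurable borel" "c > 0" "r > 0"
    and "(\<integral>\<^sup>+x. \<phi> x ^ CARD('n) \<partial>lborel) \<le> ennreal (c ^ CARD('n))"
  shows "(\<integral>\<^sup>+x\<in>ball b r. \<phi> x \<partial>lborel) \<le> ennreal (V * r ^ CARD('n) * (c * \<kappa> / r))"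
  using nn_integral_ball_Holder[OF dim assms] by (simp add: V_def \<kappa>_def)

text \<open>Pulling \<rho> back by a dilation with factor \<open>t\<close> divides its n-norm by
  \<open>t\<close>.\<close>

lemma ball_average:
  assumes r: "r > 0" and t: "t > 0"
  shows "(\<integral>\<^sup>+x\<in>ball b r. \<rho> (y + t *\<^sub>R x) \<partial>lborel) \<le> ennreal (V * r ^ CARD('n) * (a / t * \<kappa> / r))"
proof (rule ball_Holder)
  have "(\<integral>\<^sup>+x. \<rho> (y + t *\<^sub>R x) ^ CARD('n) \<partial>lborel) = ennreal (1 / t ^ CARD('n)) * (\<integral>\<^sup>+x. \<rho> x ^ CARD('n) \<partial>lborel)"
    by (rule nn_integral_lborel_affine) (use t in auto)
  also have "\<dots> \<le> ennreal (1 / t ^ CARD('n)) * ennreal (a ^ CARD('n))"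
    by (intro mult_left_mono Ln_norm_le) simp
  also have "\<dots> = ennreal ((a / t) ^ CARD('n))"
    using t a by (simp add: power_divide flip: ennreal_mult)
  finally show "(\<integral>\<^sup>+x. \<rho> (y + t *\<^sub>R x) ^ CARD('n) \<partial>lborel) \<le> ennreal ((a / t) ^ CARD('n))" .
qed (use r t a in auto)

text \<open>At parameter \<open>t\<close> the segments keep the k-th coordinate and contract the
  others by \<open>t\<close>, so the n-norm of a slice is at most \<open>a\<close> times t to the
  power -(n - 1)/n. The integral of this power over the unit interval is n, the source of the factor
  \<open>real CARD('n)\<close>.\<close>

lemma cone_average:
  assumes [measurable]: "e \<in> borel_measurable borel" and l: "l > 0" and C: "C \<ge> 0"
    and e: "\<And>p. p \<in> ball c l \<Longrightarrow> e (p $ k) $ k = p $ k"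
    and d: "\<And>p. p \<in> ball c l \<Longrightarrow> dist (e (p $ k)) p \<le> C * l"
  shows "(\<integral>\<^sup>+p\<in>ball c l. segment_integral (e (p $ k)) p \<rho> \<partial>lborel)
     \<le> ennreal (V * l ^ CARD('n) * (a * (C * real CARD('n) * \<kappa>)))"
proof -
  let ?n = "real CARD('n)"
  let ?m = "V * l ^ CARD('n)"
  have [measurable]: "(\<lambda>x::real^'n. x $ k) \<in> borel_measurable borel"
    by (intro borel_measurable_continuous_onI continuous_intros)
  have eq: "(\<lambda>s. axis k s :: real^'n) = (\<lambda>s. s *\<^sub>R axis k 1)"
    by (auto simp: vec_eq_iff axis_def)
  have [measurable]: "(\<lambda>s. axis k s :: real^'n) \<in> borel_measurable borel"
    by (subst eq) (intro borel_measurable_continuous_onI continuous_intros)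
  let ?p = "\<lambda>t. t powr (- (?n - 1) / ?n)"
  let ?J = "\<lambda>t. \<integral>\<^sup>+p\<in>ball c l. \<rho> (linepath (e (p $ k)) p t) \<partial>lborel"
  have slice: "?J t
      \<le> ennreal (?m * (a * \<kappa> / l)) * ennreal (?p t)" if t: "t > 0" for t
  proof -
    \<comment> \<open>The end point \<open>e (p $ k)\<close> depends on \<open>p $ k\<close> only
      and shares this coordinate with \<open>p\<close>, so its contribution beyond the contraction
      is a shear.\<close>
    define v where "v s = (1 - t) *\<^sub>R (e s - axis k (e s $ k))" for s
    have [measurable]: "v \<in> borel_measurable borel" unfolding v_def by measurable
    have vk: "v s $ k = 0" for s by (simp add: v_def axis_def)
    define \<phi> where "\<phi> p = \<rho> (axis k (p $ k) + t *\<^sub>R (p - axis k (p $ k)) + v (p $ k))" for p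
    have [measurable]: "\<phi> \<in> borel_measurable borel" unfolding \<phi>_def by measurable
    let ?c = "a * ?p t"
    have eq: "\<rho> (linepath (e (p $ k)) p t) = \<phi> p" if "p \<in> ball c l" for p
    proof -
      have "linepath (e (p $ k)) p t = axis k (p $ k) + t *\<^sub>R (p - axis k (p $ k)) + v (p $ k)"
        unfolding v_def e[OF that] linepath_def by (simp add: algebra_simps)
      then show ?thesis by (simp add: \<phi>_def)
    qed
    have "(\<integral>\<^sup>+p. \<phi> p ^ CARD('n) \<partial>lborel) = ennreal (1 / t ^ (CARD('n) - 1)) * (\<integral>\<^sup>+x. \<rho> x ^ CARD('n) \<partial>lborel)"
      unfolding \<phi>_def by (rule nn_integral_scaled_shear[OF _ _ vk t]) auto
    also have "\<dots> \<le> ennreal (1 / t ^ (CARD('n) - 1)) * ennreal (a ^ CARD('n))"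
      by (intro mult_left_mono Ln_norm_le) simp
    also have "\<dots> = ennreal (?c ^ CARD('n))"
    proof -
      have "(?p t) ^ CARD('n) = t powr (- (?n - 1))"
        using t dim by (simp add: powr_powr flip: powr_realpow)
      also have "\<dots> = 1 / t ^ (CARD('n) - 1)"
        using t dim powr_minus_divide[of t "?n - 1"] powr_realpow[OF t, of "CARD('n) - 1"]
        by (simp add: of_nat_diff)
      finally show ?thesis using a t by (simp add: power_mult_distrib mult.commute flip: ennreal_mult)
    qed
    finally have I: "(\<integral>\<^sup>+p. \<phi> p ^ CARD('n) \<partial>lborel) \<le> ennreal (?c ^ CARD('n))" .
    have "?J t = (\<integral>\<^sup>+p\<in>ball c l. \<phi> p \<partial>lborel)"
      using eq by (intro nn_integral_cong) (auto simp: indicator_def)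
    also have "\<dots> \<le> ennreal (?m * (?c * \<kappa> / l))"
      by (rule ball_Holder[OF _ _ l I]) (use a t in auto)
    also have "?m * (?c * \<kappa> / l) = (?m * (a * \<kappa> / l)) * ?p t" by simp
    also have "ennreal \<dots> = ennreal (?m * (a * \<kappa> / l)) * ennreal (?p t)"
      by (rule ennreal_mult) (use a l V_pos \<kappa>_pos in auto)
    finally show ?thesis .
  qed
  have "(\<integral>\<^sup>+p\<in>ball c l. segment_integral (e (p $ k)) p \<rho> \<partial>lborel) \<le>
      ennreal (C * l) * (\<integral>\<^sup>+t\<in>{0..1}. ?J t \<partial>lborel)"
    by (rule nn_integral_segment_le) (use d in auto)
  also have "(\<integral>\<^sup>+t\<in>{0..1}. ?J t \<partial>lborel)
      \<le> (\<integral>\<^sup>+t. ennreal (?m * (a * \<kappa> / l)) * (ennreal (?p t) * indicator {0..1} t) \<partial>lborel)"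
  proof (rule nn_integral_mono_AE, rule AE_mp[OF AE_lborel_singleton[of 0]], intro AE_I2 impI)
    fix t :: real assume "t \<noteq> 0"
    then show "?J t * indicator {0..1} t
        \<le> ennreal (?m * (a * \<kappa> / l)) * (ennreal (?p t) * indicator {0..1} t)"
      using slice[of t] by (auto simp: indicator_def)
  qed
  also have "\<dots> = ennreal (?m * (a * \<kappa> / l)) * ennreal (1 / (- (?n - 1) / ?n + 1))"
    by (subst nn_integral_cmult, measurable, subst nn_integral_powr_01) (use dim in \<open>auto simp: field_simps\<close>)
  also have "1 / (- (?n - 1) / ?n + 1) = ?n" using dim by (simp add: field_simps)
  also have "ennreal (C * l) * (ennreal (?m * (a * \<kappa> / l)) * ennreal ?n) = ennreal (C * l * (?m * (a * \<kappa> / l) * ?n))"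
    using C l a V_pos \<kappa>_pos by (simp flip: ennreal_mult)
  also have "C * l * (?m * (a * \<kappa> / l) * ?n) = ?m * (a * (C * ?n * \<kappa>))" using l by simp
  finally show ?thesis by (simp add: mult_left_mono)
qed

text \<open>Exchanging the integrals turns the mean into an integral of \<rho> against a radial
  weight, equal to l^n / (n D^(n-1)) at distances D between l and T l from \<open>c\<close>. On this
  shell Hoelder is sharp for \<rho> proportional to 1/D, the extremal density of a spherical ring;
  hence the exact coefficient n V. The core of radius \<open>l\<close> and the boundary term of the
  layer cake add the 2/n.\<close>

lemma dilation_average:
  assumes l: "l > 0" and T: "T \<ge> 1"
  shows "(\<integral>\<^sup>+p\<in>ball c l. segment_integral p (c + T *\<^sub>R (p - c)) \<rho> \<partial>lborel)
     \<le> ennreal (V * l ^ CARD('n) * (a * ((real CARD('n) * V) powr (- 1 / real CARD('n)) *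
          (2 / real CARD('n) + ln T) powr ((real CARD('n) - 1) / real CARD('n)))))"
proof -
  let ?n = "real CARD('n)"
  let ?m = "V * l ^ CARD('n)"
  let ?N = "CARD('n)"
  define q where "q = ?n / (?n - 1)"
  have q: "q > 1" using dim by (simp add: q_def)
  define D where "D x = dist c x" for x
  let ?k = "\<lambda>x t. ennreal (1 / t ^ Suc ?N) * indicator {t. D x < t * l} t :: ennreal"
  have [measurable]: "D \<in> borel_measurable borel" unfolding D_def by measurable
  \<comment> \<open>\<open>w\<close> bounds D x times the integral of 1/t^(n+1) over those t in
    [1, T] with D x < t l: this range starts at 1 inside the ball, at D x / l outside, and is empty
    from T l on.\<close>
  define w where "w x = (if D x < l then D x / ?n else if D x < T * l then l ^ ?N / (?n * D x ^ (?N - 1)) else 0)" for x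
  have [measurable]: "w \<in> borel_measurable borel" unfolding w_def by measurable
  have w0: "w x \<ge> 0" for x using l by (simp add: w_def D_def)
  have [measurable]: "ball c l \<in> sets borel" by auto
  let ?r = "\<lambda>p t. ennreal (D p) * \<rho> (c + t *\<^sub>R (p - c))"
  let ?W = "\<lambda>x. \<integral>\<^sup>+t. ?k x t * indicator {1..T} t \<partial>lborel"
  let ?b = "l ^ ?N / ?n * (V * (2 + ?n * ln T)) powr ((?n - 1) / ?n)"
  let ?s = "\<lambda>p. segment_integral p (c + T *\<^sub>R (p - c)) \<rho>"
  have seg: "?s p \<le>
      (\<integral>\<^sup>+t\<in>{1..T}. ?r p t \<partial>lborel)" for p
  proof (cases "T = 1")
    case True
    then show ?thesis by (simp add: segment_integral_def)
  next
    case False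
    then have T1: "T > 1" using T by simp
    have "(\<integral>\<^sup>+t\<in>{1..T}. ?r p t \<partial>lborel) =
       ennreal \<bar>T - 1\<bar> * (\<integral>\<^sup>+s. ennreal (D p) * \<rho> (c + (1 + (T - 1) * s) *\<^sub>R (p - c)) * indicator {1..T} (1 + (T - 1) * s) \<partial>lborel)"
      by (rule nn_integral_real_affine) (use T1 in auto)
    also have "\<dots> = ennreal \<bar>T - 1\<bar> * (\<integral>\<^sup>+s. ennreal (D p) * (\<rho> (linepath p (c + T *\<^sub>R (p - c)) s) * indicator {0..1} s) \<partial>lborel)"
    proof (rule arg_cong2[where f=times, OF refl], rule nn_integral_cong)
      fix s
      have "c + (1 + (T - 1) * s) *\<^sub>R (p - c) = linepath p (c + T *\<^sub>R (p - c)) s"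
        by (simp add: linepath_def algebra_simps)
      moreover have "indicator {1..T} (1 + (T - 1) * s) = (indicator {0..1} s :: ennreal)"
      proof -
        have "(T - 1) * s \<le> (T - 1) * 1 \<longleftrightarrow> s \<le> 1" using T1 by (intro mult_le_cancel_left_pos) simp
        then have "1 + (T - 1) * s \<le> T \<longleftrightarrow> s \<le> 1" by (simp only: mult_1_right) linarith
        then show ?thesis using T1 by (simp add: indicator_def zero_le_mult_iff)
      qed
      ultimately show "ennreal (D p) * \<rho> (c + (1 + (T - 1) * s) *\<^sub>R (p - c)) * indicator {1..T} (1 + (T - 1) * s)
        = ennreal (D p) * (\<rho> (linepath p (c + T *\<^sub>R (p - c)) s) * indicator {0..1} s)"
        by (simp add: mult.assoc)
    qed
    also have "\<dots> = ennreal \<bar>T - 1\<bar> * (ennreal (D p) * (\<integral>\<^sup>+s\<in>{0..1}. \<rho> (linepath p (c + T *\<^sub>R (p - c)) s) \<partial>lborel))"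
      unfolding linepath_def by (subst nn_integral_cmult) auto
    also have "\<dots> = ?s p"
    proof -
      have "p - (c + T *\<^sub>R (p - c)) = (T - 1) *\<^sub>R (c - p)" by (simp add: algebra_simps)
      then have "dist p (c + T *\<^sub>R (p - c)) = \<bar>T - 1\<bar> * D p" by (simp add: dist_norm D_def)
      then show ?thesis unfolding segment_integral_def by (simp add: ennreal_mult D_def mult.assoc)
    qed
    finally show ?thesis by simp
  qed
  have inner: "(\<integral>\<^sup>+p. ?r p t * indicator (ball c l) p \<partial>lborel)
      = (\<integral>\<^sup>+x. \<rho> x * ennreal (D x) * (?k x t) \<partial>lborel)"
    if t: "t > 0" for t
  proof -
    let ?G = "\<lambda>x. ennreal (D x / t) * \<rho> x * indicator {x. D x < t * l} x"
    have "(\<integral>\<^sup>+p. ?r p t * indicator (ball c l) p \<partial>lborel)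
        = (\<integral>\<^sup>+p. ?G ((c - t *\<^sub>R c) + t *\<^sub>R p) \<partial>lborel)"
    proof (rule nn_integral_cong)
      fix p
      have eq: "(c - t *\<^sub>R c) + t *\<^sub>R p = c + t *\<^sub>R (p - c)" by (simp add: algebra_simps)
      have D: "D (c + t *\<^sub>R (p - c)) = t * D p"
        using t by (simp add: D_def dist_norm norm_minus_commute)
      have iff: "D (c + t *\<^sub>R (p - c)) < t * l \<longleftrightarrow> p \<in> ball c l" unfolding D using t by (simp add: D_def)
      have "D (c + t *\<^sub>R (p - c)) / t = D p" unfolding D using t by simp
      with iff show "?r p t * indicator (ball c l) p = ?G ((c - t *\<^sub>R c) + t *\<^sub>R p)"
        unfolding eq by (simp add: indicator_def del: mem_ball)
    qed
    also have "\<dots> = ennreal (1 / t ^ ?N) * (\<integral>\<^sup>+x. ?G x \<partial>lborel)"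
      by (rule nn_integral_lborel_affine) (use t in auto)
    also have "\<dots> = (\<integral>\<^sup>+x. ennreal (1 / t ^ ?N) * ?G x \<partial>lborel)"
      by (rule nn_integral_cmult[symmetric]) measurable
    also have "\<dots> = (\<integral>\<^sup>+x. \<rho> x * ennreal (D x) * (?k x t) \<partial>lborel)"
    proof (intro nn_integral_cong)
      fix x
      have "ennreal (1 / t ^ ?N) * ennreal (D x / t) = ennreal (D x) * ennreal (1 / t ^ Suc ?N)"
        using t by (simp add: D_def mult.commute flip: ennreal_mult)
      then show "ennreal (1 / t ^ ?N) * ?G x = \<rho> x * ennreal (D x) * (?k x t)"
        by (simp add: indicator_def mult_ac)
    qed
    finally show ?thesis .
  qed
  have weight: "ennreal (D x) * ?W x
      \<le> ennreal (w x)" for x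
  proof -
    have D0: "D x \<ge> 0" by (simp add: D_def)
    consider "D x < l" | "l \<le> D x" "D x < T * l" | "l \<le> D x" "T * l \<le> D x" by linarith
    then show ?thesis
    proof cases
      case 1
      have "?W x
          \<le> (\<integral>\<^sup>+t\<in>{1..T}. ennreal (1 / t ^ Suc ?N) \<partial>lborel)"
        by (intro nn_integral_mono) (auto simp: indicator_def)
      also have "\<dots> \<le> ennreal (1 / ?n)"
        using nn_integral_inverse_power_le[of 1 ?N T] by simp
      finally have "ennreal (D x) * ?W x
          \<le> ennreal (D x) * ennreal (1 / ?n)" by (rule mult_left_mono) simp
      also have "\<dots> = ennreal (w x)" using 1 D0 by (simp add: w_def flip: ennreal_mult)
      finally show ?thesis .
    next
      case 2
      have Dp: "D x > 0" using 2 l by simp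
      have "?W x
          \<le> (\<integral>\<^sup>+t\<in>{D x / l..T}. ennreal (1 / t ^ Suc ?N) \<partial>lborel)"
        using l by (intro nn_integral_mono) (auto simp: indicator_def field_simps)
      also have "\<dots> \<le> ennreal (1 / (?n * (D x / l) ^ ?N))"
        using Dp l by (intro nn_integral_inverse_power_le) auto
      finally have "ennreal (D x) * ?W x
          \<le> ennreal (D x) * ennreal (1 / (?n * (D x / l) ^ ?N))" by (rule mult_left_mono) simp
      also have "\<dots> = ennreal (D x * (1 / (?n * (D x / l) ^ ?N)))" using D0 l by (simp flip: ennreal_mult)
      also have "D x * (1 / (?n * (D x / l) ^ ?N)) = w x"
      proof -
        have "D x ^ ?N = D x * D x ^ (?N - 1)" using dim by (simp flip: power_Suc)
        then show ?thesis using 2 Dp l by (simp add: w_def power_divide)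
      qed
      finally show ?thesis .
    next
      case 3
      have "?k x t * indicator {1..T} t = 0" for t
      proof (cases "t \<in> {1..T}")
        case True
        then have "t * l \<le> T * l" using l by (intro mult_right_mono) auto
        then show ?thesis using 3 by simp
      qed simp
      then have "?W x
          = (\<integral>\<^sup>+t. 0 \<partial>(lborel :: real measure))"
        by (intro nn_integral_cong)
      then show ?thesis by (simp only: nn_integral_const mult_zero_left mult_zero_right) simp
    qed
  qed
  have "(\<integral>\<^sup>+p\<in>ball c l. ?s p \<partial>lborel) \<le>
      (\<integral>\<^sup>+p. (\<integral>\<^sup>+t. ?r p t * indicator (ball c l) p * indicator {1..T} t \<partial>lborel) \<partial>lborel)"
    using seg by (intro nn_integral_mono) (auto simp: indicator_def)
  also have "\<dots> = (\<integral>\<^sup>+t. (\<integral>\<^sup>+p. ?r p t * indicator (ball c l) p * indicator {1..T} t \<partial>lborel) \<partial>lborel)"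
    by (rule lborel_pair.Fubini'[symmetric]) measurable
  also have "\<dots> = (\<integral>\<^sup>+t. (\<integral>\<^sup>+x. \<rho> x * ennreal (D x) * (?k x t * indicator {1..T} t) \<partial>lborel) \<partial>lborel)"
  proof (rule nn_integral_cong)
    fix t
    show "(\<integral>\<^sup>+p. ?r p t * indicator (ball c l) p * indicator {1..T} t \<partial>lborel)
       = (\<integral>\<^sup>+x. \<rho> x * ennreal (D x) * (?k x t * indicator {1..T} t) \<partial>lborel)"
    proof (cases "t \<in> {1..T}")
      case True
      then show ?thesis using inner[of t] by simp
    qed simp
  qed
  also have "\<dots> = (\<integral>\<^sup>+x. (\<integral>\<^sup>+t. \<rho> x * ennreal (D x) * (?k x t * indicator {1..T} t) \<partial>lborel) \<partial>lborel)"
    by (rule lborel_pair.Fubini') measurable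
  also have "\<dots> = (\<integral>\<^sup>+x. \<rho> x * (ennreal (D x) * (\<integral>\<^sup>+t. (?k x t * indicator {1..T} t) \<partial>lborel)) \<partial>lborel)"
    by (intro nn_integral_cong, subst nn_integral_cmult) (auto simp: mult.assoc)
  also have "\<dots> \<le> (\<integral>\<^sup>+x. \<rho> x * ennreal (w x) \<partial>lborel)"
    by (intro nn_integral_mono mult_left_mono weight) simp
  also have "\<dots> \<le> ennreal (a * ?b)"
  proof (rule nn_integral_Holder[OF dim _ _ w0 a _ Ln_norm_le])
    show "\<rho> \<in> borel_measurable lborel" "w \<in> borel_measurable lborel" by measurable
    have lnT: "ln T \<ge> 0" using T by simp
    then have pos: "V * (2 + ?n * ln T) > 0" using V_pos by (intro mult_pos_pos add_pos_nonneg) auto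
    then have "0 < (V * (2 + ?n * ln T)) powr ((?n - 1) / ?n)"
      by (intro powr_gt_zero[THEN iffD2]) linarith
    then show "0 < l ^ ?N / ?n * (V * (2 + ?n * ln T)) powr ((?n - 1) / ?n)"
      using l by (intro mult_pos_pos divide_pos_pos) auto
    let ?A = "(l ^ ?N / ?n) powr q"
    \<comment> \<open>As n q = n + q, the core and the shell get the same prefactor
      \<open>?A\<close>.\<close>
    have key: "(l / ?n) powr q * l ^ ?N = ?A"
    proof -
      have "?A = (l ^ ?N) powr q / ?n powr q" using l by (simp add: powr_divide)
      also have "(l ^ ?N) powr q = l powr (?n * q)" using l by (simp add: powr_powr flip: powr_realpow)
      also have "?n * q = q + ?n" using dim by (simp add: q_def field_simps)
      also have "l powr (q + ?n) = l powr q * l ^ ?N" using l by (simp add: powr_add powr_realpow)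
      finally show ?thesis using l by (simp add: powr_divide)
    qed
    have "(\<integral>\<^sup>+x. ennreal (w x powr q) \<partial>lborel) \<le>
       (\<integral>\<^sup>+x. ennreal ((l / ?n) powr q) * indicator (ball c l) x +
         ennreal ?A * (1 * ennreal (1 / D x ^ ?N) * indicator {x. l \<le> D x \<and> D x < T * l} x) \<partial>lborel)"
    proof (rule nn_integral_mono)
      fix x
      consider "D x < l" | "l \<le> D x" "D x < T * l" | "l \<le> D x" "T * l \<le> D x" by linarith
      then show "ennreal (w x powr q) \<le> ennreal ((l / ?n) powr q) * indicator (ball c l) x +
         ennreal ?A * (1 * ennreal (1 / D x ^ ?N) * indicator {x. l \<le> D x \<and> D x < T * l} x)"
      proof cases
        case 1
        have "(D x / ?n) powr q \<le> (l / ?n) powr q"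
          using 1 q by (intro powr_mono2 divide_right_mono) (auto simp: D_def)
        then show ?thesis using 1 by (simp add: w_def D_def)
      next
        case 2
        have Dp: "D x > 0" using 2 l by simp
        have "(D x ^ (?N - 1)) powr q = D x powr (real (?N - 1) * q)"
          using Dp by (simp add: powr_powr flip: powr_realpow)
        also have "real (?N - 1) * q = ?n" using dim by (simp add: q_def of_nat_diff)
        finally have "w x powr q = ?A * (1 / D x ^ ?N)"
          using 2 Dp l by (simp add: w_def powr_divide powr_mult powr_realpow)
        then show ?thesis using 2 l by (simp add: D_def flip: ennreal_mult)
      next
        case 3
        then show ?thesis by (simp add: w_def)
      qed
    qed
    also have "\<dots> = ennreal ((l / ?n) powr q) * emeasure lborel (ball c l) +
        ennreal ?A * (\<integral>\<^sup>+x. 1 * ennreal (1 / D x ^ ?N) * indicator {x. l \<le> D x \<and> D x < T * l} x \<partial>lborel)"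
      by (subst nn_integral_add, measurable, subst nn_integral_cmult, measurable, subst nn_integral_cmult) auto
    also have "(\<integral>\<^sup>+x. 1 * ennreal (1 / D x ^ ?N) * indicator {x. l \<le> D x \<and> D x < T * l} x \<partial>lborel)
        \<le> ennreal (V * (1 + ?n * ln (T * l / l)))"
    proof (rule nn_integral_inverse_power_layer[OF sigma_finite_lborel])
      show "l \<le> T * l" using T l by simp
      fix t assume t: "t \<in> {l..T * l}"
      have "(\<integral>\<^sup>+x. 1 * indicator {x. D x < t} x \<partial>lborel) = emeasure lborel (ball c t)"
        by (simp add: D_def ball_def)
      then show "(\<integral>\<^sup>+x. 1 * indicator {x. D x < t} x \<partial>lborel) \<le> ennreal (V * t ^ ?N)"
        using emeasure_ball_V[of t c] t l by simp
    qed (use l V_pos in auto)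
    also have "ennreal ((l / ?n) powr q) * emeasure lborel (ball c l) + ennreal ?A * ennreal (V * (1 + ?n * ln (T * l / l)))
      = ennreal ((l / ?n) powr q * (V * l ^ ?N) + ?A * (V * (1 + ?n * ln T)))"
      using emeasure_ball_V[of l c] l V_pos lnT by (simp flip: ennreal_mult ennreal_plus)
    also have "(l / ?n) powr q * (V * l ^ ?N) + ?A * (V * (1 + ?n * ln T)) = ?A * (V * (2 + ?n * ln T))"
      using key by (simp add: algebra_simps)
    also have "\<dots> = ?b powr q"
    proof -
      have "A powr q * P = (A * P powr ((?n - 1) / ?n)) powr q" if "A > 0" "P > 0" for A P :: real
        using that dim by (simp add: powr_mult powr_powr q_def)
      from this[OF _ pos, of "l ^ ?N / ?n"] show ?thesis using l by simp
    qed
    finally show "(\<integral>\<^sup>+x. ennreal (w x powr (?n / (?n - 1))) \<partial>lborel) \<le>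
        ennreal (?b powr (?n / (?n - 1)))"
      unfolding q_def by (simp add: add_left_mono mult_left_mono)
  qed
  also have "l ^ ?N / ?n * (V * (2 + ?n * ln T)) powr ((?n - 1) / ?n) =
     ?m * ((?n * V) powr (- 1 / ?n) * (2 / ?n + ln T) powr ((?n - 1) / ?n))"
  proof -
    have "V * (2 + ?n * ln T) = (?n * V) * (2 / ?n + ln T)" using dim by (simp add: field_simps)
    then have "(V * (2 + ?n * ln T)) powr ((?n - 1) / ?n) = (?n * V) powr ((?n - 1) / ?n) * (2 / ?n + ln T) powr ((?n - 1) / ?n)"
      using V_pos T by (simp add: powr_mult)
    also have "(?n - 1) / ?n = 1 + - 1 / ?n" using dim by (simp add: field_simps)
    also have "(?n * V) powr (1 + - 1 / ?n) = ?n * V * (?n * V) powr (- 1 / ?n)"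
      using V_pos dim by (simp only: powr_add) simp
    finally show ?thesis using dim by (simp add: diff_divide_distrib)
  qed
  finally show ?thesis by (simp add: mult.left_commute mult.assoc)
qed

text \<open>Integrating first over p costs a factor 1/(1 - t), first over q a factor 1/t. Fubini
  allows the harmless order on each half of the parameter interval; this is why both end points are
  averaged.\<close>

lemma transfer_average:
  assumes l: "l > 0" and l': "l' > 0" and T: "T > 0"
    and d: "\<And>p q. p \<in> ball c l \<Longrightarrow> q \<in> ball c' l' \<Longrightarrow> dist (c + T *\<^sub>R (p - c)) q \<le> \<Delta>" and \<Delta>: "\<Delta> \<ge> 0"
  shows "(\<integral>\<^sup>+q\<in>ball c' l'. (\<integral>\<^sup>+p\<in>ball c l. segment_integral (c + T *\<^sub>R (p - c)) q \<rho> \<partial>lborel) \<partial>lborel)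
     \<le> ennreal ((V * l' ^ CARD('n)) * (V * l ^ CARD('n)) * (a * (\<Delta> * (2 * \<kappa> / (T * l) + 2 * \<kappa> / l'))))"
proof -
  let ?m = "V * l ^ CARD('n)" and ?m' = "V * l' ^ CARD('n)"
  let ?B = "ball c l" and ?B' = "ball c' l'"
  let ?K = "2 * \<kappa> / (T * l) + 2 * \<kappa> / l'"
  have m: "?m > 0" "?m' > 0" using l l' V_pos by auto
  have [measurable]: "?B \<in> sets borel" "?B' \<in> sets borel" by auto
  let ?L = "\<lambda>p q t. \<rho> (linepath (c + T *\<^sub>R (p - c)) q t)"
  let ?J = "\<lambda>q t. \<integral>\<^sup>+p\<in>?B. ?L p q t \<partial>lborel"
  have half1: "?J q t \<le> ennreal (?m * (a * ?K))" if t: "t \<le> 1/2" for q t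
  proof -
    have "?J q t =
        (\<integral>\<^sup>+p\<in>?B. \<rho> (((1 - t) *\<^sub>R (c - T *\<^sub>R c) + t *\<^sub>R q) + ((1 - t) * T) *\<^sub>R p) \<partial>lborel)"
      by (simp add: linepath_def algebra_simps)
    also have "\<dots> \<le> ennreal (?m * (a / ((1 - t) * T) * \<kappa> / l))"
      by (rule ball_average) (use t l T in auto)
    also have "\<dots> \<le> ennreal (?m * (a * ?K))"
    proof (intro ennreal_leI mult_left_mono)
      have "a / ((1 - t) * T) * \<kappa> / l = a * \<kappa> / (T * l) * (1 / (1 - t))" by simp
      also have "\<dots> \<le> a * \<kappa> / (T * l) * 2"
        using t a T l \<kappa>_pos by (intro mult_left_mono) (auto simp: field_simps)
      also have "\<dots> \<le> a * ?K" using a l' \<kappa>_pos by (simp add: algebra_simps)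
      finally show "a / ((1 - t) * T) * \<kappa> / l \<le> a * ?K" .
    qed (use m in auto)
    finally show ?thesis .
  qed
  have half2: "(\<integral>\<^sup>+q\<in>?B'. ?L p q t \<partial>lborel) \<le> ennreal (?m' * (a * ?K))" if t: "t > 1/2" for p t
  proof -
    have "(\<integral>\<^sup>+q\<in>?B'. ?L p q t \<partial>lborel) =
        (\<integral>\<^sup>+q\<in>?B'. \<rho> ((1 - t) *\<^sub>R (c + T *\<^sub>R (p - c)) + t *\<^sub>R q) \<partial>lborel)"
      by (simp add: linepath_def)
    also have "\<dots> \<le> ennreal (?m' * (a / t * \<kappa> / l'))"
      by (rule ball_average) (use t l' in auto)
    also have "\<dots> \<le> ennreal (?m' * (a * ?K))"
    proof (intro ennreal_leI mult_left_mono)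
      have "a / t * \<kappa> / l' = a * \<kappa> / l' * (1 / t)" by simp
      also have "\<dots> \<le> a * \<kappa> / l' * 2"
        using t a l' \<kappa>_pos by (intro mult_left_mono) (auto simp: field_simps)
      also have "\<dots> \<le> a * ?K" using a l T \<kappa>_pos by (simp add: algebra_simps)
      finally show "a / t * \<kappa> / l' \<le> a * ?K" .
    qed (use m in auto)
    finally show ?thesis .
  qed
  have slice: "(\<integral>\<^sup>+q\<in>?B'. ?J q t \<partial>lborel) \<le> ennreal (?m' * ?m * (a * ?K))" for t
  proof (cases "t \<le> 1/2")
    case True
    have "(\<integral>\<^sup>+q\<in>?B'. ?J q t \<partial>lborel) \<le> (\<integral>\<^sup>+q. ennreal (?m * (a * ?K)) * indicator ?B' q \<partial>lborel)"
      by (intro nn_integral_mono mult_right_mono half1 True) auto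
    also have "\<dots> = ennreal (?m * (a * ?K)) * ennreal ?m'"
      using l' by (subst nn_integral_cmult_indicator) (auto simp: emeasure_ball_V)
    also have "\<dots> = ennreal (?m' * ?m * (a * ?K))"
      using m by (subst ennreal_mult''[symmetric]) (auto simp: mult_ac)
    finally show ?thesis .
  next
    case False
    then have t: "t > 1/2" by simp
    have "(\<integral>\<^sup>+q\<in>?B'. ?J q t \<partial>lborel) =
        (\<integral>\<^sup>+q. (\<integral>\<^sup>+p. ?L p q t * indicator ?B' q * indicator ?B p \<partial>lborel) \<partial>lborel)"
      by (intro nn_integral_cong) (auto simp: indicator_def)
    also have "\<dots> = (\<integral>\<^sup>+p. (\<integral>\<^sup>+q. ?L p q t * indicator ?B' q * indicator ?B p \<partial>lborel) \<partial>lborel)"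
      by (rule lborel_pair.Fubini'[symmetric]) (unfold linepath_def, measurable)
    also have "\<dots> \<le> (\<integral>\<^sup>+p. ennreal (?m' * (a * ?K)) * indicator ?B p \<partial>lborel)"
      using half2[OF t] by (intro nn_integral_mono) (auto simp: indicator_def)
    also have "\<dots> = ennreal (?m' * (a * ?K)) * ennreal ?m"
      using l by (subst nn_integral_cmult_indicator) (auto simp: emeasure_ball_V)
    also have "\<dots> = ennreal (?m' * ?m * (a * ?K))"
      using m by (subst ennreal_mult''[symmetric]) (auto simp: mult_ac)
    finally show ?thesis .
  qed
  have "(\<integral>\<^sup>+q\<in>?B'. (\<integral>\<^sup>+p\<in>?B. segment_integral (c + T *\<^sub>R (p - c)) q \<rho> \<partial>lborel) \<partial>lborel)
     \<le> (\<integral>\<^sup>+q. ennreal \<Delta> * (\<integral>\<^sup>+t. ?J q t * indicator {0..1} t * indicator ?B' q \<partial>lborel) \<partial>lborel)"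
  proof (rule nn_integral_mono)
    fix q
    show "(\<integral>\<^sup>+p\<in>?B. segment_integral (c + T *\<^sub>R (p - c)) q \<rho> \<partial>lborel) * indicator ?B' q \<le>
       ennreal \<Delta> * (\<integral>\<^sup>+t. ?J q t * indicator {0..1} t * indicator ?B' q \<partial>lborel)"
    proof (cases "q \<in> ?B'")
      case True
      then show ?thesis using nn_integral_segment_le[of \<rho> "\<lambda>p. c + T *\<^sub>R (p - c)" "\<lambda>_. q" ?B \<Delta>] d by simp
    qed simp
  qed
  also have "\<dots> = ennreal \<Delta> * (\<integral>\<^sup>+q. (\<integral>\<^sup>+t. ?J q t * indicator {0..1} t * indicator ?B' q \<partial>lborel) \<partial>lborel)"
    unfolding linepath_def by (rule nn_integral_cmult) measurable
  also have "(\<integral>\<^sup>+q. (\<integral>\<^sup>+t. ?J q t * indicator {0..1} t * indicator ?B' q \<partial>lborel) \<partial>lborel)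
     = (\<integral>\<^sup>+t. (\<integral>\<^sup>+q. ?J q t * indicator {0..1} t * indicator ?B' q \<partial>lborel) \<partial>lborel)"
    unfolding linepath_def by (rule lborel_pair.Fubini'[symmetric]) measurable
  also have "\<dots> \<le> (\<integral>\<^sup>+t. ennreal (?m' * ?m * (a * ?K)) * indicator {0..1::real} t \<partial>lborel)"
    using slice by (intro nn_integral_mono) (auto simp: indicator_def)
  also have "\<dots> = ennreal (?m' * ?m * (a * ?K))" by (simp add: nn_integral_cmult)
  also have "ennreal \<Delta> * ennreal (?m' * ?m * (a * ?K)) = ennreal (?m' * ?m * (a * (\<Delta> * ?K)))"
    using \<Delta> by (subst ennreal_mult'[symmetric]) (auto simp: mult_ac)
  finally show ?thesis by (simp add: mult_left_mono)
qed

end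

section \<open>A lower bound for the modulus\<close>

text \<open>First hitting times of the values of a coordinate are monotone, hence Borel.\<close>

lemma coordinate_selection:
  fixes \<sigma> :: "real \<Rightarrow> real^'n"
  assumes \<sigma>: "path \<sigma>" and xy: "x \<in> path_image \<sigma>" "y \<in> path_image \<sigma>"
  obtains e where "e \<in> borel_measurable borel"
    "\<And>s. s \<in> {x $ k..y $ k} \<Longrightarrow> e s \<in> path_image \<sigma> \<and> e s $ k = s"
proof (cases "x $ k \<le> y $ k")
  case False
  then show ?thesis using that[of "\<lambda>_. 0"] by simp
next
  case le: True
  obtain u v where uv: "u \<in> {0..1}" "v \<in> {0..1}" "\<sigma> u = x" "\<sigma> v = y"
    using xy by (auto simp: path_image_def)
  define g where "g = subpath u v \<sigma>"
  have g: "path g" "path_image g \<subseteq> path_image \<sigma>" "g 0 = x" "g 1 = y"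
  proof -
    show "path g" "path_image g \<subseteq> path_image \<sigma>"
      unfolding g_def using uv \<sigma> path_image_subpath_subset[of u v \<sigma>] by auto
    show "g 0 = x" "g 1 = y" using uv by (simp_all add: g_def subpath_def)
  qed
  define \<phi> where "\<phi> t = g t $ k" for t
  have c\<phi>: "continuous_on {0..1} \<phi>" unfolding \<phi>_def using g(1) by (auto simp: path_def intro!: continuous_intros)
  \<comment> \<open>Clamping extends the hitting time \<open>T\<close> to a monotone function on the
    whole line.\<close>
  define cl where "cl s = max (x $ k) (min (y $ k) s)" for s
  have cl: "x $ k \<le> cl s" "cl s \<le> y $ k" for s using le by (auto simp: cl_def)
  define S where "S s = {t \<in> {0..1}. cl s \<le> \<phi> t}" for s
  have S1: "1 \<in> S s" for s using cl g by (simp add: S_def \<phi>_def)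
  have clS: "closed (S s)" for s
    unfolding S_def using continuous_closed_preimage[OF c\<phi>, of "{cl s..}"] by (simp add: vimage_def Int_def)
  have bdd: "bdd_below (S s)" for s by (rule bdd_belowI[of _ 0]) (simp add: S_def)
  define T where "T s = Inf (S s)" for s
  have TS: "T s \<in> S s" for s unfolding T_def using closed_contains_Inf[OF _ bdd clS] S1 by blast
  have T01: "T s \<in> {0..1}" for s using TS[of s] by (simp add: S_def)
  have "mono T"
  proof (rule monoI)
    fix a b :: real assume "a \<le> b"
    then have "cl a \<le> cl b" by (auto simp: cl_def)
    then have "S b \<subseteq> S a" by (auto simp: S_def)
    then show "T a \<le> T b" unfolding T_def using S1[of b] by (intro cInf_superset_mono bdd) auto
  qed
  then have [measurable]: "T \<in> borel_measurable borel" by (rule borel_measurable_mono)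
  have \<phi>T: "\<phi> (T s) = cl s" for s
  proof (rule ccontr)
    assume "\<phi> (T s) \<noteq> cl s"
    then have gt: "cl s < \<phi> (T s)" using TS[of s] by (simp add: S_def)
    have "\<phi> 0 \<le> cl s" using cl g by (simp add: \<phi>_def)
    then obtain t where t: "0 \<le> t" "t \<le> T s" "\<phi> t = cl s"
      using IVT'[of \<phi> 0 "cl s" "T s"] gt T01[of s] continuous_on_subset[OF c\<phi>, of "{0..T s}"] by auto
    then have "t \<in> S s" using T01[of s] by (simp add: S_def)
    then have "T s \<le> t" unfolding T_def by (rule cInf_lower[OF _ bdd])
    then show False using t gt by simp
  qed
  have "continuous_on UNIV (\<lambda>t. g (max 0 (min 1 t)))"
    using g(1) unfolding path_def
    by (rule continuous_on_compose2) (auto intro!: continuous_intros)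
  then have m: "(\<lambda>t. g (max 0 (min 1 t))) \<in> borel_measurable borel"
    by (rule borel_measurable_continuous_onI)
  show ?thesis
  proof (rule that[of "\<lambda>s. g (max 0 (min 1 (T s)))"])
    show "(\<lambda>s. g (max 0 (min 1 (T s)))) \<in> borel_measurable borel"
      by (rule measurable_compose[OF _ m]) measurable
    fix s assume s: "s \<in> {x $ k..y $ k}"
    have "max 0 (min 1 (T s)) = T s" using T01[of s] by simp
    moreover have "cl s = s" using s by (simp add: cl_def)
    moreover have "g (T s) \<in> path_image \<sigma>" using T01[of s] g(2) by (auto simp: path_image_def)
    ultimately show "g (max 0 (min 1 (T s))) \<in> path_image \<sigma> \<and> g (max 0 (min 1 (T s))) $ k = s"
      using \<phi>T[of s] by (simp add: \<phi>_def)
  qed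
qed

text \<open>Axis \<open>k\<close> is the one along which the path extends furthest, and
  \<open>2 * l\<close> is that extent; the l1 norm bounds the diameter by n such extents. The ball
  is placed so that the k-th coordinates of its points are attained on the path. The final distance
  bound adds 2 n l across the path to twice the radius.\<close>

lemma spread_ball:
  fixes \<sigma> :: "real \<Rightarrow> real^'n"
  assumes \<sigma>: "path \<sigma>" "path_image \<sigma> \<subseteq> ball 0 R" and xy: "x \<in> path_image \<sigma>" "y \<in> path_image \<sigma>" "x \<noteq> y"
  obtains c l k e where "e \<in> borel_measurable borel" "l > 0" "dist x y \<le> 2 * real CARD('n) * l" "l \<le> R" "norm c < 2 * R"
    "\<And>p. p \<in> ball c l \<Longrightarrow> e (p $ k) \<in> path_image \<sigma> \<and> e (p $ k) $ k = p $ k \<and>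
        dist (e (p $ k)) p \<le> (2 + 2 * real CARD('n)) * l"
proof -
  let ?E = "path_image \<sigma>" and ?n = "real CARD('n)"
  have "\<exists>u v. u \<in> ?E \<and> v \<in> ?E \<and> (\<forall>p\<in>?E. u $ i \<le> p $ i \<and> p $ i \<le> v $ i)" for i
  proof -
    have c: "compact ?E" "?E \<noteq> {}" using \<sigma> by (auto simp: compact_path_image)
    have co: "continuous_on ?E (\<lambda>p. p $ i)" by (intro continuous_intros)
    show ?thesis using continuous_attains_sup[OF c co] continuous_attains_inf[OF c co] by blast
  qed
  then obtain u v where uv: "\<And>i. u i \<in> ?E" "\<And>i. v i \<in> ?E" "\<And>i p. p \<in> ?E \<Longrightarrow> u i $ i \<le> p $ i \<and> p $ i \<le> v i $ i"
    by metis
  define ext where "ext i = v i $ i - u i $ i" for i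
  obtain k where k: "\<And>i. ext i \<le> ext k"
  proof -
    have "Max (range ext) \<in> range ext" by (intro Max_in) auto
    then obtain k where "Max (range ext) = ext k" by blast
    then show thesis using that[of k] by (metis Max_ge finite finite_imageI rangeI)
  qed
  define l where "l = ext k / 2"
  have diam: "dist p q \<le> 2 * ?n * l" if "p \<in> ?E" "q \<in> ?E" for p q
  proof -
    have "dist p q \<le> (\<Sum>i\<in>UNIV. \<bar>(p - q) $ i\<bar>)" unfolding dist_norm by (rule norm_le_l1_cart)
    also have "\<dots> \<le> (\<Sum>i\<in>(UNIV::'n set). 2 * l)"
    proof (rule sum_mono)
      fix i
      have "\<bar>(p - q) $ i\<bar> \<le> ext i" using uv(3)[OF that(1), of i] uv(3)[OF that(2), of i] by (auto simp: ext_def)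
      then show "\<bar>(p - q) $ i\<bar> \<le> 2 * l" using k[of i] by (simp add: l_def)
    qed
    finally show ?thesis by simp
  qed
  have l: "l > 0"
  proof (rule ccontr)
    assume "\<not> l > 0"
    then have "2 * ?n * l \<le> 0" by (simp add: mult_nonneg_nonpos)
    moreover have "0 < dist x y" using xy(3) by simp
    ultimately show False using diam[OF xy(1,2)] by linarith
  qed
  obtain e where e: "e \<in> borel_measurable borel" "\<And>s. s \<in> {u k $ k..v k $ k} \<Longrightarrow> e s \<in> ?E \<and> e s $ k = s"
    using coordinate_selection[OF \<sigma>(1) uv(1)[of k] uv(2)[of k], of k] by blast
  \<comment> \<open>\<open>v k\<close> has the largest k-th coordinate on the path, so
    \<open>c\<close> lies in the middle of the range of that coordinate and at distance
    \<open>l\<close> from the path point \<open>v k\<close>.\<close>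
  define c where "c = v k - l *\<^sub>R axis k 1"
  have ck: "c $ k = v k $ k - l" by (simp add: c_def)
  have dc: "dist (v k) c = l" using l by (simp add: c_def dist_norm)
  have "norm (v k) < R" "norm (u k) < R" using uv(1,2)[of k] \<sigma>(2) by (auto simp: subset_iff)
  then have b: "\<bar>v k $ k\<bar> < R" "\<bar>u k $ k\<bar> < R" "norm (v k) < R"
    using component_le_norm_cart[of "v k" k] component_le_norm_cart[of "u k" k] by linarith+
  have lR: "l \<le> R" using b by (simp add: l_def ext_def)
  show thesis
  proof (rule that[OF e(1) l diam[OF xy(1,2)] lR])
    have "norm c \<le> norm (v k) + l" using norm_triangle_ineq4[of "v k" "l *\<^sub>R axis k 1"] l by (simp add: c_def)
    then show "norm c < 2 * R" using b lR by simp
    fix p assume p: "p \<in> ball c l"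
    have "\<bar>(p - c) $ k\<bar> \<le> norm (p - c)" by (rule component_le_norm_cart)
    then have "\<bar>p $ k - c $ k\<bar> < l" using p by (simp add: dist_norm norm_minus_commute)
    moreover have "2 * l = v k $ k - u k $ k" by (simp add: l_def ext_def)
    ultimately have s: "p $ k \<in> {u k $ k..v k $ k}" unfolding atLeastAtMost_iff ck by linarith
    have "dist (e (p $ k)) p \<le> dist (e (p $ k)) (v k) + dist (v k) c + dist c p"
      using dist_triangle[of "e (p $ k)" p "v k"] dist_triangle[of "v k" p c] by linarith
    also have "\<dots> \<le> 2 * ?n * l + l + l" using diam[of "e (p $ k)" "v k"] e(2)[OF s] uv(2) dc p by simp
    finally show "e (p $ k) \<in> ?E \<and> e (p $ k) $ k = p $ k \<and> dist (e (p $ k)) p \<le> (2 + 2 * ?n) * l"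
      using e(2)[OF s] by (simp add: algebra_simps)
  qed
qed

text \<open>The cost of the three segments other than the dilation: two cones with C = 2 + 2 n, and
  a transfer over a distance of at most 6 R between balls of radius R and l', where 1/l' is at most
  2 n / \<delta>.\<close>

definition join_const :: "nat \<Rightarrow> real \<Rightarrow> real \<Rightarrow> real" where
  "join_const n \<delta> R = (let \<kappa> = unit_ball_vol (real n) powr (- 1 / real n) in
     2 * ((2 + 2 * real n) * real n * \<kappa>) + 6 * R * (2 * \<kappa> / R + 2 * \<kappa> * (2 * real n / \<delta>)))"

lemma polygon_in_path_family:
  assumes "a \<in> E" "e \<in> F"
  shows "linepath a b +++ linepath b c +++ linepath c d +++ linepath d e \<in> path_family E F UNIV"
  using assms by (simp add: path_family_def)

text \<open>Every polygon has integral at least 1. Integrating over all pairs (p, q) and dividing by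
  the volumes of both balls leaves the sum of the four mean bounds, each a multiple of
  \<open>a\<close>.\<close>

lemma admissible_density_lower_bound:
  fixes \<rho> :: "real^'n \<Rightarrow> ennreal"
  assumes dim: "CARD('n) \<ge> 2" and \<rho>: "admissible \<rho> (path_family (path_image \<sigma>) (path_image \<omega>) UNIV)"
    and a: "a > 0" "(\<integral>\<^sup>+x. \<rho> x ^ CARD('n) \<partial>lborel) \<le> ennreal (a ^ CARD('n))"
    and \<sigma>: "path \<sigma>" "path_image \<sigma> \<subseteq> ball 0 R" "x \<in> path_image \<sigma>" "y \<in> path_image \<sigma>" "x \<noteq> y"
    and \<omega>: "path \<omega>" "path_image \<omega> \<subseteq> ball 0 R" "x' \<in> path_image \<omega>" "y' \<in> path_image \<omega>" "dist x' y' \<ge> \<delta>"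
    and \<delta>: "\<delta> > 0"
  shows "1 \<le> a * (join_const CARD('n) \<delta> R + (real CARD('n) * unit_ball_vol (real CARD('n))) powr (- 1 / real CARD('n)) *
     (2 / real CARD('n) + ln (2 * real CARD('n) * R / dist x y)) powr ((real CARD('n) - 1) / real CARD('n)))"
proof -
  have [measurable]: "\<rho> \<in> borel_measurable borel" using \<rho> by (simp add: admissible_def)
  interpret Ln_density \<rho> a "unit_ball_vol (real CARD('n))" "unit_ball_vol (real CARD('n)) powr (- 1 / real CARD('n))"
    by unfold_locales (use dim a in auto)
  let ?n = "real CARD('n)"
  define V \<kappa> where "V = unit_ball_vol ?n" and "\<kappa> = unit_ball_vol ?n powr (- 1 / ?n)"
  have V: "V > 0" and \<kappa>: "\<kappa> > 0" using V_pos \<kappa>_pos unfolding V_def \<kappa>_def by blast+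
  obtain c l k e where s: "e \<in> borel_measurable borel" "l > 0" "dist x y \<le> 2 * ?n * l" "l \<le> R" "norm c < 2 * R"
    "\<And>p. p \<in> ball c l \<Longrightarrow> e (p $ k) \<in> path_image \<sigma> \<and> e (p $ k) $ k = p $ k \<and> dist (e (p $ k)) p \<le> (2 + 2 * ?n) * l"
    using spread_ball[OF \<sigma>] by metis
  have "x' \<noteq> y'" using \<omega>(5) \<delta> by auto
  then obtain c' l' k' e' where s': "e' \<in> borel_measurable borel" "l' > 0" "dist x' y' \<le> 2 * ?n * l'" "l' \<le> R" "norm c' < 2 * R"
    "\<And>p. p \<in> ball c' l' \<Longrightarrow> e' (p $ k') \<in> path_image \<omega> \<and> e' (p $ k') $ k' = p $ k' \<and> dist (e' (p $ k')) p \<le> (2 + 2 * ?n) * l'"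
    using spread_ball[OF \<omega>(1-4)] by metis
  \<comment> \<open>The ball is dilated to radius \<open>R\<close> whatever the size of the curve,
    so that size enters the final bound only through ln T.\<close>
  define T where "T = R / l"
  have R: "R > 0" using s by simp
  have T: "T \<ge> 1" using s by (simp add: T_def)
  let ?B = "ball c l" and ?B' = "ball c' l'"
  have [measurable]: "?B \<in> sets borel" "?B' \<in> sets borel" "e \<in> borel_measurable borel" "e' \<in> borel_measurable borel"
    using s s' by auto
  have [measurable]: "(\<lambda>x::real^'n. x $ k) \<in> borel_measurable borel" "(\<lambda>x::real^'n. x $ k') \<in> borel_measurable borel"
    by (intro borel_measurable_continuous_onI continuous_intros)+
  define m m' where "m = V * l ^ CARD('n)" and "m' = V * l' ^ CARD('n)"
  have m: "m > 0" "m' > 0" using V s(2) s'(2) by (auto simp: m_def m'_def)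
  have em: "emeasure lborel ?B = ennreal m" "emeasure lborel ?B' = ennreal m'"
    using emeasure_ball_V s(2) s'(2) by (auto simp: m_def m'_def V_def)
  define S1 where "S1 p = segment_integral (e (p $ k)) p \<rho>" for p
  define S2 where "S2 p = segment_integral p (c + T *\<^sub>R (p - c)) \<rho>" for p
  define S3 where "S3 p q = segment_integral (c + T *\<^sub>R (p - c)) q \<rho>" for p q
  define S4 where "S4 q = segment_integral (e' (q $ k')) q \<rho>" for q
  have [measurable]: "S1 \<in> borel_measurable borel" "S2 \<in> borel_measurable borel" "S4 \<in> borel_measurable borel"
    "(\<lambda>(q, p). S3 p q) \<in> borel_measurable (borel \<Otimes>\<^sub>M borel)"
    unfolding S1_def S2_def S3_def S4_def by measurable
  let ?S = "\<lambda>p q. S1 p + S2 p + S3 p q + S4 q"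
  let ?I1 = "\<integral>\<^sup>+p\<in>?B. S1 p \<partial>lborel" and ?I2 = "\<integral>\<^sup>+p\<in>?B. S2 p \<partial>lborel"
  let ?I3 = "\<lambda>q. \<integral>\<^sup>+p\<in>?B. S3 p q \<partial>lborel" and ?I4 = "\<integral>\<^sup>+q\<in>?B'. S4 q \<partial>lborel"
  have one: "1 \<le> ?S p q" if "p \<in> ?B" "q \<in> ?B'" for p q
  proof -
    let ?g = "linepath (e (p $ k)) p +++ linepath p (c + T *\<^sub>R (p - c)) +++ linepath (c + T *\<^sub>R (p - c)) q +++ linepath q (e' (q $ k'))"
    have "1 \<le> path_integral ?g \<rho>"
      using \<rho> polygon_in_path_family[of "e (p $ k)" "path_image \<sigma>" "e' (q $ k')" "path_image \<omega>"]
        s(6)[OF that(1)] s'(6)[OF that(2)] path_integral_four_segments_le(1)[of \<rho>] unfolding admissible_def by auto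
    also have "\<dots> \<le> S1 p + S2 p + S3 p q + segment_integral q (e' (q $ k')) \<rho>"
      unfolding S1_def S2_def S3_def by (rule path_integral_four_segments_le(2)) measurable
    also have "segment_integral q (e' (q $ k')) \<rho> = S4 q"
      unfolding S4_def by (rule segment_integral_commute) measurable
    finally show ?thesis .
  qed
  let ?C = "2 + 2 * ?n"
  let ?c1 = "a * (?C * ?n * \<kappa>)"
  have I1: "?I1 \<le> ennreal (m * ?c1)"
    unfolding S1_def m_def V_def \<kappa>_def by (rule cone_average) (use s in auto)
  have I4: "?I4 \<le> ennreal (m' * ?c1)"
    unfolding S4_def m'_def V_def \<kappa>_def by (rule cone_average) (use s' in auto)
  define W where "W = (?n * V) powr (- 1 / ?n) * (2 / ?n + ln T) powr ((?n - 1) / ?n)"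
  have I2: "?I2 \<le> ennreal (m * (a * W))"
    unfolding S2_def m_def V_def W_def by (rule dilation_average[OF s(2) T])
  define K3 where "K3 = 6 * R * (2 * \<kappa> / (T * l) + 2 * \<kappa> / l')"
  have I3: "(\<integral>\<^sup>+q\<in>?B'. ?I3 q \<partial>lborel) \<le> ennreal (m' * m * (a * K3))"
    unfolding S3_def m_def m'_def V_def K3_def \<kappa>_def
  proof (rule transfer_average)
    \<comment> \<open>Both points have norm at most 3 R: less than 2 R for the centre, plus at most
      R for the radius. Hence 6 R.\<close>
    fix p q assume p: "p \<in> ?B" and q: "q \<in> ?B'"
    have "norm (T *\<^sub>R (p - c)) \<le> R"
    proof -
      have "norm (T *\<^sub>R (p - c)) \<le> T * l" using p T by (simp add: dist_norm norm_minus_commute mult_left_mono)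
      also have "T * l = R" using s(2) by (simp add: T_def)
      finally show ?thesis .
    qed
    moreover have "norm q \<le> norm c' + l'" using q norm_triangle_ineq2[of q c'] by (simp add: dist_norm norm_minus_commute)
    ultimately show "dist (c + T *\<^sub>R (p - c)) q \<le> 6 * R"
      using norm_triangle_ineq4[of "c + T *\<^sub>R (p - c)" q] norm_triangle_ineq[of c "T *\<^sub>R (p - c)"] s(4,5) s'(4,5)
      unfolding dist_norm by linarith
  qed (use s(2) s'(2) T R in auto)
  have "ennreal (m' * m) = (\<integral>\<^sup>+q\<in>?B'. (\<integral>\<^sup>+p\<in>?B. 1 \<partial>lborel) \<partial>lborel)"
    using m em by (simp add: nn_integral_cmult_indicator ennreal_mult mult.commute)
  also have "\<dots> \<le> (\<integral>\<^sup>+q\<in>?B'. (\<integral>\<^sup>+p\<in>?B. ?S p q \<partial>lborel) \<partial>lborel)"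
  proof (rule nn_integral_mono)
    fix q
    show "(\<integral>\<^sup>+p\<in>?B. 1 \<partial>lborel) * indicator ?B' q \<le> (\<integral>\<^sup>+p\<in>?B. ?S p q \<partial>lborel) * indicator ?B' q"
    proof (cases "q \<in> ?B'")
      case True
      have "(\<integral>\<^sup>+p\<in>?B. 1 \<partial>lborel) \<le> (\<integral>\<^sup>+p\<in>?B. ?S p q \<partial>lborel)"
      proof (rule nn_integral_mono)
        fix p
        show "1 * indicator ?B p \<le> ?S p q * indicator ?B p"
          using one[OF _ True] by (cases "p \<in> ?B") (simp_all del: mem_ball)
      qed
      then show ?thesis using True by simp
    qed simp
  qed
  also have "\<dots> = (\<integral>\<^sup>+q. (?I1 + ?I2) * indicator ?B' q +
      (?I3 q * indicator ?B' q + ennreal m * (S4 q * indicator ?B' q)) \<partial>lborel)"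
  proof (intro nn_integral_cong)
    fix q
    have "(\<integral>\<^sup>+p\<in>?B. ?S p q \<partial>lborel) =
        (\<integral>\<^sup>+p. (S1 p * indicator ?B p + S2 p * indicator ?B p) + (S3 p q * indicator ?B p + S4 q * indicator ?B p) \<partial>lborel)"
      by (simp add: distrib_right add.assoc)
    also have "\<dots> = (?I1 + ?I2) + (?I3 q + S4 q * ennreal m)"
      by (subst nn_integral_add, measurable, subst nn_integral_add, measurable, subst nn_integral_add, measurable)
         (simp add: nn_integral_cmult_indicator em)
    finally have eq: "(\<integral>\<^sup>+p\<in>?B. ?S p q \<partial>lborel) =
      (?I1 + ?I2) + (?I3 q + S4 q * ennreal m)" .
    show "(\<integral>\<^sup>+p\<in>?B. ?S p q \<partial>lborel) * indicator ?B' q =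
      (?I1 + ?I2) * indicator ?B' q +
      (?I3 q * indicator ?B' q + ennreal m * (S4 q * indicator ?B' q))"
      unfolding eq by (cases "q \<in> ?B'") (simp_all add: mult.commute del: mem_ball)
  qed
  also have "\<dots> = (?I1 + ?I2) * ennreal m' +
      ((\<integral>\<^sup>+q\<in>?B'. ?I3 q \<partial>lborel) + ennreal m * ?I4)"
    by (subst nn_integral_add, measurable, subst nn_integral_add, measurable, subst nn_integral_cmult, measurable)
       (simp add: nn_integral_cmult_indicator em)
  also have "\<dots> \<le> (ennreal (m * ?c1) + ennreal (m * (a * W))) * ennreal m' +
      (ennreal (m' * m * (a * K3)) + ennreal m * ennreal (m' * ?c1))"
    by (intro add_mono mult_left_mono mult_right_mono I1 I2 I3 I4) auto
  also have "\<dots> = ennreal ((m * ?c1 + m * (a * W)) * m' + (m' * m * (a * K3) + m * (m' * ?c1)))"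
  proof -
    have "W \<ge> 0" "K3 \<ge> 0" using R \<kappa> T s(2) s'(2) by (auto simp: W_def K3_def)
    then show ?thesis using m a \<kappa> by (simp flip: ennreal_mult ennreal_plus)
  qed
  also have "(m * ?c1 + m * (a * W)) * m' + (m' * m * (a * K3) + m * (m' * ?c1))
     = (m' * m) * (a * (2 * (?C * ?n * \<kappa>) + K3 + W))" by (simp add: algebra_simps)
  finally have "ennreal (m' * m) \<le> ennreal ((m' * m) * (a * (2 * (?C * ?n * \<kappa>) + K3 + W)))" .
  moreover have "0 \<le> (m' * m) * (a * (2 * (?C * ?n * \<kappa>) + K3 + W))"
    using m a \<kappa> R T s(2) s'(2) by (auto simp: W_def K3_def intro!: mult_nonneg_nonneg add_nonneg_nonneg)
  ultimately have "(m' * m) * 1 \<le> (m' * m) * (a * (2 * (?C * ?n * \<kappa>) + K3 + W))"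
    by (simp add: ennreal_le_iff)
  then have "1 \<le> a * (2 * (?C * ?n * \<kappa>) + K3 + W)" using m by (subst (asm) mult_le_cancel_left_pos) auto
  \<comment> \<open>The auxiliary radii are eliminated through dist x y \<le> 2 n l and \<delta>
    \<le> 2 n l'.\<close>
  also have "\<dots> \<le> a * (join_const CARD('n) \<delta> R + (?n * V) powr (- 1 / ?n) * (2 / ?n + ln (2 * ?n * R / dist x y)) powr ((?n - 1) / ?n))"
  proof (intro mult_left_mono add_mono)
    have "\<delta> \<le> 2 * ?n * l'" using \<omega>(5) s'(3) by simp
    then have "1 / l' \<le> 2 * ?n / \<delta>" using \<delta> s'(2) by (simp add: field_simps)
    then have "2 * \<kappa> * (1 / l') \<le> 2 * \<kappa> * (2 * ?n / \<delta>)" using \<kappa> by (intro mult_left_mono) auto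
    then have "K3 \<le> 6 * R * (2 * \<kappa> / R + 2 * \<kappa> * (2 * ?n / \<delta>))"
      unfolding K3_def using R s(2) by (intro mult_left_mono add_mono) (auto simp: T_def)
    then show "2 * (?C * ?n * \<kappa>) + K3 \<le> join_const CARD('n) \<delta> R"
      by (simp add: join_const_def Let_def \<kappa>_def)
    have d: "dist x y > 0" using \<sigma>(5) by simp
    have "T \<le> 2 * ?n * R / dist x y"
      unfolding T_def using s(2,3) d R by (simp add: field_simps)
    then have "ln T \<le> ln (2 * ?n * R / dist x y)" using T by (intro ln_mono) auto
    moreover have "0 \<le> 2 / ?n + ln T" using T by simp
    ultimately show "W \<le> (?n * V) powr (- 1 / ?n) * (2 / ?n + ln (2 * ?n * R / dist x y)) powr ((?n - 1) / ?n)"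
      unfolding W_def using dim by (intro mult_left_mono powr_mono2) auto
  qed (use a in auto)
  finally show ?thesis unfolding V_def .
qed

section \<open>Moduli under ring mappings\<close>

lemma sigma_finite_lebesgue: "sigma_finite_measure (lebesgue :: 'a::euclidean_space measure)"
proof
  obtain A :: "'a set set" where "countable A" "A \<subseteq> sets lborel" "\<Union>A = space lborel" "\<forall>a\<in>A. emeasure lborel a \<noteq> \<infinity>"
    using sigma_finite_lborel unfolding sigma_finite_measure_def by metis
  then show "\<exists>A :: 'a set set. countable A \<and> A \<subseteq> sets lebesgue \<and> \<Union> A = space lebesgue \<and> (\<forall>a\<in>A. emeasure lebesgue a \<noteq> \<infinity>)"
    by (intro exI[of _ A]) (auto simp: subset_iff)
qed

lemma conf_modulus_mono: "\<Gamma> \<subseteq> \<Gamma>' \<Longrightarrow> conf_modulus \<Gamma> \<le> conf_modulus \<Gamma>'"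
  unfolding conf_modulus_def by (rule INF_superset_mono) (auto simp: admissible_def)

text \<open>With the logarithmic \<eta> the right-hand side becomes L^(-n) times the integral of Q /
  |x - x0|^n over the ring, which the layer cake controls through the growth of the mass of
  Q.\<close>

lemma ring_modulus_le:
  fixes D :: "(real^'n) set"
  assumes Q[measurable]: "Q \<in> borel_measurable lebesgue" and Q0: "\<And>x. x \<notin> D \<Longrightarrow> Q x = 0"
    and f: "ring_Q_mapping r0 Q D x0 f" and r: "0 < r1" "r1 < r2" "r2 < r0" and \<kappa>: "\<kappa> \<ge> 0"
    and vol: "\<And>t. 0 < t \<Longrightarrow> t \<le> r2 \<Longrightarrow> (\<integral>\<^sup>+x\<in>ball x0 t \<inter> D. Q x \<partial>lebesgue) \<le> ennreal (\<kappa> * t ^ CARD('n))"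
  shows "conf_modulus ((\<lambda>\<gamma>. f \<circ> \<gamma>) ` path_family (sphere x0 r1) (sphere x0 r2) D)
     \<le> ennreal (\<kappa> * (1 + real CARD('n) * ln (r2 / r1)) / ln (r2 / r1) ^ CARD('n))"
proof -
  define L where "L = ln (r2 / r1)"
  have L: "L > 0" using r by (simp add: L_def)
  define \<eta> :: "real \<Rightarrow> ennreal" where "\<eta> t = ennreal (1 / (t * L))" for t
  have \<eta>m [measurable]: "\<eta> \<in> borel_measurable borel" unfolding \<eta>_def by measurable
  have "(\<integral>\<^sup>+t\<in>{r1<..<r2}. \<eta> t \<partial>lebesgue) = (\<integral>\<^sup>+t\<in>{r1<..<r2}. \<eta> t \<partial>lborel)"
    by (rule nn_integral_completion) measurable
  also have "\<dots> = (\<integral>\<^sup>+t\<in>{r1..r2}. \<eta> t \<partial>lborel)"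
    by (rule nn_integral_cong_AE, rule AE_mp[OF AE_lborel_singleton[of r1]], rule AE_mp[OF AE_lborel_singleton[of r2]])
       (auto simp: indicator_def)
  also have "\<dots> = ennreal (ln r2 / L - ln r1 / L)"
    unfolding \<eta>_def
  proof (rule nn_integral_FTC_Icc)
    show "((\<lambda>t. ln t / L) has_field_derivative 1 / (t * L)) (at t)" if "t \<in> {r1..r2}" for t
      using that r L by (auto intro!: derivative_eq_intros)
  qed (use r L in auto)
  also have "ln r2 / L - ln r1 / L = 1"
    using r L by (simp add: L_def ln_div flip: diff_divide_distrib)
  finally have \<eta>1: "(\<integral>\<^sup>+t\<in>{r1<..<r2}. \<eta> t \<partial>lebesgue) = 1" by simp
  define u where "u x = norm (x - x0)" for x
  have "u \<in> borel_measurable lborel" unfolding u_def by measurable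
  then have [measurable]: "u \<in> borel_measurable lebesgue" by (rule measurable_completion)
  let ?i = "indicator {x. r1 \<le> u x \<and> u x < r2} :: real^'n \<Rightarrow> ennreal"
  have "\<eta> \<in> borel_measurable (lebesgue_on {r1<..<r2})"
    by (intro measurable_restrict_space1 measurable_completion) simp
  then have "conf_modulus ((\<lambda>\<gamma>. f \<circ> \<gamma>) ` path_family (sphere x0 r1) (sphere x0 r2) D)
      \<le> (\<integral>\<^sup>+x\<in>annulus x0 r1 r2. Q x * \<eta> (u x) ^ CARD('n) \<partial>lebesgue)"
    unfolding u_def using r \<eta>1 by (intro f[unfolded ring_Q_mapping_def, rule_format]) auto
  also have "\<dots> \<le> (\<integral>\<^sup>+x. ennreal (1 / L ^ CARD('n)) * (Q x * ennreal (1 / u x ^ CARD('n)) *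
      ?i x) \<partial>lebesgue)"
  proof (rule nn_integral_mono)
    fix x
    have "\<eta> (u x) ^ CARD('n) = ennreal ((1 / (u x * L)) ^ CARD('n))"
      using L unfolding \<eta>_def by (intro ennreal_power) (simp add: u_def)
    also have "(1 / (u x * L)) ^ CARD('n) = 1 / L ^ CARD('n) * (1 / u x ^ CARD('n))"
      by (simp add: power_divide power_mult_distrib)
    also have "ennreal \<dots> = ennreal (1 / L ^ CARD('n)) * ennreal (1 / u x ^ CARD('n))"
      using L by (intro ennreal_mult) (auto simp: u_def)
    finally have "\<eta> (u x) ^ CARD('n) = ennreal (1 / L ^ CARD('n)) * ennreal (1 / u x ^ CARD('n))" .
    then show "Q x * \<eta> (u x) ^ CARD('n) * indicator (annulus x0 r1 r2) x \<le>
        ennreal (1 / L ^ CARD('n)) * (Q x * ennreal (1 / u x ^ CARD('n)) *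
        ?i x)"
      by (auto simp: annulus_def u_def indicator_def mult_ac)
  qed
  also have "\<dots> = ennreal (1 / L ^ CARD('n)) * (\<integral>\<^sup>+x. Q x * ennreal (1 / u x ^ CARD('n)) *
      ?i x \<partial>lebesgue)"
    by (rule nn_integral_cmult) measurable
  also have "\<dots> \<le> ennreal (1 / L ^ CARD('n)) * ennreal (\<kappa> * (1 + real CARD('n) * ln (r2 / r1)))"
  proof (intro mult_left_mono nn_integral_inverse_power_layer sigma_finite_lebesgue)
    fix t assume t: "t \<in> {r1..r2}"
    have "(\<integral>\<^sup>+x. Q x * indicator {x. u x < t} x \<partial>lebesgue) = (\<integral>\<^sup>+x\<in>ball x0 t \<inter> D. Q x \<partial>lebesgue)"
      using Q0 by (intro nn_integral_cong) (auto simp: u_def indicator_def dist_norm norm_minus_commute)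
    then show "(\<integral>\<^sup>+x. Q x * indicator {x. u x < t} x \<partial>lebesgue) \<le> ennreal (\<kappa> * t ^ CARD('n))"
      using vol[of t] t r by simp
  qed (use r \<kappa> in auto)
  also have "\<dots> = ennreal (\<kappa> * (1 + real CARD('n) * L) / L ^ CARD('n))"
    using L \<kappa> by (simp add: L_def flip: ennreal_mult)
  finally show ?thesis unfolding L_def .
qed

text \<open>A path from \<open>f ` S\<close> to \<open>K\<close> lifts to a path which has to cross the ring; the image of the crossing
  is a subpath of the original path.\<close>

lemma modulus_lift_le:
  assumes P: "proper_open_finite_map D f" and \<sigma>: "S \<subseteq> D" "\<And>x. x \<in> S \<Longrightarrow> norm (x - x0) < r1"
    and r: "r1 < r2" and K: "\<And>x. x \<in> D \<Longrightarrow> f x \<in> K \<Longrightarrow> r2 \<le> norm (x - x0)"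
  shows "conf_modulus (path_family (f ` S) K (f ` D))
     \<le> conf_modulus ((\<lambda>\<gamma>. f \<circ> \<gamma>) ` path_family (sphere x0 r1) (sphere x0 r2) D)"
proof -
  let ?\<Gamma> = "path_family (sphere x0 r1) (sphere x0 r2) D"
  interpret proper_open_finite_map D f by (rule P)
  have "admissible \<rho> (path_family (f ` S) K (f ` D))"
    if \<rho>: "admissible \<rho> ((\<lambda>\<gamma>. f \<circ> \<gamma>) ` ?\<Gamma>)" for \<rho>
    unfolding admissible_def
  proof (intro conjI ballI impI)
    show \<rho>m: "\<rho> \<in> borel_measurable borel" using \<rho> by (simp add: admissible_def)
    fix g assume g: "g \<in> path_family (f ` S) K (f ` D)" and rg: "rectifiable g"
    then have pg: "path g" "path_image g \<subseteq> f ` D" "pathfinish g \<in> K" by (auto simp: path_family_def)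
    obtain x where x: "x \<in> S" "f x = pathstart g" using g by (auto simp: path_family_def)
    obtain h where h: "path h" "path_image h \<subseteq> D" "pathstart h = x" "\<And>t. t \<in> {0..1} \<Longrightarrow> f (h t) = g t"
      using path_lifting[OF pg(1,2) _ x(2)] x(1) \<sigma>(1) by blast
    define \<phi> where "\<phi> t = norm (h t - x0)" for t
    have c\<phi>: "continuous_on {0..1} \<phi>" unfolding \<phi>_def using h(1) by (auto simp: path_def intro!: continuous_intros)
    have "\<phi> 0 \<le> r1" using \<sigma>(2)[OF x(1)] h(3) by (simp add: \<phi>_def pathstart_def)
    moreover have \<phi>1: "r2 \<le> \<phi> 1"
    proof -
      have "h 1 \<in> D" using h(2) pathfinish_in_path_image[of h] by (auto simp: pathfinish_def)
      then show ?thesis using K[of "h 1"] h(4)[of 1] pg(3) by (simp add: \<phi>_def pathfinish_def)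
    qed
    ultimately obtain t1 where t1: "0 \<le> t1" "t1 \<le> 1" "\<phi> t1 = r1"
      using IVT'[of \<phi> 0 r1 1] c\<phi> r by auto
    \<comment> \<open>The piece between \<open>t1\<close> and \<open>t2\<close> may leave the
      annulus; the ring condition concerns all paths in \<open>D\<close> from one sphere to the
      other.\<close>
    obtain t2 where t2: "t1 \<le> t2" "t2 \<le> 1" "\<phi> t2 = r2"
      using IVT'[of \<phi> t1 r2 1] continuous_on_subset[OF c\<phi>, of "{t1..1}"] t1 \<phi>1 r by auto
    define h' where "h' = subpath t1 t2 h"
    \<comment> \<open>The lift is controlled on \<open>{0..1}\<close> only, so equality holds there,
      and the congruence lemmas transfer length and integral.\<close>
    have eq: "(f \<circ> h') t = subpath t1 t2 g t" if "t \<in> {0..1}" for t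
    proof -
      have "(t2 - t1) * t \<le> t2 - t1" using that t2 by (intro mult_left_le) auto
      then have "(t2 - t1) * t + t1 \<in> {0..1}" using t1 t2 that by auto
      then show ?thesis using h(4) by (simp add: h'_def subpath_def)
    qed
    have "h' \<in> ?\<Gamma>"
      unfolding path_family_def h'_def
      using h(1,2) t1 t2 path_image_subpath_subset[of t1 t2 h]
      by (auto simp: \<phi>_def dist_norm norm_minus_commute)
    then have mem: "f \<circ> h' \<in> (\<lambda>\<gamma>. f \<circ> \<gamma>) ` ?\<Gamma>" by blast
    have "rectifiable (f \<circ> h')"
      using rectifiable_cong[of "f \<circ> h'" "subpath t1 t2 g"] eq rectifiable_subpath[OF rg] t1 t2 by auto
    then have "1 \<le> path_integral (f \<circ> h') \<rho>" using \<rho> mem unfolding admissible_def by blast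
    also have "\<dots> = path_integral (subpath t1 t2 g) \<rho>" by (rule path_integral_cong) (rule eq)
    also have "\<dots> \<le> path_integral g \<rho>" by (rule path_integral_subpath_le[OF pg(1) rg \<rho>m]) (use t1 t2 in auto)
    finally show "1 \<le> path_integral g \<rho>" .
  qed
  then show ?thesis unfolding conf_modulus_def by (intro INF_superset_mono) auto
qed

text \<open>The factor X for which every admissible density of n-norm at most \<open>a\<close>
  satisfies 1 \<le> a X; hence X^(-n) bounds the modulus from below.\<close>

definition modulus_scale :: "nat \<Rightarrow> real \<Rightarrow> real \<Rightarrow> real \<Rightarrow> real" where
  "modulus_scale n \<delta> R d = join_const n \<delta> R + (real n * unit_ball_vol (real n)) powr (- 1 / real n) *
     (2 / real n + ln (2 * real n * R / d)) powr ((real n - 1) / real n)"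

lemma join_const_pos: "\<delta> > 0 \<Longrightarrow> R > 0 \<Longrightarrow> n > 0 \<Longrightarrow> 0 < join_const n \<delta> R"
proof -
  assume *: "\<delta> > 0" "R > 0" "n > 0"
  have "unit_ball_vol (real n) powr (- 1 / real n) > 0"
    using unit_ball_vol_pos[of "real n"] by (simp add: less_imp_neq[THEN not_sym])
  then show ?thesis using * unfolding join_const_def Let_def
    by (intro add_pos_nonneg mult_pos_pos mult_nonneg_nonneg add_nonneg_nonneg) auto
qed

lemma modulus_scale_pos:
  assumes "\<delta> > 0" "R > 0" "n > 0"
  shows "modulus_scale n \<delta> R d > 0"
  unfolding modulus_scale_def using join_const_pos[OF assms] by (intro add_pos_nonneg) auto

lemma conf_modulus_ge:
  fixes \<sigma> \<omega> :: "real \<Rightarrow> real^'n"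
  assumes dim: "CARD('n) \<ge> 2"
    and \<sigma>: "path \<sigma>" "path_image \<sigma> \<subseteq> ball 0 R" "x \<in> path_image \<sigma>" "y \<in> path_image \<sigma>" "x \<noteq> y"
    and \<omega>: "path \<omega>" "path_image \<omega> \<subseteq> ball 0 R" "x' \<in> path_image \<omega>" "y' \<in> path_image \<omega>" "dist x' y' \<ge> \<delta>"
    and \<delta>: "\<delta> > 0"
  shows "ennreal (1 / modulus_scale CARD('n) \<delta> R (dist x y) ^ CARD('n))
     \<le> conf_modulus (path_family (path_image \<sigma>) (path_image \<omega>) UNIV)"
  unfolding conf_modulus_def
proof (rule INF_greatest)
  let ?N = "CARD('n)"
  define X where "X = modulus_scale ?N \<delta> R (dist x y)"
  have "R > 0" using \<sigma>(2,3) by (auto simp: subset_iff dest!: bspec intro: order_le_less_trans[OF norm_ge_zero])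
  then have X: "X > 0" unfolding X_def using \<delta> dim by (intro modulus_scale_pos) auto
  let ?\<Gamma> = "path_family (path_image \<sigma>) (path_image \<omega>) UNIV"
  fix \<rho> :: "real^'n \<Rightarrow> ennreal" assume "\<rho> \<in> {\<rho>. admissible \<rho> (?\<Gamma>)}"
  then have \<rho>: "admissible \<rho> (?\<Gamma>)" by simp
  show "ennreal (1 / modulus_scale ?N \<delta> R (dist x y) ^ ?N) \<le> (\<integral>\<^sup>+x. \<rho> x ^ ?N \<partial>lborel)"
  proof (rule ccontr)
    assume "\<not> ?thesis"
    then have lt: "(\<integral>\<^sup>+x. \<rho> x ^ ?N \<partial>lborel) < ennreal (1 / X ^ ?N)" by (simp add: X_def)
    then obtain i where i: "(\<integral>\<^sup>+x. \<rho> x ^ ?N \<partial>lborel) = ennreal i" "i \<ge> 0"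
      by (cases "\<integral>\<^sup>+x. \<rho> x ^ ?N \<partial>lborel") auto
    have i2: "i < 1 / X ^ ?N" using lt i by (simp add: ennreal_less_iff)
    \<comment> \<open>The midpoint is positive even if the integral \<open>i\<close> vanishes, and
      it stays strictly below 1 / X^n, which gives the contradiction.\<close>
    define b where "b = (i + 1 / X ^ ?N) / 2"
    have b: "b > 0" "i \<le> b" "b < 1 / X ^ ?N" using i2 i(2) X by (auto simp: b_def intro: add_nonneg_pos)
    define a where "a = root ?N b"
    have a: "a > 0" "a ^ ?N = b" using b by (auto simp: a_def real_root_pow_pos2)
    have "1 \<le> a * X"
      unfolding X_def modulus_scale_def
      by (rule admissible_density_lower_bound[OF dim \<rho> a(1) _ \<sigma> \<omega> \<delta>]) (use i b a in \<open>auto intro: ennreal_leI\<close>)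
    then have "1 \<le> (a * X) ^ ?N" by (rule one_le_power)
    then have "1 \<le> b * X ^ ?N" using a by (simp add: power_mult_distrib)
    then show False using b(3) X by (simp add: field_simps)
  qed
qed

text \<open>The bound on \<open>A0\<close> comes from monotonicity: paths inside the image are among
  all paths, so with QED the full modulus k satisfies k \<le> A0 k, and k is positive by the lower
  bound and finite by the upper one.\<close>

lemma ring_family_modulus_bound:
  fixes D :: "(real^'n) set"
  assumes dim: "CARD('n) \<ge> 2" and D: "domain D" and x0: "Some x0 \<in> ext_boundary D"
    and Q: "Q \<in> borel_measurable lebesgue" "\<And>x. x \<notin> D \<Longrightarrow> Q x = 0"
    and r: "0 < r1" "r1 < r2" "r2 < r0" "r2 \<le> \<delta>" and \<kappa>: "\<kappa> \<ge> 0"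
    and vol: "\<And>t. 0 < t \<Longrightarrow> t \<le> r2 \<Longrightarrow> (\<integral>\<^sup>+x\<in>ball x0 t \<inter> D. Q x \<partial>lebesgue) \<le> ennreal (\<kappa> * t ^ CARD('n))"
    and conn: "connected (ball x0 r1 \<inter> D)"
    and f: "f \<in> ring_family r0 A0 R0 Q \<delta> D x0" and \<delta>: "\<delta> > 0" and A0: "A0 > 0"
    and xy: "x \<in> ball x0 r1 \<inter> D" "y \<in> ball x0 r1 \<inter> D" "f x \<noteq> f y"
  shows "1 / modulus_scale CARD('n) \<delta> R0 (dist (f x) (f y)) ^ CARD('n)
      \<le> A0 * (\<kappa> * (1 + real CARD('n) * ln (r2 / r1)) / ln (r2 / r1) ^ CARD('n))" (is "?lo \<le> A0 * ?up")
    and "A0 \<ge> 1"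
proof -
  have D': "open D" using D by (simp add: domain_def)
  have fc: "continuous_on D f" and fR: "f ` D \<subseteq> ball 0 R0" and fo: "open_mapping D f" "discrete_mapping D f" "closed_mapping D f"
    and fQ: "ring_Q_mapping r0 Q D x0 f" and qd: "QED A0 (f ` D)"
    using f by (auto simp: ring_family_def)
  obtain K where K: "continuum K" "path_connected K" "K \<subseteq> f ` D" "\<delta> \<le> diameter K"
    "ereal \<delta> \<le> chordal_setdist (Some ` (D \<inter> f -` K)) (ext_boundary D)"
    using f by (auto simp: ring_family_def)
  \<comment> \<open>A chordal distance is at most the Euclidean one, and \<open>x0\<close> is a
    boundary point, so the preimage of \<open>K\<close> lies at distance at least \<delta> from
    it.\<close>
  have far: "r2 \<le> norm (z - x0)" if "z \<in> D" "f z \<in> K" for z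
  proof -
    have "chordal_setdist (Some ` (D \<inter> f -` K)) (ext_boundary D) \<le> (INF p\<in>ext_boundary D. ereal (chordal (Some z) p))"
      unfolding chordal_setdist_def using that by (intro INF_lower) auto
    also have "\<dots> \<le> ereal (chordal (Some z) (Some x0))" using x0 by (rule INF_lower)
    finally have "ereal \<delta> \<le> ereal (chordal (Some z) (Some x0))" using K(5) by (rule order_trans[rotated])
    then have "\<delta> \<le> chordal (Some z) (Some x0)" by (simp only: ereal_less_eq)
    also have "\<dots> \<le> norm (z - x0)"
    proof -
      have "1 * 1 \<le> sqrt (1 + (norm z)\<^sup>2) * sqrt (1 + (norm x0)\<^sup>2)" by (intro mult_mono) auto
      then have "norm (z - x0) / (sqrt (1 + (norm z)\<^sup>2) * sqrt (1 + (norm x0)\<^sup>2)) \<le> norm (z - x0) / 1"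
        by (intro divide_left_mono) auto
      then show ?thesis by simp
    qed
    finally show ?thesis using r by simp
  qed
  have "path_connected (ball x0 r1 \<inter> D)" using conn D' by (intro connected_open_path_connected) auto
  then obtain s where s: "path s" "path_image s \<subseteq> ball x0 r1 \<inter> D" "pathstart s = x" "pathfinish s = y"
    using xy unfolding path_connected_def by blast
  define \<sigma> where "\<sigma> = f \<circ> s"
  have im: "path_image \<sigma> = f ` path_image s" by (simp add: \<sigma>_def path_image_compose)
  have \<sigma>: "path \<sigma>" unfolding \<sigma>_def using s(1,2) by (intro path_continuous_image continuous_on_subset[OF fc]) auto
  have \<sigma>D: "path_image \<sigma> \<subseteq> f ` D" using s(2) by (auto simp: im)
  have ends: "f x \<in> path_image \<sigma>" "f y \<in> path_image \<sigma>"
    using s(3,4) unfolding im by (auto simp: pathstart_in_path_image pathfinish_in_path_image)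
  have "K \<noteq> {}" using K(4) \<delta> by auto
  then obtain x' y' where xy': "x' \<in> K" "y' \<in> K" "dist x' y' = diameter K"
    using diameter_compact_attained[of K] K(1) by (auto simp: continuum_def)
  \<comment> \<open>The lower bound is stated for two paths. A path in \<open>K\<close> between
    points that realize the diameter stands in for \<open>K\<close>; passing from it to
    \<open>K\<close> can only raise the modulus.\<close>
  obtain \<omega> where \<omega>: "path \<omega>" "path_image \<omega> \<subseteq> K" "pathstart \<omega> = x'" "pathfinish \<omega> = y'"
    using K(2) xy' unfolding path_connected_def by blast
  define MR where "MR = conf_modulus (path_family (path_image \<sigma>) K UNIV)"
  define MD where "MD = conf_modulus (path_family (path_image \<sigma>) K (f ` D))"
  have "ennreal ?lo \<le> conf_modulus (path_family (path_image \<sigma>) (path_image \<omega>) UNIV)"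
  proof (rule conf_modulus_ge[OF dim \<sigma> _ ends xy(3) \<omega>(1) _ _ _ _ \<delta>])
    show "path_image \<sigma> \<subseteq> ball 0 R0" "path_image \<omega> \<subseteq> ball 0 R0" using \<sigma>D \<omega>(2) K(3) fR by blast+
    show "x' \<in> path_image \<omega>" "y' \<in> path_image \<omega>" using \<omega> by auto
    show "\<delta> \<le> dist x' y'" using xy' K(4) by simp
  qed
  also have "\<dots> \<le> MR" unfolding MR_def by (rule conf_modulus_mono) (use \<omega>(2) in \<open>auto simp: path_family_def\<close>)
  finally have lo: "ennreal ?lo \<le> MR" .
  have "MD \<le> conf_modulus ((\<lambda>\<gamma>. f \<circ> \<gamma>) ` path_family (sphere x0 r1) (sphere x0 r2) D)"
    unfolding MD_def im
    by (rule modulus_lift_le[OF proper_open_finite_mapI[OF D' fc fo] _ _ r(2) far])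
       (use s(2) in \<open>auto simp: subset_iff dist_norm norm_minus_commute\<close>)
  also have "\<dots> \<le> ennreal ?up" by (rule ring_modulus_le[OF Q fQ r(1-3) \<kappa> vol])
  finally have up: "MD \<le> ennreal ?up" .
  have "continuum (path_image \<sigma>)" using \<sigma> by (simp add: continuum_def compact_path_image connected_path_image)
  then have QED: "MR \<le> ennreal A0 * MD" unfolding MR_def MD_def
    using qd K(1,3) \<sigma>D unfolding QED_def by blast
  have L: "ln (r2 / r1) > 0" using r by simp
  have up0: "?up \<ge> 0" using \<kappa> L by (intro divide_nonneg_nonneg mult_nonneg_nonneg add_nonneg_nonneg) auto
  have R0: "R0 > 0" using fR xy by (auto simp: subset_iff intro: order_le_less_trans[OF norm_ge_zero])
  have lo0: "?lo > 0" using modulus_scale_pos[OF \<delta> R0, of "CARD('n)"] by simp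
  have MRup: "MR \<le> ennreal (A0 * ?up)"
  proof -
    have "ennreal A0 * MD \<le> ennreal A0 * ennreal ?up" by (intro mult_left_mono up) simp
    also have "\<dots> = ennreal (A0 * ?up)" using A0 up0 by (intro ennreal_mult[symmetric]) auto
    finally show ?thesis by (rule order_trans[OF QED])
  qed
  then have "ennreal ?lo \<le> ennreal (A0 * ?up)" using lo by (rule order_trans[rotated])
  then show "?lo \<le> A0 * ?up" using A0 up0 by (simp add: ennreal_le_iff del: times_divide_eq_right)
  have "MD \<le> MR" unfolding MD_def MR_def by (rule conf_modulus_mono) (auto simp: path_family_def)
  then have "MR \<le> ennreal A0 * MR" using QED by (meson mult_left_mono order_trans zero_le)
  moreover obtain k where k: "MR = ennreal k" "k \<ge> 0" using MRup by (cases MR) (auto simp: top_unique)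
  ultimately have "k \<le> A0 * k" using A0 by (simp add: ennreal_le_iff flip: ennreal_mult)
  moreover have "?lo \<le> k" using lo k by (simp add: ennreal_le_iff)
  then have "k > 0" using lo0 by (rule order_less_le_trans[rotated])
  ultimately show "A0 \<ge> 1" by simp
qed

section \<open>Comparing the two bounds\<close>

text \<open>Bounds the exponent times L in the case where the joining cost dominates the logarithmic
  term; \<theta> is the n-th root of the margin 4/3.\<close>

definition exponent_loss :: "nat \<Rightarrow> real \<Rightarrow> real \<Rightarrow> real" where
  "exponent_loss n \<delta> R = (let \<theta> = (4 / 3) powr (1 / real n) in
     (2 * real n * (real n + 1) * unit_ball_vol (real n) * ln 2 / 2 ^ (n + 1) *
       (join_const n \<delta> R * \<theta> / (\<theta> - 1)) ^ n) powr (1 / (real n - 1)))"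

lemma beta_exponent_pos: "n \<ge> 2 \<Longrightarrow> A0 > 0 \<Longrightarrow> C > 0 \<Longrightarrow> beta_exponent n A0 C > 0"
proof -
  assume "n \<ge> 2" "A0 > 0" "C > 0"
  then have "real n * ln 2 / (A0 * C * 2 ^ (n + 1)) > 0" by (intro divide_pos_pos mult_pos_pos) auto
  then show ?thesis unfolding beta_exponent_def by (intro powr_gt_zero[THEN iffD2]) linarith
qed

text \<open>Lets constants computed with \<open>A0 = 1\<close> serve all larger
  \<open>A0\<close>.\<close>

lemma beta_exponent_le:
  assumes "n \<ge> 2" "A0 \<ge> 1" "C > 0"
  shows "beta_exponent n A0 C \<le> beta_exponent n 1 C"
  unfolding beta_exponent_def
proof (intro powr_mono2 divide_left_mono)
  show "1 * C * 2 ^ (n + 1) \<le> A0 * C * 2 ^ (n + 1)" using assms by (intro mult_right_mono) auto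
qed (use assms in auto)

text \<open>The room in 2^(n+1): it absorbs 2 (n + 1) from the upper bound together with the margin
  4/3. Equality holds for n = 2, so 4/3 is the largest margin once ln 2 is bounded by 1.\<close>

lemma eight_mult_le_power: "n \<ge> 2 \<Longrightarrow> 8 * (real n + 1) \<le> 3 * 2 ^ (n + 1)"
  by (induction n rule: nat_induct_at_least) auto

text \<open>Writing \<open>X = J + z\<close> for the modulus scale, where \<open>z ^ n\<close> is the sharp main term, either \<open>J\<close> is
  negligible against \<open>z\<close>, at the price of the factor \<open>4 / 3\<close> in \<open>X ^ n\<close> which the constant
  \<open>2 ^ (n + 1)\<close> absorbs, or \<open>X\<close> is bounded.\<close>

lemma beta_exponent_log_le:
  assumes n: "n \<ge> 2" and pos: "\<delta> > 0" "R > 0" "C > 0" "A0 > 0" and d: "d > 0" "d \<le> 2 * R" and L: "L \<ge> 1"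
    and H: "1 / modulus_scale n \<delta> R d ^ n \<le> A0 * (2 * C * unit_ball_vol (real n) * (1 + real n * L) / L ^ n)"
  shows "beta_exponent n A0 C * L \<le> 1 + ln (2 * real n * R / d) + exponent_loss n \<delta> R"
proof -
  define V where "V = unit_ball_vol (real n)"
  define X where "X = modulus_scale n \<delta> R d"
  define J where "J = join_const n \<delta> R"
  define Y where "Y = 2 / real n + ln (2 * real n * R / d)"
  define z where "z = (real n * V) powr (- 1 / real n) * Y powr ((real n - 1) / real n)"
  define B where "B = real n * ln 2 / (A0 * C * 2 ^ (n + 1))"
  define coef where "coef = 2 * real n * (real n + 1) * V * ln 2 / 2 ^ (n + 1)"
  define \<theta> :: real where "\<theta> = (4 / 3) powr (1 / real n)"
  have V: "V > 0" unfolding V_def by (rule unit_ball_vol_pos) simp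
  have X: "X > 0" unfolding X_def using pos n by (intro modulus_scale_pos) auto
  have XJ: "X = J + z" by (simp add: X_def J_def z_def Y_def V_def modulus_scale_def)
  have J: "J > 0" unfolding J_def using pos n by (intro join_const_pos) auto
  have B: "B > 0" unfolding B_def using n pos by (intro divide_pos_pos mult_pos_pos) auto
  have coef: "coef > 0" unfolding coef_def using n V by (intro divide_pos_pos mult_pos_pos) auto
  have \<theta>: "\<theta> > 1" unfolding \<theta>_def using n by (intro gr_one_powr) auto
  have \<theta>n: "\<theta> ^ n = 4 / 3" unfolding \<theta>_def using n by (simp add: powr_powr flip: powr_realpow)
  have "d * 1 \<le> (2 * R) * real n" using d n by (intro mult_mono) auto
  then have "1 \<le> 2 * real n * R / d" using d by (simp add: field_simps)
  then have lnY: "ln (2 * real n * R / d) \<ge> 0" by simp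
  have Y: "Y > 0" unfolding Y_def using lnY n by (intro add_pos_nonneg) auto
  have Y1: "Y \<le> 1 + ln (2 * real n * R / d)" unfolding Y_def using n by simp
  have zn: "z ^ n = Y ^ (n - 1) / (real n * V)"
  proof -
    have "z ^ n = ((real n * V) powr (- 1 / real n)) ^ n * (Y powr ((real n - 1) / real n)) ^ n"
      by (simp add: z_def power_mult_distrib)
    also have "((real n * V) powr (- 1 / real n)) ^ n = (real n * V) powr (- 1)"
      using n V by (simp add: powr_powr flip: powr_realpow)
    also have "(Y powr ((real n - 1) / real n)) ^ n = Y powr (real n - 1)"
      using n Y by (simp add: powr_powr flip: powr_realpow)
    also have "Y powr (real n - 1) = Y ^ (n - 1)"
      using n powr_realpow[OF Y, of "n - 1"] by (simp add: of_nat_diff)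
    also have "(real n * V) powr (- 1) = 1 / (real n * V)" using n V by (simp add: powr_minus_divide)
    finally show ?thesis by simp
  qed
  \<comment> \<open>As L \<ge> 1, the sum 1 + n L is at most (n + 1) L, which leaves the power n - 1
    of L.\<close>
  have LX: "L ^ (n - 1) \<le> A0 * (2 * C * V * (real n + 1)) * X ^ n"
  proof -
    have "1 / X ^ n \<le> A0 * (2 * C * V * (1 + real n * L) / L ^ n)" using H by (simp add: X_def V_def)
    also have "\<dots> \<le> A0 * (2 * C * V * ((real n + 1) * L) / L ^ n)"
      using pos V L by (intro mult_left_mono divide_right_mono) (auto simp: algebra_simps)
    also have "L ^ n = L * L ^ (n - 1)" using n by (simp flip: power_Suc)
    finally have "1 / X ^ n \<le> A0 * (2 * C * V * (real n + 1)) / L ^ (n - 1)" using L by simp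
    then show ?thesis using X L by (simp add: field_simps)
  qed
  have BL: "B * L ^ (n - 1) \<le> coef * X ^ n"
  proof -
    have "B * L ^ (n - 1) \<le> B * (A0 * (2 * C * V * (real n + 1)) * X ^ n)"
      using B LX by (intro mult_left_mono) auto
    also have "\<dots> = coef * X ^ n" using pos by (simp add: B_def coef_def)
    finally show ?thesis .
  qed
  let ?q = "1 / (real n - 1)"
  have rootL: "(B * L ^ (n - 1)) powr ?q = beta_exponent n A0 C * L"
  proof -
    have "L ^ (n - 1) = L powr (real n - 1)"
      using powr_realpow[of L "n - 1"] L n by (simp add: of_nat_diff)
    then have "(L ^ (n - 1)) powr ?q = L" using L n by (simp add: powr_powr)
    moreover have "(B * L ^ (n - 1)) powr ?q = B powr ?q * (L ^ (n - 1)) powr ?q"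
      by (rule powr_mult)
    ultimately show ?thesis by (simp only: beta_exponent_def B_def)
  qed
  have loss: "exponent_loss n \<delta> R = (coef * (J * \<theta> / (\<theta> - 1)) ^ n) powr ?q"
    by (simp add: exponent_loss_def Let_def coef_def J_def \<theta>_def V_def)
  show ?thesis
  proof (cases "J \<le> (\<theta> - 1) * z")
    case True
    then have "X \<le> \<theta> * z" by (simp add: XJ algebra_simps)
    then have "X ^ n \<le> (\<theta> * z) ^ n" using X by (intro power_mono) auto
    also have "\<dots> = 4 / 3 * (Y ^ (n - 1) / (real n * V))" by (simp add: power_mult_distrib \<theta>n zn)
    finally have "B * L ^ (n - 1) \<le> coef * (4 / 3 * (Y ^ (n - 1) / (real n * V)))"
      using BL coef by (meson mult_left_mono order_trans less_imp_le)
    also have "\<dots> = (8 * (real n + 1) * ln 2 / (3 * 2 ^ (n + 1))) * Y ^ (n - 1)"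
      using n V by (simp add: coef_def field_simps)
    also have "\<dots> \<le> 1 * Y ^ (n - 1)"
    proof (intro mult_right_mono)
      have "8 * (real n + 1) * ln 2 \<le> 8 * (real n + 1) * 1"
        using ln_2_less_1 by (intro mult_left_mono) auto
      also have "\<dots> \<le> 3 * 2 ^ (n + 1)" using eight_mult_le_power[OF n] by simp
      finally show "8 * (real n + 1) * ln 2 / (3 * 2 ^ (n + 1)) \<le> 1"
        by (subst divide_le_eq_1_pos) auto
    qed (use Y in auto)
    finally have "B * L ^ (n - 1) \<le> Y ^ (n - 1)" by simp
    then have "(B * L ^ (n - 1)) powr ?q \<le> (Y ^ (n - 1)) powr ?q"
      using B L n by (intro powr_mono2) auto
    also have "\<dots> = Y"
    proof -
      have "Y ^ (n - 1) = Y powr (real n - 1)"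
        using powr_realpow[of Y "n - 1"] Y n by (simp add: of_nat_diff)
      then show ?thesis using Y n by (simp add: powr_powr)
    qed
    finally show ?thesis using Y1 unfolding rootL loss by (smt (verit) powr_ge_zero)
  next
    case False
    then have "z \<le> J / (\<theta> - 1)" using \<theta> by (simp add: field_simps)
    then have "X \<le> J + J / (\<theta> - 1)" by (simp add: XJ)
    also have "\<dots> = J * \<theta> / (\<theta> - 1)" using \<theta> by (simp add: field_simps)
    finally have "X ^ n \<le> (J * \<theta> / (\<theta> - 1)) ^ n" using X by (intro power_mono) auto
    then have "B * L ^ (n - 1) \<le> coef * (J * \<theta> / (\<theta> - 1)) ^ n"
      using BL coef by (meson mult_left_mono order_trans less_imp_le)
    then have "(B * L ^ (n - 1)) powr ?q \<le> exponent_loss n \<delta> R"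
      unfolding loss using B L n by (intro powr_mono2) auto
    then show ?thesis using lnY unfolding rootL by linarith
  qed
qed

section \<open>Exponentiating the comparison and fixing the constants\<close>

lemma powr_decay_bound:
  fixes a b d r1 r2 K :: real
  assumes "0 < d" "0 < a" "0 < r1" "0 < r2" and "b * ln (r2 / r1) \<le> K + ln (a / d)"
  shows "d \<le> a * exp K * (r1 / r2) powr b"
proof -
  have "ln (a / d) = ln a - ln d" using assms by (simp add: ln_div)
  then have "ln d \<le> ln a + K - b * ln (r2 / r1)" using assms(5) by linarith
  also have "ln (r2 / r1) = - ln (r1 / r2)" using assms by (simp add: ln_div)
  also have "ln a + K - b * - ln (r1 / r2) = ln (a * exp K * (r1 / r2) powr b)"
    using assms by (simp add: ln_mult ln_powr)
  finally show ?thesis using assms by (subst (asm) ln_le_cancel_iff) auto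
qed

text \<open>A limsup bound holds for all small radii only after giving up some slack;
  \<open>C\<close> is doubled, and the exponent has room for this factor.\<close>

lemma eventually_volume_bound:
  fixes x0 :: "real^'n"
  assumes C: "C > 0"
    and lim: "Limsup (at_right 0) (\<lambda>\<epsilon>. (\<integral>\<^sup>+x\<in>ball x0 \<epsilon> \<inter> D. Q x \<partial>lebesgue) /
                  ennreal (measure lebesgue (ball (0::real^'n) 1) * \<epsilon> ^ CARD('n))) \<le> ennreal C"
  obtains e where "e > 0" "\<And>t. 0 < t \<Longrightarrow> t < e \<Longrightarrow>
     (\<integral>\<^sup>+x\<in>ball x0 t \<inter> D. Q x \<partial>lebesgue) \<le> ennreal (2 * C * unit_ball_vol (real CARD('n)) * t ^ CARD('n))"
proof -
  define V where "V = unit_ball_vol (real CARD('n))"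
  have V: "V > 0" unfolding V_def by (rule unit_ball_vol_gt_0)
  have mV: "measure lebesgue (ball (0::real^'n) 1) = V"
    using content_ball[of 1 "0::real^'n"] by (simp add: V_def)
  let ?I = "\<lambda>t. \<integral>\<^sup>+x\<in>ball x0 t \<inter> D. Q x \<partial>lebesgue"
  have "ennreal C < ennreal (2 * C)" using C by (simp add: ennreal_less_iff)
  then have "eventually (\<lambda>t. ?I t / ennreal (V * t ^ CARD('n)) < ennreal (2 * C)) (at_right 0)"
    using lim unfolding mV by (intro Limsup_lessD) (rule order_le_less_trans)
  then obtain e where e: "e > 0" "\<And>t. 0 < t \<Longrightarrow> t < e \<Longrightarrow> ?I t / ennreal (V * t ^ CARD('n)) < ennreal (2 * C)"
    unfolding eventually_at_right_field by auto
  show thesis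
  proof (rule that[OF e(1)])
    fix t assume t: "0 < t" "t < e"
    let ?c = "V * t ^ CARD('n)"
    have c: "?c > 0" using V t by simp
    have "?I t = ?I t / ennreal ?c * ennreal ?c"
    proof -
      have "ennreal ?c \<noteq> 0" using c by (simp only: ennreal_eq_0_iff not_le)
      then have "ennreal ?c / ennreal ?c = 1" by (intro ennreal_divide_self) simp_all
      then show ?thesis by (simp only: ennreal_divide_times mult_1_right)
    qed
    also have "\<dots> \<le> ennreal (2 * C) * ennreal ?c" using e(2)[OF t] by (intro mult_right_mono) auto
    also have "\<dots> = ennreal (2 * C * unit_ball_vol (real CARD('n)) * t ^ CARD('n))"
      using C c by (simp add: V_def mult.assoc flip: ennreal_mult)
    finally show "?I t \<le> ennreal (2 * C * unit_ball_vol (real CARD('n)) * t ^ CARD('n))" .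
  qed
qed

text \<open>The radius \<open>\<epsilon>0\<close> is chosen before \<delta>, so pairs that are not
  close to \<open>x0\<close> on the scale \<open>r2\<close>, which depends on \<delta>, are handled
  by boundedness of the image alone. Likewise \<alpha> precedes \<open>A0\<close>; it is computed
  with the largest possible exponent \<open>b\<close>.\<close>

theorem theorem1p2:
  fixes D :: "(real^'n) set" and x0 :: "real^'n" and Q :: "real^'n \<Rightarrow> ennreal"
    and C r0 :: real
  assumes n: "CARD('n) \<ge> 2"
    and D: "domain D"
    and x0: "Some x0 \<in> ext_boundary D"
    and r0: "r0 > 0"
    and Q_measurable: "Q \<in> borel_measurable lebesgue"
    and Q_zero: "\<And>x. x \<notin> D \<Longrightarrow> Q x = 0"
    and cond1: "\<exists>r0'>0. \<forall>r. 0 < r \<and> r < r0' \<longrightarrow> connected (ball x0 r \<inter> D)"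
    and C: "C > 0"
    and cond2: "Limsup (at_right 0) (\<lambda>\<epsilon>. (\<integral>\<^sup>+x\<in>ball x0 \<epsilon> \<inter> D. Q x \<partial>lebesgue) /
                  ennreal (measure lebesgue (ball (0::real^'n) 1) * \<epsilon> ^ CARD('n))) \<le> ennreal C"
  shows "\<exists>\<epsilon>0>0. \<forall>\<delta>>0. \<forall>R0>0. \<exists>\<alpha>>0. \<forall>A0>0.
           \<forall>f \<in> ring_family r0 A0 R0 Q \<delta> D x0. \<forall>x \<in> ball x0 \<epsilon>0 \<inter> D. \<forall>y \<in> ball x0 \<epsilon>0 \<inter> D.
             norm (f x - f y) \<le> \<alpha> * max (norm (x - x0) powr beta_exponent CARD('n) A0 C)
                                         (norm (y - x0) powr beta_exponent CARD('n) A0 C)"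
proof -
  let ?N = "CARD('n)" and ?V = "unit_ball_vol (real CARD('n))"
  have oD: "open D" using D by (simp add: domain_def)
  have x0D: "x0 \<in> closure D" "x0 \<notin> D" using x0 Some_mem_ext_boundary_iff[OF oD] by auto
  obtain r' where r': "r' > 0" "\<And>r. 0 < r \<Longrightarrow> r < r' \<Longrightarrow> connected (ball x0 r \<inter> D)" using cond1 by blast
  obtain e where e: "e > 0" "\<And>t. 0 < t \<Longrightarrow> t < e \<Longrightarrow>
     (\<integral>\<^sup>+x\<in>ball x0 t \<inter> D. Q x \<partial>lebesgue) \<le> ennreal (2 * C * ?V * t ^ ?N)"
    using eventually_volume_bound[OF C cond2] by blast
  \<comment> \<open>The bound 1 makes \<open>2 / r2\<close> and \<open>6 / r2\<close> at least 1, so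
    that their powers increase with the exponent.\<close>
  define \<epsilon>0 where "\<epsilon>0 = min (min e r') (min r0 1)"
  have \<epsilon>0: "\<epsilon>0 > 0" "\<epsilon>0 \<le> e" "\<epsilon>0 \<le> r'" "\<epsilon>0 \<le> r0" "\<epsilon>0 \<le> 1" using e r' r0 by (auto simp: \<epsilon>0_def)
  show ?thesis
  proof (rule exI[of _ \<epsilon>0], intro conjI \<epsilon>0(1) allI impI)
    fix \<delta> R0 :: real assume \<delta>: "\<delta> > 0" and R0: "R0 > 0"
    \<comment> \<open>Halving keeps \<open>r2\<close> strictly below \<open>\<epsilon>0\<close>, and
      \<open>r2 \<le> \<delta>\<close> keeps the preimage of \<open>K\<close> at distance at least
      \<open>r2\<close> from \<open>x0\<close>.\<close>
    define r2 where "r2 = min \<epsilon>0 \<delta> / 2"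
    have r2: "r2 > 0" "r2 < \<epsilon>0" "r2 \<le> \<delta>" "r2 < 1" using \<epsilon>0 \<delta> by (auto simp: r2_def min_def)
    let ?a = "2 * real ?N * R0 * exp (1 + exponent_loss ?N \<delta> R0)"
    define b where "b = beta_exponent ?N 1 C"
    \<comment> \<open>\<open>c1\<close> serves pairs within \<open>r2 / 6\<close> of
      \<open>x0\<close>, \<open>c2\<close> all others; both use \<open>b\<close> in place of the
      exponent.\<close>
    define c1 where "c1 = ?a * (2 / r2) powr b"
    define c2 where "c2 = 2 * R0 * (6 / r2) powr b"
    have two: "2 / r2 \<ge> 1" "6 / r2 \<ge> 1" using r2 by auto
    have c1: "c1 \<ge> 0" unfolding c1_def using R0 by (intro mult_nonneg_nonneg) auto
    have c2: "c2 > 0" unfolding c2_def using R0 two r2 by (intro mult_pos_pos powr_gt_zero[THEN iffD2]) auto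
    define \<alpha> where "\<alpha> = max c1 c2"
    have \<alpha>: "\<alpha> > 0" "c1 \<le> \<alpha>" "c2 \<le> \<alpha>" using c2 by (auto simp: \<alpha>_def)
    show "\<exists>\<alpha>>0. \<forall>A0>0. \<forall>f \<in> ring_family r0 A0 R0 Q \<delta> D x0. \<forall>x \<in> ball x0 \<epsilon>0 \<inter> D. \<forall>y \<in> ball x0 \<epsilon>0 \<inter> D.
             norm (f x - f y) \<le> \<alpha> * max (norm (x - x0) powr beta_exponent ?N A0 C)
                                         (norm (y - x0) powr beta_exponent ?N A0 C)"
    proof (rule exI[of _ \<alpha>], intro conjI \<alpha>(1) allI impI ballI)
      fix A0 f x y assume A0: "A0 > 0" and f: "f \<in> ring_family r0 A0 R0 Q \<delta> D x0"
        and x: "x \<in> ball x0 \<epsilon>0 \<inter> D" and y: "y \<in> ball x0 \<epsilon>0 \<inter> D"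
      let ?\<beta> = "beta_exponent ?N A0 C"
      have fR: "f ` D \<subseteq> ball 0 R0" and fo: "open_mapping D f" using f by (auto simp: ring_family_def)
      have fdist: "dist (f u) (f v) < 2 * R0" if "u \<in> D" "v \<in> D" for u v
      proof -
        have "f u \<in> ball 0 R0" "f v \<in> ball 0 R0" using fR that by blast+
        then show ?thesis using norm_triangle_ineq4[of "f u" "f v"] by (simp add: dist_norm)
      qed
      have main: "1 / modulus_scale ?N \<delta> R0 (dist (f u) (f v)) ^ ?N
          \<le> A0 * (2 * C * ?V * (1 + real ?N * ln (r2 / r1)) / ln (r2 / r1) ^ ?N)" "A0 \<ge> 1"
        if r1: "0 < r1" "r1 < r2" and uv: "u \<in> ball x0 r1 \<inter> D" "v \<in> ball x0 r1 \<inter> D" "f u \<noteq> f v" for r1 u v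
      proof -
        have r20: "r2 < r0" using r2 \<epsilon>0 by simp
        have k: "0 \<le> 2 * C * ?V" using C by simp
        have vol: "(\<integral>\<^sup>+x\<in>ball x0 t \<inter> D. Q x \<partial>lebesgue) \<le> ennreal (2 * C * ?V * t ^ ?N)" if "0 < t" "t \<le> r2" for t
          using that r2 \<epsilon>0 by (intro e(2)) auto
        have conn: "connected (ball x0 r1 \<inter> D)" using r1 r2 \<epsilon>0 by (intro r'(2)) auto
        note * = ring_family_modulus_bound[OF n D x0 Q_measurable Q_zero r1 r20 r2(3) k vol conn f \<delta> A0 uv]
        show "1 / modulus_scale ?N \<delta> R0 (dist (f u) (f v)) ^ ?N
          \<le> A0 * (2 * C * ?V * (1 + real ?N * ln (r2 / r1)) / ln (r2 / r1) ^ ?N)" by (rule *(1))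
        show "A0 \<ge> 1" by (rule *(2))
      qed
      \<comment> \<open>The bound on \<open>A0\<close> requires two points with different values
        near \<open>x0\<close>. They exist because an open map is not constant on a nonempty open
        set.\<close>
      have A1: "A0 \<ge> 1"
      proof -
        let ?U = "ball x0 (r2 / 2) \<inter> D"
        have "x0 \<in> ball x0 (r2 / 2)" using r2 by simp
        then have "?U \<noteq> {}" using x0D(1) open_Int_closure_eq_empty[of "ball x0 (r2 / 2)" D] by blast
        then obtain u where u: "u \<in> ?U" by blast
        have op: "open (f ` ?U)"
          by (intro fo[unfolded open_mapping_def, rule_format] conjI open_Int open_ball oD Int_lower2)
        have "\<exists>v\<in>?U. f u \<noteq> f v"
        proof (rule ccontr)
          assume "\<not> (\<exists>v\<in>?U. f u \<noteq> f v)"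
          then have "f v = f u" if "v \<in> ?U" for v using that by metis
          then have "f ` ?U = (\<lambda>_. f u) ` ?U" by (rule image_cong[OF refl])
          also have "\<dots> = {f u}" using u by (rule image_constant)
          finally have eq: "f ` ?U = {f u}" .
          have "open {f u}" using op unfolding eq .
          then show False using not_open_singleton by blast
        qed
        then obtain v where v: "v \<in> ?U" "f u \<noteq> f v" by blast
        show ?thesis by (rule main(2)[OF _ _ u v]) (use r2 in auto)
      qed
      have \<beta>: "?\<beta> > 0" "?\<beta> \<le> b" unfolding b_def using n A1 C by (auto intro!: beta_exponent_pos beta_exponent_le)
      define r where "r = max (norm (x - x0)) (norm (y - x0))"
      have r: "r > 0" using x x0D(2) by (auto simp: r_def less_max_iff_disj)
      have rb: "r powr ?\<beta> \<le> max (norm (x - x0) powr ?\<beta>) (norm (y - x0) powr ?\<beta>)"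
        by (simp add: r_def max_def)
      have "dist (f x) (f y) \<le> \<alpha> * r powr ?\<beta>"
      proof (cases "f x = f y")
        case True
        then show ?thesis using \<alpha> by simp
      next
        case fxy: False
        show ?thesis
        \<comment> \<open>The inner radius will be \<open>2 * r\<close>, so that both points lie in
          the open ball; r < r2 / 6 then gives r2 / (2 r) > 3 > e, hence L \<ge> 1.\<close>
        proof (cases "r < r2 / 6")
          case True
          define L where "L = ln (r2 / (2 * r))"
          have "3 \<le> r2 / (2 * r)" using True r by (simp add: field_simps)
          with exp_le have "exp 1 \<le> r2 / (2 * r)" by (rule order_trans)
          then have L: "L \<ge> 1" unfolding L_def using r r2 by (subst ln_ge_iff) auto
          have mem: "x \<in> ball x0 (2 * r) \<inter> D" "y \<in> ball x0 (2 * r) \<inter> D"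
            using x y r by (auto simp: r_def dist_norm norm_minus_commute)
          have "1 / modulus_scale ?N \<delta> R0 (dist (f x) (f y)) ^ ?N
              \<le> A0 * (2 * C * ?V * (1 + real ?N * L) / L ^ ?N)"
            unfolding L_def by (rule main(1)[OF _ _ mem fxy]) (use r r2 True in auto)
          then have "?\<beta> * L \<le> 1 + ln (2 * real ?N * R0 / dist (f x) (f y)) + exponent_loss ?N \<delta> R0"
            using fdist[of x y] x y fxy by (intro beta_exponent_log_le n \<delta> R0 C A0 L) auto
          then have "?\<beta> * ln (r2 / (2 * r)) \<le> (1 + exponent_loss ?N \<delta> R0) + ln (2 * real ?N * R0 / dist (f x) (f y))"
            by (simp add: L_def)
          then have "dist (f x) (f y) \<le> ?a * (2 * r / r2) powr ?\<beta>"
            using fxy R0 r r2 by (intro powr_decay_bound) auto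
          also have "(2 * r / r2) powr ?\<beta> = (2 / r2) powr ?\<beta> * r powr ?\<beta>"
            using r r2 by (simp flip: powr_mult)
          also have "?a * ((2 / r2) powr ?\<beta> * r powr ?\<beta>) \<le> c1 * r powr ?\<beta>"
            unfolding c1_def using R0 two \<beta> by (simp only: mult.assoc[symmetric]) (intro mult_right_mono mult_left_mono powr_mono; simp)
          also have "\<dots> \<le> \<alpha> * r powr ?\<beta>" using \<alpha> by (intro mult_right_mono) auto
          finally show ?thesis .
        next
          \<comment> \<open>Now 6 r / r2 \<ge> 1, so the bound 2 R0 for distances in the image may
            be multiplied by its power.\<close>
          case False
          have "dist (f x) (f y) \<le> 2 * R0 * 1" using fdist[of x y] x y by simp
          also have "\<dots> \<le> 2 * R0 * (6 / r2 * r) powr ?\<beta>"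
            using False r2 R0 \<beta> by (intro mult_left_mono ge_one_powr_ge_zero) (auto simp: field_simps)
          also have "(6 / r2 * r) powr ?\<beta> = (6 / r2) powr ?\<beta> * r powr ?\<beta>"
            by (rule powr_mult)
          also have "2 * R0 * ((6 / r2) powr ?\<beta> * r powr ?\<beta>) \<le> c2 * r powr ?\<beta>"
            unfolding c2_def using R0 two \<beta> by (simp only: mult.assoc[symmetric]) (intro mult_right_mono mult_left_mono powr_mono; simp)
          also have "\<dots> \<le> \<alpha> * r powr ?\<beta>" using \<alpha> by (intro mult_right_mono) auto
          finally show ?thesis .
        qed
      qed
      also have "\<dots> \<le> \<alpha> * max (norm (x - x0) powr ?\<beta>) (norm (y - x0) powr ?\<beta>)"
        using rb \<alpha> by (intro mult_left_mono) auto
      finally show "norm (f x - f y) \<le> \<alpha> * max (norm (x - x0) powr ?\<beta>) (norm (y - x0) powr ?\<beta>)"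
        by (simp add: dist_norm)
    qed
  qed
qed

end
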